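(* Let $J$ be a bounded half-line Jacobi matrix with spectral measure $\rho$, let $N_j\to\infty$ be a sequence along which the limits described in the context exist, with associated functions $w_\pm$, $g$, $\gamma$, and put $Z=\{t\in\mathbb{R}:\gamma(t)=0\}$. There exists a Borel set $N\subset\mathbb{R}$, with $\operatorname{cap}(N)=0$, so that $\rho$ is supported by $Z\cup N$. In particular, $w_{\pm}, g\in\mathcal{N}(\Sigma_{ac})$.
   Context: $\operatorname{cap}$ denotes logarithmic capacity. A measure $\rho$ is supported by a measurable (not necessarily closed) set $S$ if $\rho(S^c)=0$. A Herglotz function is a holomorphic map $F$ of $\mathbb{C}^+=\{z\in\mathbb{C}:\operatorname{Im}z>0\}$ to itself; $F(t)=\lim_{y\to0+}F(t+iy)$ exists for almost every $t\in\mathbb{R}$. For $S\subset\mathbb{R}$, $\mathcal{N}(S)$ is the set of Herglotz functions $F$ with $\operatorname{Re}F(t)=0$ for almost every $t\in S$. The spectral measure of $J$ is $d\rho(t)=d\|E(t)\delta_1\|^2$, where $E$ is the spectral resolution of $J$. $\Sigma_{ac}$ is an essential support of the absolutely continuous part of $\rho$, determined up to Lebesgue null sets; a representative is $\Sigma_{ac}=\{t:d\rho/dt>0\}$. Setting: let $J$ be a half-line Jacobi matrix on $\ell_2(\mathbb{Z}_+)$, $\mathbb{Z}_+=\{1,2,\dots\}$: $(Ju)(n)=a(n)u(n+1)+a(n-1)u(n-1)+b(n)u(n)$ (term with $u(n-1)$ omitted for $n=1$), with real coefficients satisfying $(M+1)^{-1}\le a(n)\le M+1$, $|b(n)|\le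 M$ for some $M>0$. Put $a(0)=1$. For $z\in\mathbb{C}^+$ let $f_\pm(n,z)$ be the solutions of $a(n)f(n+1)+a(n-1)f(n-1)+b(n)f(n)=zf(n)$ ($n\ge1$) with $f_-(0,z)=0$, $f_-(1,z)=1$, $f_+(0,z)=1$, $f_+(1,z)=-\langle\delta_1,(J-z)^{-1}\delta_1\rangle$. Then $f_\pm(n,z)\ne0$ for $n\ge1$ and $z\mapsto\mp f_\pm(n+1,z)/f_\pm(n,z)$ are Herglotz functions. With the logarithm satisfying $\operatorname{Im}\ln\zeta\in(0,\pi)$ for $\zeta\in\mathbb{C}^+$, put $$w_\pm^{(N)}(z)=\frac1N\sum_{n=1}^N\ln\left[\mp\frac{f_\pm(n+1,z)}{f_\pm(n,z)}\right],\qquad g_N(z)=\frac1N\sum_{n=1}^N\langle\delta_n,(J-z)^{-1}\delta_n\rangle=\int_{\mathbb{R}}\frac{d\nu_N(t)}{t-z},$$ $d\nu_N(t)=\frac1N\sum_{n=1}^N d\|E(t)\delta_n\|^2$, and $dk_N=\frac1N\sum_{n=1}^N\delta_{\lambda_n^{(N)}}$, where $\lambda_1^{(N)},\dots,\lambda_N^{(N)}$ are the eigenvalues of the truncation of $J$ to $\ell_2(\{1,\dots,N\})$ (boundary conditions $u(0)=u(N+1)=0$). $N_j\to\infty$ is a fixed (otherwise arbitrary) sequence such that, as $j\to\infty$, $w_\pm^{(N_j)}\to w_\pm$ and $g_{N_j}\to g$ uniformly on compact subsets of $\mathbb{C}^+$ with Herglotz limits, $\nu_{N_j}$ and $dk_{N_j}$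 converge in weak $*$ sense to probability measures, and $(a(1)\cdots a(N_j))^{1/N_j}\to A>0$. Write $w_+=-\gamma+i\pi k$ with $\gamma,k$ real valued on $\mathbb{C}^+$, and put $\gamma(t)=\lim_{y\to0+}\gamma(t+iy)$ for $t\in\mathbb{R}$ (this limit exists for every $t$). *)

theory Defs
  imports
    "HOL-Probability.Probability"
    "HOL-Complex_Analysis.Complex_Analysis"
    "Jordan_Normal_Form.Char_Poly"
begin

section \<open>The Hilbert space of square summable sequences on the positive integers\<close>

text \<open>A sequence on \<open>{1, 2, \<dots>}\<close> is represented by a function on \<^typ>\<open>nat\<close> that vanishes at 0.\<close>

definition ell2 :: "(nat \<Rightarrow> complex) set" where
  "ell2 = {u. u 0 = 0 \<and> summable (\<lambda>n. (cmod (u n))\<^sup>2)}"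

definition ell2_inner :: "(nat \<Rightarrow> complex) \<Rightarrow> (nat \<Rightarrow> complex) \<Rightarrow> complex" where
  "ell2_inner u v = (\<Sum>n. cnj (u n) * v n)"

definition ell2_norm :: "(nat \<Rightarrow> complex) \<Rightarrow> real" where
  "ell2_norm u = sqrt (\<Sum>n. (cmod (u n))\<^sup>2)"

definition delta :: "nat \<Rightarrow> nat \<Rightarrow> complex" where
  "delta n = (\<lambda>m. if m = n then 1 else 0)"

section \<open>Spectral resolution, resolvent and spectral measures\<close>

definition ell2_projection :: "((nat \<Rightarrow> complex) \<Rightarrow> nat \<Rightarrow> complex) \<Rightarrow> bool" where
  "ell2_projection P \<longleftrightarrow>
     (\<forall>u\<in>ell2. P u \<in> ell2 \<and> P (P u) = P u) \<and>
     (\<forall>u\<in>ell2. \<forall>v\<in>ell2. \<forall>c d. P (\<lambda>n. c * u n + d * v n) = (\<lambda>n. c * P u n + d * P v n)) \<and>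
     (\<forall>u\<in>ell2. \<forall>v\<in>ell2. ell2_inner (P u) v = ell2_inner u (P v))"

text \<open>
  \<open>E\<close> is the (right continuous) resolution of the identity with \<open>T = \<integral> t dE(t)\<close>, for a bounded
  symmetric operator \<open>T\<close> on \<^const>\<open>ell2\<close>. The last clause is the identity \<open>T = \<integral> t dE(t)\<close> tested
  on the diagonal, with \<open>d\<parallel>E(t)u\<parallel>\<^sup>2\<close> the Lebesgue-Stieltjes measure of \<open>t \<mapsto> \<parallel>E(t)u\<parallel>\<^sup>2\<close>; by
  polarization this determines \<open>T\<close>.
\<close>

definition spectral_resolution ::
  "((nat \<Rightarrow> complex) \<Rightarrow> nat \<Rightarrow> complex) \<Rightarrow> (real \<Rightarrow> (nat \<Rightarrow> complex) \<Rightarrow> nat \<Rightarrow> complex) \<Rightarrow> bool" where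
  "spectral_resolution T E \<longleftrightarrow>
     (\<forall>t. ell2_projection (E t)) \<and>
     (\<forall>s t. s \<le> t \<longrightarrow> (\<forall>u\<in>ell2. E s (E t u) = E s u \<and> E t (E s u) = E s u)) \<and>
     (\<forall>t. \<forall>u\<in>ell2. ((\<lambda>s. ell2_norm (\<lambda>n. E s u n - E t u n)) \<longlongrightarrow> 0) (at_right t)) \<and>
     (\<forall>u\<in>ell2. ((\<lambda>s. ell2_norm (E s u)) \<longlongrightarrow> 0) at_bot) \<and>
     (\<forall>u\<in>ell2. ((\<lambda>s. ell2_norm (\<lambda>n. E s u n - u n)) \<longlongrightarrow> 0) at_top) \<and>
     (\<forall>u\<in>ell2. integrable (interval_measure (\<lambda>t. (ell2_norm (E t u))\<^sup>2)) (\<lambda>t. t) \<and>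
        complex_of_real (\<integral>t. t \<partial>interval_measure (\<lambda>t. (ell2_norm (E t u))\<^sup>2)) = ell2_inner u (T u))"

definition spectral_measure ::
  "(real \<Rightarrow> (nat \<Rightarrow> complex) \<Rightarrow> nat \<Rightarrow> complex) \<Rightarrow> real measure" where
  "spectral_measure E = interval_measure (\<lambda>t. (ell2_norm (E t (delta 1)))\<^sup>2)"

definition averaged_spectral_measure ::
  "(real \<Rightarrow> (nat \<Rightarrow> complex) \<Rightarrow> nat \<Rightarrow> complex) \<Rightarrow> nat \<Rightarrow> real measure" where
  "averaged_spectral_measure E N =
     interval_measure (\<lambda>t. (1 / real N) * (\<Sum>n=1..N. (ell2_norm (E t (delta n)))\<^sup>2))"

definition resolvent ::
  "((nat \<Rightarrow> complex) \<Rightarrow> nat \<Rightarrow> complex) \<Rightarrow> complex \<Rightarrow> (nat \<Rightarrow> complex) \<Rightarrow> nat \<Rightarrow> complex" where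
  "resolvent T z = the_inv_into ell2 (\<lambda>u n. T u n - z * u n)"

section \<open>Jacobi matrices\<close>

definition jacobi ::
  "(nat \<Rightarrow> real) \<Rightarrow> (nat \<Rightarrow> real) \<Rightarrow> (nat \<Rightarrow> complex) \<Rightarrow> nat \<Rightarrow> complex" where
  "jacobi a b u n =
     (if n = 0 then 0
      else of_real (a n) * u (n + 1)
         + (if n = 1 then 0 else of_real (a (n - 1)) * u (n - 1))
         + of_real (b n) * u n)"

text \<open>
  The solution of \<open>a(n) f(n+1) + a(n-1) f(n-1) + b(n) f(n) = z f(n)\<close>, \<open>n \<ge> 1\<close>, with initial
  values \<open>f(0) = c0\<close>, \<open>f(1) = c1\<close>.
\<close>

fun jacobi_solution ::
  "(nat \<Rightarrow> real) \<Rightarrow> (nat \<Rightarrow> real) \<Rightarrow> complex \<Rightarrow> complex \<Rightarrow> complex \<Rightarrow> nat \<Rightarrow> complex" where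
  "jacobi_solution a b z c0 c1 0 = c0"
| "jacobi_solution a b z c0 c1 (Suc 0) = c1"
| "jacobi_solution a b z c0 c1 (Suc (Suc n)) =
     ((z - of_real (b (Suc n))) * jacobi_solution a b z c0 c1 (Suc n)
       - of_real (a n) * jacobi_solution a b z c0 c1 n) / of_real (a (Suc n))"

lemma jacobi_solution_unique:
  assumes "\<And>n. n \<ge> 1 \<Longrightarrow> a n \<noteq> 0"
  shows "f = jacobi_solution a b z c0 c1 \<longleftrightarrow>
     f 0 = c0 \<and> f 1 = c1 \<and>
     (\<forall>n\<ge>1. of_real (a n) * f (n + 1) + of_real (a (n - 1)) * f (n - 1) + of_real (b n) * f n = z * f n)"
    (is "?L \<longleftrightarrow> ?R")
proof
  assume L: ?L
  have "of_real (a n) * f (n + 1) + of_real (a (n - 1)) * f (n - 1) + of_real (b n) * f n = z * f n"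
    if n: "n \<ge> 1" for n
  proof -
    from n obtain m where "n = Suc m" by (cases n) auto
    then show ?thesis using assms[OF n] L by (simp add: field_simps)
  qed
  with L show ?R by simp
next
  assume R: ?R
  have "f n = jacobi_solution a b z c0 c1 n" for n
  proof (induction n rule: induct_nat_012)
    case (ge2 n)
    have "of_real (a (Suc n)) * f (Suc (Suc n)) + of_real (a n) * f n + of_real (b (Suc n)) * f (Suc n)
            = z * f (Suc n)"
      using R[THEN conjunct2, THEN conjunct2, rule_format, of "Suc n"] by simp
    then have "of_real (a (Suc n)) * f (Suc (Suc n)) =
        (z - of_real (b (Suc n))) * f (Suc n) - of_real (a n) * f n"
      by (simp add: algebra_simps)
    moreover have "complex_of_real (a (Suc n)) \<noteq> 0" using assms[of "Suc n"] by simp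
    ultimately show ?case using ge2 by (simp add: field_simps)
  qed (use R in simp_all)
  then show ?L by blast
qed

definition f_minus :: "(nat \<Rightarrow> real) \<Rightarrow> (nat \<Rightarrow> real) \<Rightarrow> nat \<Rightarrow> complex \<Rightarrow> complex" where
  "f_minus a b n z = jacobi_solution a b z 0 1 n"

definition f_plus :: "(nat \<Rightarrow> real) \<Rightarrow> (nat \<Rightarrow> real) \<Rightarrow> nat \<Rightarrow> complex \<Rightarrow> complex" where
  "f_plus a b n z =
     jacobi_solution a b z 1 (- ell2_inner (delta 1) (resolvent (jacobi a b) z (delta 1))) n"

text \<open>\<^const>\<open>Ln\<close> is the principal branch, whose imaginary part on the upper half plane is in \<open>(0, \<pi>)\<close>.\<close>

definition w_plus_avg :: "(nat \<Rightarrow> real) \<Rightarrow> (nat \<Rightarrow> real) \<Rightarrow> nat \<Rightarrow> complex \<Rightarrow> complex" where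
  "w_plus_avg a b N z = (1 / of_nat N) * (\<Sum>n=1..N. Ln (- (f_plus a b (n + 1) z / f_plus a b n z)))"

definition w_minus_avg :: "(nat \<Rightarrow> real) \<Rightarrow> (nat \<Rightarrow> real) \<Rightarrow> nat \<Rightarrow> complex \<Rightarrow> complex" where
  "w_minus_avg a b N z = (1 / of_nat N) * (\<Sum>n=1..N. Ln (f_minus a b (n + 1) z / f_minus a b n z))"

definition green_avg :: "(nat \<Rightarrow> real) \<Rightarrow> (nat \<Rightarrow> real) \<Rightarrow> nat \<Rightarrow> complex \<Rightarrow> complex" where
  "green_avg a b N z =
     (1 / of_nat N) * (\<Sum>n=1..N. ell2_inner (delta n) (resolvent (jacobi a b) z (delta n)))"

text \<open>The entry \<open>(i, j)\<close> of a \<^const>\<open>Matrix.mat\<close> is indexed from 0 and belongs to the sites \<open>i + 1\<close>, \<open>j + 1\<close>.\<close>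

definition jacobi_truncation :: "(nat \<Rightarrow> real) \<Rightarrow> (nat \<Rightarrow> real) \<Rightarrow> nat \<Rightarrow> real mat" where
  "jacobi_truncation a b N = Matrix.mat N N (\<lambda>(i, j).
     if j = i then b (i + 1)
     else if j = i + 1 then a (i + 1)
     else if i = j + 1 then a (j + 1)
     else 0)"

text \<open>
  The measure \<open>(1/N) \<Sum>\<^sub>n \<delta>(\<lambda>\<^sub>n)\<close> over the eigenvalues \<open>\<lambda>\<^sub>1, \<dots>, \<lambda>\<^sub>N\<close> of the truncation, listed with
  multiplicity (for a real symmetric matrix, the multiset \<^const>\<open>proots\<close> has size \<open>N\<close>).
\<close>

definition eigenvalue_counting_measure :: "(nat \<Rightarrow> real) \<Rightarrow> (nat \<Rightarrow> real) \<Rightarrow> nat \<Rightarrow> real measure" where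
  "eigenvalue_counting_measure a b N =
     distr (measure_pmf (pmf_of_multiset (proots (char_poly (jacobi_truncation a b N))))) borel (\<lambda>t. t)"

section \<open>Herglotz functions and modes of convergence\<close>

definition upper_half_plane :: "complex set" where
  "upper_half_plane = {z. 0 < Im z}"

definition herglotz :: "(complex \<Rightarrow> complex) \<Rightarrow> bool" where
  "herglotz F \<longleftrightarrow> F holomorphic_on upper_half_plane \<and> F ` upper_half_plane \<subseteq> upper_half_plane"

definition boundary_value :: "(complex \<Rightarrow> 'a::t2_space) \<Rightarrow> real \<Rightarrow> 'a" where
  "boundary_value F t = Lim (at_right 0) (\<lambda>y. F (Complex t y))"

definition herglotz_N :: "real set \<Rightarrow> (complex \<Rightarrow> complex) set" where
  "herglotz_N S = {F. herglotz F \<and> (AE t in lborel. t \<in> S \<longrightarrow> Re (boundary_value F t) = 0)}"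

definition converges_locally_uniformly ::
  "(nat \<Rightarrow> complex \<Rightarrow> complex) \<Rightarrow> (complex \<Rightarrow> complex) \<Rightarrow> bool" where
  "converges_locally_uniformly F f \<longleftrightarrow>
     (\<forall>K. compact K \<and> K \<subseteq> upper_half_plane \<longrightarrow> uniform_limit K F f sequentially)"

definition weak_star_convergent :: "(nat \<Rightarrow> real measure) \<Rightarrow> real measure \<Rightarrow> bool" where
  "weak_star_convergent \<mu> \<mu>' \<longleftrightarrow>
     (\<forall>\<phi> :: real \<Rightarrow> real. continuous_on UNIV \<phi> \<and> compact (closure {t. \<phi> t \<noteq> 0}) \<longrightarrow>
        (\<lambda>j. \<integral>t. \<phi> t \<partial>\<mu> j) \<longlonglongrightarrow> (\<integral>t. \<phi> t \<partial>\<mu>'))"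

section \<open>Supports\<close>

text \<open>Measurability is required because \<^const>\<open>emeasure\<close> is 0 on nonmeasurable sets.\<close>

definition supported_by :: "real measure \<Rightarrow> real set \<Rightarrow> bool" where
  "supported_by \<mu> S \<longleftrightarrow> S \<in> sets \<mu> \<and> emeasure \<mu> (space \<mu> - S) = 0"

text \<open>\<open>\<alpha>\<close> is the absolutely continuous part of \<open>\<mu>\<close> in its Lebesgue decomposition \<open>\<mu> = \<alpha> + \<sigma>\<close>.\<close>

definition is_ac_part :: "real measure \<Rightarrow> real measure \<Rightarrow> bool" where
  "is_ac_part \<mu> \<alpha> \<longleftrightarrow>
     sets \<alpha> = sets borel \<and> absolutely_continuous lborel \<alpha> \<and>
     (\<exists>\<sigma>. sets \<sigma> = sets borel \<and> (\<exists>B\<in>null_sets lborel. supported_by \<sigma> B) \<and>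
        (\<forall>A\<in>sets borel. emeasure \<mu> A = emeasure \<alpha> A + emeasure \<sigma> A))"

text \<open>A support that is minimal up to Lebesgue null sets.\<close>

definition essential_support :: "real measure \<Rightarrow> real set \<Rightarrow> bool" where
  "essential_support \<alpha> S \<longleftrightarrow>
     supported_by \<alpha> S \<and>
     (\<forall>T. T \<subseteq> S \<and> supported_by \<alpha> T \<longrightarrow> emeasure lborel (S - T) = 0)"

text \<open>The two notions above are not vacuous for finite Borel measures.\<close>

lemma ex_essential_support_ac_part:
  fixes \<mu> :: "real measure"
  assumes fin: "finite_measure \<mu>" and sets_mu [measurable_cong]: "sets \<mu> = sets borel"
  shows "\<exists>\<alpha> S. is_ac_part \<mu> \<alpha> \<and> essential_support \<alpha> S"
proof -
  interpret finite_measure \<mu> by (rule fin)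
  have space_mu [simp]: "space \<mu> = UNIV" using sets_eq_imp_space_eq[OF sets_mu] by simp
  define s where "s = (SUP B\<in>null_sets lborel. emeasure \<mu> B)"
  have ne: "null_sets (lborel :: real measure) \<noteq> {}" by blast
  obtain F :: "nat \<Rightarrow> ennreal" where F: "range F \<subseteq> emeasure \<mu> ` null_sets lborel" "s = (SUP i. F i)"
    using ennreal_SUP_countable_SUP[OF ne, of "emeasure \<mu>"] unfolding s_def by (elim exE conjE)
  have "\<forall>i. \<exists>B. B \<in> null_sets lborel \<and> F i = emeasure \<mu> B" using F(1) by blast
  then obtain C where C: "\<And>i. C i \<in> null_sets lborel" "\<And>i. F i = emeasure \<mu> (C i)" by metis
  define B where "B = (\<Union>i. C i)"
  have B_null: "B \<in> null_sets lborel" unfolding B_def by (intro null_sets_UN C)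
  then have B_sets [measurable]: "B \<in> sets borel" by (metis null_setsD2 sets_lborel)
  have C_sets: "C i \<in> sets borel" for i using null_setsD2[OF C(1)] by simp
  have sB: "s \<le> emeasure \<mu> B"
    unfolding F(2)
  proof (rule SUP_least)
    fix i
    show "F i \<le> emeasure \<mu> B" unfolding C(2)
      by (rule emeasure_mono) (use B_sets in \<open>simp_all add: B_def sets_mu UN_upper\<close>)
  qed
  have key: "emeasure \<mu> (A - B) = 0" if A: "A \<in> null_sets lborel" for A
  proof -
    have [measurable]: "A \<in> sets borel" using null_setsD2[OF A] by simp
    have "A \<union> B \<in> null_sets lborel" using A B_null by (rule null_sets.Un)
    then have "emeasure \<mu> (A \<union> B) \<le> s" unfolding s_def by (rule SUP_upper)
    also have "\<dots> \<le> emeasure \<mu> B" by (rule sB)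
    finally have "emeasure \<mu> (B \<union> (A - B)) \<le> emeasure \<mu> B" by (simp add: Un_commute)
    moreover have "emeasure \<mu> (B \<union> (A - B)) = emeasure \<mu> B + emeasure \<mu> (A - B)"
      by (rule plus_emeasure[symmetric]) (auto simp: sets_mu)
    ultimately have "emeasure \<mu> B + emeasure \<mu> (A - B) \<le> emeasure \<mu> B + 0" by simp
    then show ?thesis using emeasure_finite[of B] by (simp add: ennreal_add_left_cancel_le)
  qed
  define \<alpha> where "\<alpha> = density \<mu> (indicator (- B))"
  define \<sigma> where "\<sigma> = density \<mu> (indicator B)"
  have sets_al [measurable_cong]: "sets \<alpha> = sets borel" and sets_si: "sets \<sigma> = sets borel"
    by (simp_all add: \<alpha>_def \<sigma>_def sets_mu)
  have al: "emeasure \<alpha> A = emeasure \<mu> (A - B)" if [measurable]: "A \<in> sets borel" for A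
  proof -
    have "emeasure \<alpha> A = (\<integral>\<^sup>+x. indicator (- B) x * indicator A x \<partial>\<mu>)"
      unfolding \<alpha>_def by (rule emeasure_density) (auto simp: sets_mu)
    also have "\<dots> = (\<integral>\<^sup>+x. indicator (A - B) x \<partial>\<mu>)"
      by (intro nn_integral_cong) (auto simp: indicator_def)
    finally show ?thesis by (simp add: sets_mu)
  qed
  have si: "emeasure \<sigma> A = emeasure \<mu> (A \<inter> B)" if [measurable]: "A \<in> sets borel" for A
  proof -
    have "emeasure \<sigma> A = (\<integral>\<^sup>+x. indicator B x * indicator A x \<partial>\<mu>)"
      unfolding \<sigma>_def by (rule emeasure_density) (auto simp: sets_mu)
    also have "\<dots> = (\<integral>\<^sup>+x. indicator (A \<inter> B) x \<partial>\<mu>)"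
      by (intro nn_integral_cong) (auto simp: indicator_def)
    finally show ?thesis by (simp add: sets_mu)
  qed
  have ac: "absolutely_continuous lborel \<alpha>"
    unfolding absolutely_continuous_def
  proof
    fix A :: "real set" assume A: "A \<in> null_sets lborel"
    then have "A \<in> sets borel" using null_setsD2[OF A] by simp
    then show "A \<in> null_sets \<alpha>" using key[OF A] by (intro null_setsI) (auto simp: al sets_al)
  qed
  have "supported_by \<sigma> B"
    using sets_eq_imp_space_eq[OF sets_si] by (simp add: supported_by_def sets_si si Compl_eq_Diff_UNIV[symmetric])
  moreover have "emeasure \<mu> A = emeasure \<alpha> A + emeasure \<sigma> A" if [measurable]: "A \<in> sets borel" for A
  proof -
    have "emeasure \<mu> (A - B) + emeasure \<mu> (A \<inter> B) = emeasure \<mu> ((A - B) \<union> (A \<inter> B))"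
      by (rule plus_emeasure) (auto simp: sets_mu)
    moreover have "(A - B) \<union> (A \<inter> B) = A" by blast
    ultimately show ?thesis by (simp add: al si)
  qed
  ultimately have part: "is_ac_part \<mu> \<alpha>"
    unfolding is_ac_part_def using sets_al sets_si ac B_null by blast
  define f where "f = RN_deriv lborel \<alpha>"
  have f [measurable]: "f \<in> borel_measurable borel"
    unfolding f_def using borel_measurable_RN_deriv[of lborel \<alpha>] by simp
  have dens: "density lborel f = \<alpha>"
    unfolding f_def by (rule sigma_finite_measure.density_RN_deriv[OF lborel.sigma_finite_measure_axioms]) (auto simp: ac sets_al)
  have null_iff: "emeasure \<alpha> A = 0 \<longleftrightarrow> (AE x in lborel. x \<in> A \<longrightarrow> f x = 0)"
    if [measurable]: "A \<in> sets borel" for A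
  proof -
    have "emeasure \<alpha> A = (\<integral>\<^sup>+x. f x * indicator A x \<partial>lborel)"
      unfolding dens[symmetric] by (rule emeasure_density) auto
    also have "\<dots> = 0 \<longleftrightarrow> (AE x in lborel. f x * indicator A x = 0)"
      by (rule nn_integral_0_iff_AE) measurable
    also have "\<dots> \<longleftrightarrow> (AE x in lborel. x \<in> A \<longrightarrow> f x = 0)"
      by (rule AE_cong) (auto simp: indicator_def)
    finally show ?thesis .
  qed
  define S where "S = {x. f x \<noteq> 0}"
  have S [measurable]: "S \<in> sets borel"
  proof -
    have "S = {x \<in> space borel. f x \<noteq> 0}" by (simp add: S_def)
    also have "\<dots> \<in> sets borel" by measurable
    finally show ?thesis .
  qed
  have space_al: "space \<alpha> = UNIV" using sets_eq_imp_space_eq[OF sets_al] by simp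
  have "essential_support \<alpha> S"
    unfolding essential_support_def
  proof (intro conjI allI impI)
    show "supported_by \<alpha> S"
      unfolding supported_by_def space_al by (simp add: sets_al null_iff) (simp add: S_def)
    fix T assume T: "T \<subseteq> S \<and> supported_by \<alpha> T"
    then have [measurable]: "T \<in> sets borel" by (simp add: supported_by_def sets_al)
    have "AE x in lborel. x \<in> UNIV - T \<longrightarrow> f x = 0"
      using T by (subst null_iff[symmetric]) (auto simp: supported_by_def space_al)
    then have "AE x in lborel. x \<notin> S - T" by eventually_elim (auto simp: S_def)
    moreover have "S - T \<in> sets lborel" by simp
    ultimately show "emeasure lborel (S - T) = 0" using AE_iff_measurable[of "S - T" lborel "\<lambda>x. x \<notin> S - T"]
      by (simp add: set_diff_eq)
  qed
  with part show ?thesis by blast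
qed

section \<open>Logarithmic capacity\<close>

text \<open>
  The energy \<open>I(\<mu>) = \<integral>\<integral> log (1 / \<bar>x - y\<bar>) d\<mu>(x) d\<mu>(y)\<close> of a measure, as the difference of the
  positive and the negative part. The second is finite for a finite \<open>\<mu>\<close> with compact support.
  On the diagonal the kernel is \<open>\<infinity>\<close>, whereas \<^term>\<open>ln (0::real) = 0\<close>.
\<close>

definition log_energy :: "'a::real_normed_field measure \<Rightarrow> ereal" where
  "log_energy \<mu> =
     enn2ereal (\<integral>\<^sup>+x. \<integral>\<^sup>+y. (if x = y then \<infinity> else ennreal (- ln (dist x y))) \<partial>\<mu> \<partial>\<mu>)
     - enn2ereal (\<integral>\<^sup>+x. \<integral>\<^sup>+y. (if x = y then 0 else ennreal (ln (dist x y))) \<partial>\<mu> \<partial>\<mu>)"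

definition compactly_carried_probabilities :: "'a::real_normed_field set \<Rightarrow> 'a measure set" where
  "compactly_carried_probabilities S =
     {\<mu>. prob_space \<mu> \<and> sets \<mu> = sets borel \<and> (\<exists>K. compact K \<and> K \<subseteq> S \<and> emeasure \<mu> K = 1)}"

text \<open>
  \<open>cap S = sup exp (-I(\<mu>))\<close> over the probability measures \<open>\<mu>\<close> carried by compact subsets
  of \<open>S\<close> (the inner capacity). For a subset of the real line it makes no difference whether the
  measures live on the line or in the plane.
\<close>

definition log_capacity :: "'a::real_normed_field set \<Rightarrow> ennreal" where
  "log_capacity S =
     (SUP \<mu>\<in>compactly_carried_probabilities S.
        if log_energy \<mu> = \<infinity> then 0 else ennreal (exp (- real_of_ereal (log_energy \<mu>))))"

end

theory Submission
  imports Defs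
begin

text \<open>
Write \<open>p\<^sub>N(z) = f\<^sub>-(N+1, z)\<close>, a polynomial of degree \<open>N\<close> with real zeros, and \<open>f\<^sub>+\<close> for the Weyl solution.

\<^emph>\<open>The exponent as a growth rate.\<close> The logarithms defining the averages telescope, so that
\<open>Re w\<^sub>-\<close> is the limit of \<open>(1/N) ln \<bar>p\<^sub>N\<bar>\<close>. At a fixed \<open>z\<close> in the upper half plane the diagonal Green function
\<open>-f\<^sub>-(n)f\<^sub>+(n)\<close> is bounded, and bounded away from 0; hence \<open>\<gamma> = -Re w\<^sub>+ = Re w\<^sub>-\<close>. Since \<open>p\<^sub>N\<close> has
only real zeros, \<open>\<gamma>(t+iy)\<close> increases with \<open>y\<close>; it is nonnegative because \<open>\<bar>p\<^sub>N(z)\<bar>\<close> stays away from 0. So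
\<open>\<gamma>(t)\<close> exists for every real \<open>t\<close> and \<open>\<gamma>(t) \<ge> 0\<close>.

\<^emph>\<open>The support.\<close> The \<open>p\<^sub>N\<close> are orthonormal for \<open>\<rho>\<close>, and \<open>\<integral> p\<^sub>N\<^sup>2 d\<rho> = 1\<close> forces \<open>\<bar>p\<^sub>N(t)\<bar> \<le> C\<^sub>t (N+1)\<close> for \<open>\<rho>\<close>-almost
every \<open>t\<close> (lemma \<open>AE_growth\<close>). It remains to see that the set where this bound holds and nevertheless \<open>\<gamma>(t) > 0\<close> has
capacity zero (lemma \<open>capacity_zero_polynomial_growth\<close>), which is a case of the upper envelope theorem. Moving from
\<open>t\<close> to \<open>t+iy\<close> increases \<open>(1/N) ln \<bar>p\<^sub>N\<bar>\<close> by the average of the kernel \<open>ln(1 + y\<^sup>2/(t-\<lambda>)\<^sup>2)/2\<close> over the zeros \<open>\<lambda>\<close>.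
Any measure of finite energy can be cut down to a compact set \<open>K\<close> of positive measure
on which the integral of that kernel over \<open>t \<in> K\<close> tends to 0 as \<open>y \<rightarrow> 0\<close>, uniformly in \<open>\<lambda>\<close>
(lemma \<open>log_potential_uniformly_small\<close>). For \<open>K\<close> inside the exceptional set two applications of Fatou's lemma give
\<open>\<integral>\<^sub>K \<gamma>(t) d\<mu> \<le> 0\<close>, a contradiction.

\<^emph>\<open>The boundary values.\<close> Sets of capacity zero are Lebesgue null, so almost every point of \<open>\<Sigma>\<^sub>a\<^sub>c\<close> lies in \<open>Z\<close>. The integral
over \<open>t\<close> of the kernel is a constant times \<open>y\<close>, hence by Fatou \<open>liminf \<gamma>(t+iy)/y\<close> is finite
for almost every \<open>t \<in> Z\<close>. Now \<open>iw\<^sub>-\<close> and \<open>-iw\<^sub>+\<close> are Herglotz functions with imaginary part \<open>\<gamma>\<close>, and the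
Julia-Caratheodory theorem (lemma \<open>julia_caratheodory_radial\<close>) says that at such \<open>t\<close> they and their derivatives have real radial limits.
By the Christoffel-Darboux formula \<open>g = -w\<^sub>-'\<close>, so that the radial limits of \<open>w\<^sub>+\<close>, \<open>w\<^sub>-\<close> and \<open>g\<close> all are purely imaginary.
\<close>

section \<open>The Schwarz-Pick inequality and radial Julia-Caratheodory limits\<close>

lemma uhp_iff [simp]: "z \<in> upper_half_plane \<longleftrightarrow> 0 < Im z"
  by (simp add: upper_half_plane_def)

lemma open_upper_half_plane: "open upper_half_plane"
  unfolding upper_half_plane_def by (rule open_halfspace_Im_gt)

text \<open>
Relates the pseudo-hyperbolic distance \<open>\<bar>z - w\<bar> / \<bar>z - cnj w\<bar>\<close> to the quotient \<open>\<bar>z - w\<bar>\<^sup>2 / (Im z Im w)\<close>.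
\<close>

lemma norm_diff_cnj_sq: "(cmod (z - cnj w))\<^sup>2 = (cmod (z - w))\<^sup>2 + 4 * (Im z * Im w)"
  by (simp only: cmod_power2) (simp add: power2_eq_square algebra_simps)

text \<open>
The Schwarz lemma transported to the half plane by Cayley transforms, in the form without denominators.
\<close>

lemma schwarz_pick:
  assumes h: "herglotz h" and z: "0 < Im z" and w: "0 < Im w"
  shows "(cmod (h z - h w))\<^sup>2 * (Im z * Im w) \<le> (cmod (z - w))\<^sup>2 * (Im (h z) * Im (h w))"
proof -
  have hol: "h holomorphic_on upper_half_plane" and im: "\<And>z. 0 < Im z \<Longrightarrow> 0 < Im (h z)"
    using h by (auto simp: herglotz_def image_subset_iff)
  \<comment> \<open>\<open>p\<close> maps the unit disk to the upper half plane and 0 to \<open>w\<close>.\<close>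
  define p where "p \<zeta> = (w - cnj w * \<zeta>) / (1 - \<zeta>)" for \<zeta>
  define f where "f \<zeta> = (h (p \<zeta>) - h w) / (h (p \<zeta>) - cnj (h w))" for \<zeta>
  have ne1: "1 - \<zeta> \<noteq> 0" if "cmod \<zeta> < 1" for \<zeta> using that by auto
  have imp: "0 < Im (p \<zeta>)" if "cmod \<zeta> < 1" for \<zeta>
  proof -
    have "Im (p \<zeta>) = Im ((w - cnj w * \<zeta>) * cnj (1 - \<zeta>)) / (cmod (1 - \<zeta>))\<^sup>2"
      unfolding p_def by (subst complex_div_cnj) (simp add: Im_divide_of_real flip: of_real_power)
    also have "Im ((w - cnj w * \<zeta>) * cnj (1 - \<zeta>)) = Im w * (1 - (cmod \<zeta>)\<^sup>2)"
      by (simp only: cmod_power2) (simp add: power2_eq_square algebra_simps)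
    finally show ?thesis using ne1[OF that] w that by (simp add: power_less_one_iff abs_square_less_1)
  qed
  have den: "h (p \<zeta>) - cnj (h w) \<noteq> 0" if "cmod \<zeta> < 1" for \<zeta>
  proof
    assume "h (p \<zeta>) - cnj (h w) = 0"
    then have "Im (h (p \<zeta>) - cnj (h w)) = 0" by simp
    then show False using im[OF imp[OF that]] im[OF w] by simp
  qed
  have holp: "p holomorphic_on ball 0 1"
    unfolding p_def using ne1 by (intro holomorphic_intros) auto
  have holhp: "(\<lambda>\<zeta>. h (p \<zeta>)) holomorphic_on ball 0 1"
    using holomorphic_on_compose_gen[OF holp hol] imp by (auto simp: o_def image_subset_iff)
  have "f holomorphic_on ball 0 1"
    unfolding f_def using den by (intro holomorphic_intros holhp) auto
  moreover have "f 0 = 0" by (simp add: f_def p_def)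
  moreover have "cmod (f \<zeta>) < 1" if "cmod \<zeta> < 1" for \<zeta>
  proof -
    have "(cmod (h (p \<zeta>) - h w))\<^sup>2 < (cmod (h (p \<zeta>) - cnj (h w)))\<^sup>2"
      using im[OF imp[OF that]] im[OF w] by (simp add: norm_diff_cnj_sq)
    then have "cmod (h (p \<zeta>) - h w) < cmod (h (p \<zeta>) - cnj (h w))"
      by (rule power_less_imp_less_base) simp
    then show ?thesis using den[OF that] by (simp add: f_def norm_divide)
  qed
  moreover define \<zeta> where "\<zeta> = (z - w) / (z - cnj w)"
  have zw: "z - cnj w \<noteq> 0"
    using z w by (metis add_pos_pos cnj.simps(2) diff_minus_eq_add eq_iff_diff_eq_0 less_irrefl minus_complex.simps(2) zero_complex.simps(2))
  have "(cmod (z - w))\<^sup>2 < (cmod (z - cnj w))\<^sup>2" using z w by (simp add: norm_diff_cnj_sq)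
  then have "cmod (z - w) < cmod (z - cnj w)" by (rule power_less_imp_less_base) simp
  then have z1: "cmod \<zeta> < 1" using zw by (simp add: \<zeta>_def norm_divide)
  have "cmod (f \<zeta>) \<le> cmod \<zeta>" using Schwarz_Lemma(1)[of f \<zeta>] calculation z1 by blast
  moreover have "p \<zeta> = z"
  proof -
    have "1 - \<zeta> = (w - cnj w) / (z - cnj w)" using zw by (simp add: \<zeta>_def field_simps)
    moreover have "w - cnj w * \<zeta> = z * (w - cnj w) / (z - cnj w)" using zw by (simp add: \<zeta>_def field_simps)
    moreover have "w - cnj w \<noteq> 0" using w by (auto simp: complex_eq_iff)
    ultimately show ?thesis using zw by (simp add: p_def)
  qed
  ultimately have "cmod (h z - h w) / cmod (h z - cnj (h w)) \<le> cmod (z - w) / cmod (z - cnj w)"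
    by (simp add: f_def \<zeta>_def norm_divide)
  moreover have "h z - cnj (h w) \<noteq> 0" using den[OF z1] \<open>p \<zeta> = z\<close> by simp
  ultimately have "cmod (h z - h w) * cmod (z - cnj w) \<le> cmod (z - w) * cmod (h z - cnj (h w))"
    using zw by (simp add: field_simps)
  then have "(cmod (h z - h w) * cmod (z - cnj w))\<^sup>2 \<le> (cmod (z - w) * cmod (h z - cnj (h w)))\<^sup>2"
    by (intro power_mono) auto
  then show ?thesis by (simp add: power_mult_distrib norm_diff_cnj_sq algebra_simps)
qed

text \<open>
The infinitesimal form follows from the two-point form as \<open>w \<rightarrow> z\<close>. Adding \<open>i\<epsilon>\<close> to \<open>k\<close> admits functions that
take real values.
\<close>

lemma schwarz_pick_deriv:
  assumes hol: "k holomorphic_on upper_half_plane" and im: "\<And>z. 0 < Im z \<Longrightarrow> 0 \<le> Im (k z)"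
    and z: "0 < Im z"
  shows "cmod (deriv k z) * Im z \<le> Im (k z)"
proof (rule field_le_epsilon)
  fix e :: real assume e: "e > 0"
  define h where "h z = k z + \<i> * of_real e" for z
  have her: "herglotz h" unfolding herglotz_def h_def
    using e im by (auto intro!: holomorphic_intros hol add_nonneg_pos)
  have dk: "(k has_field_derivative deriv k z) (at z)"
    by (rule holomorphic_derivI[OF hol open_upper_half_plane]) (use z in simp)
  then have dh: "(h has_field_derivative deriv k z) (at z)"
    unfolding h_def by (auto intro!: derivative_eq_intros)
  have quot: "((\<lambda>w. (h w - h z) / (w - z)) \<longlongrightarrow> deriv k z) (at z)"
    using dh by (simp add: has_field_derivative_iff)
  have cont: "(h \<longlongrightarrow> h z) (at z)" using dh DERIV_isCont isCont_def by blast
  have l1: "((\<lambda>w. (cmod ((h w - h z) / (w - z)))\<^sup>2 * (Im w * Im z)) \<longlongrightarrow> (cmod (deriv k z))\<^sup>2 * (Im z * Im z)) (at z)"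
    by (intro tendsto_intros quot)
  have l2: "((\<lambda>w. Im (h w) * Im (h z)) \<longlongrightarrow> Im (h z) * Im (h z)) (at z)"
    by (intro tendsto_intros cont)
  have ev: "eventually (\<lambda>w. w \<in> upper_half_plane \<and> w \<noteq> z) (at z)"
    by (intro eventually_conj eventually_at_in_open' open_upper_half_plane)
       (use z in \<open>auto simp: eventually_at_filter\<close>)
  have "(cmod (deriv k z))\<^sup>2 * (Im z * Im z) \<le> Im (h z) * Im (h z)"
  proof (rule tendsto_le[OF _ l2 l1])
    show "\<forall>\<^sub>F w in at z. (cmod ((h w - h z) / (w - z)))\<^sup>2 * (Im w * Im z) \<le> Im (h w) * Im (h z)"
      using ev
    proof eventually_elim
      case (elim w)
      have "(cmod (h w - h z))\<^sup>2 * (Im w * Im z) \<le> (cmod (w - z))\<^sup>2 * (Im (h w) * Im (h z))"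
        by (rule schwarz_pick[OF her]) (use elim z in auto)
      then show ?case using elim by (simp add: norm_divide power_divide field_simps)
    qed
  qed simp
  then have "(cmod (deriv k z) * Im z)\<^sup>2 \<le> (Im (h z))\<^sup>2" by (simp add: power2_eq_square algebra_simps)
  then have "cmod (deriv k z) * Im z \<le> Im (h z)"
    by (rule power2_le_imp_le) (use im[OF z] e in \<open>simp add: h_def\<close>)
  then show "cmod (deriv k z) * Im z \<le> Im (k z) + e" by (simp add: h_def)
qed

text \<open>
The hypothesis reads \<open>A/B + B/A \<le> y/u + u/y\<close>, which confines \<open>A/B\<close> to the interval \<open>[u/y, y/u]\<close>.
\<close>

lemma ratio_bound:
  fixes A B y u :: real
  assumes "A > 0" "B > 0" "0 < u" "u \<le> y" "(A - B)\<^sup>2 * (y * u) \<le> (y - u)\<^sup>2 * (A * B)"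
  shows "A / y \<le> B / u"
proof (rule ccontr)
  assume "\<not> A / y \<le> B / u"
  then have lt: "B * y < A * u" using assms by (simp add: field_simps)
  have "(A * u - B * y) * (A * y - B * u) = (A - B)\<^sup>2 * (y * u) - (y - u)\<^sup>2 * (A * B)"
    by (simp add: power2_eq_square algebra_simps)
  then have "(A * u - B * y) * (A * y - B * u) \<le> 0" using assms by linarith
  then have le: "A * y \<le> B * u" using lt by (simp add: mult_le_0_iff)
  have "B * y < A * u" by (rule lt)
  also have "\<dots> \<le> A * y" using assms by (intro mult_left_mono) auto
  also have "\<dots> \<le> B * u" by (rule le)
  also have "\<dots> \<le> B * y" using assms by (intro mult_left_mono) auto
  finally show False by simp
qed

text \<open>
The idea of the proof: by Schwarz-Pick \<open>q(y) = Im h(t+iy)/y\<close> decreases in \<open>y\<close>, so the bound along one sequence makes \<open>q\<close>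
bounded with a limit \<open>c\<close> at 0, and \<open>h(t+iy)\<close> is Lipschitz in \<open>y\<close> with a real limit \<open>l\<close>. The limiting case of
Schwarz-Pick is Julia's inequality; it says that \<open>k = 1/(c(z-t)) - 1/(h-l)\<close> has nonnegative imaginary part.
Since \<open>y Im k(t+iy) \<rightarrow> 0\<close>, the infinitesimal Schwarz-Pick inequality for \<open>k\<close> shows \<open>y\<^sup>2 k'(t+iy) \<rightarrow> 0\<close>,
and solving for \<open>h'\<close> gives \<open>h'(t+iy) \<rightarrow> c\<close>.
\<close>

lemma julia_caratheodory_radial:
  assumes h: "herglotz h" and fin: "\<And>n. 0 < y n" "y \<longlonglongrightarrow> 0"
    and bd: "\<And>n. Im (h (Complex t (y n))) \<le> C * y n"
  obtains h0 c where "((\<lambda>y. h (Complex t y)) \<longlongrightarrow> complex_of_real h0) (at_right 0)"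
    "((\<lambda>y. deriv h (Complex t y)) \<longlongrightarrow> complex_of_real c) (at_right 0)"
proof -
  have hol: "h holomorphic_on upper_half_plane" and im: "\<And>z. 0 < Im z \<Longrightarrow> 0 < Im (h z)"
    using h by (auto simp: herglotz_def image_subset_iff)
  define H where "H y = h (Complex t y)" for y
  define q where "q y = Im (H y) / y" for y
  have Hpos: "0 < Im (H y)" if "0 < y" for y using im that by (simp add: H_def)
  have qpos: "0 < q y" if "0 < y" for y using Hpos that by (simp add: q_def)
  have sp: "(cmod (H y - H u))\<^sup>2 * (y * u) \<le> (y - u)\<^sup>2 * (Im (H y) * Im (H u))" if "0 < y" "0 < u" for y u
  proof -
    have "cmod (Complex t y - Complex t u) = \<bar>y - u\<bar>"
      by (simp add: complex_diff cmod_def)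
    then show ?thesis using schwarz_pick[OF h, of "Complex t y" "Complex t u"] that by (simp add: H_def)
  qed
  have qmono: "q y \<le> q u" if "0 < u" "u \<le> y" for u y
    unfolding q_def
  proof (rule ratio_bound)
    have "(Im (H y) - Im (H u))\<^sup>2 \<le> (cmod (H y - H u))\<^sup>2"
      using abs_Im_le_cmod[of "H y - H u"] by (simp add: abs_le_square_iff[symmetric])
    then have "(Im (H y) - Im (H u))\<^sup>2 * (y * u) \<le> (cmod (H y - H u))\<^sup>2 * (y * u)"
      using that by (intro mult_right_mono) auto
    also have "\<dots> \<le> (y - u)\<^sup>2 * (Im (H y) * Im (H u))" using sp that by simp
    finally show "(Im (H y) - Im (H u))\<^sup>2 * (y * u) \<le> (y - u)\<^sup>2 * (Im (H y) * Im (H u))" .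
  qed (use that Hpos in auto)
  have qC: "q u \<le> C" if "0 < u" for u
  proof -
    from order_tendstoD(2)[OF fin(2) that] obtain n where "y n < u"
      by (auto simp: eventually_sequentially)
    then have "q u \<le> q (y n)" using fin(1)[of n] by (intro qmono) auto
    also have "\<dots> \<le> C" using bd[of n] fin(1)[of n] by (simp add: q_def H_def field_simps)
    finally show ?thesis .
  qed
  define c where "c = (SUP u\<in>{0<..}. q u)"
  have bdd: "bdd_above (q ` {0<..})" using qC by (auto intro!: bdd_aboveI2)
  have qc: "q u \<le> c" if "0 < u" for u
    unfolding c_def using that bdd by (intro cSUP_upper) auto
  have cpos: "0 < c" using qpos[of 1] qc[of 1] by simp
  have qlim: "(q \<longlongrightarrow> c) (at_right 0)"
  proof (rule order_tendstoI)
    fix x assume "x < c"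
    then obtain u where u: "0 < u" "x < q u" unfolding c_def using less_cSUP_iff[OF _ bdd, of x] by auto
    show "eventually (\<lambda>y. x < q y) (at_right 0)"
      using eventually_at_right_real[OF u(1)]
      by eventually_elim (use u qmono in \<open>auto intro: less_le_trans\<close>)
  next
    fix x assume "c < x"
    show "eventually (\<lambda>y. q y < x) (at_right 0)"
      using eventually_at_right_less by eventually_elim (use qc \<open>c < x\<close> in \<open>auto intro: le_less_trans\<close>)
  qed
  have H2: "(cmod (H y - H u))\<^sup>2 \<le> (y - u)\<^sup>2 * (q y * q u)" if "0 < y" "0 < u" for y u
    using sp[OF that] that by (simp add: q_def field_simps)
  have Hlip: "cmod (H y - H u) \<le> c * \<bar>y - u\<bar>" if "0 < y" "0 < u" for y u
  proof (rule power2_le_imp_le)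
    have "q y * q u \<le> c * c" using qc qpos that cpos by (intro mult_mono) (auto intro: less_imp_le)
    then have "(y - u)\<^sup>2 * (q y * q u) \<le> (y - u)\<^sup>2 * (c * c)" by (intro mult_left_mono) auto
    with H2[OF that] show "(cmod (H y - H u))\<^sup>2 \<le> (c * \<bar>y - u\<bar>)\<^sup>2"
      by (simp add: power_mult_distrib power2_eq_square algebra_simps)
  qed (use cpos in auto)
  have uc: "uniformly_continuous_on {0<..} H"
    unfolding uniformly_continuous_on_def
  proof (intro allI impI)
    fix e :: real assume e: "e > 0"
    show "\<exists>d>0. \<forall>x\<in>{0<..}. \<forall>x'\<in>{0<..}. dist x' x < d \<longrightarrow> dist (H x') (H x) < e"
    proof (intro exI[of _ "e / c"] conjI ballI impI)
      fix x x' :: real assume *: "x \<in> {0<..}" "x' \<in> {0<..}" "dist x' x < e / c"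
      have "dist (H x') (H x) \<le> c * dist x' x" using Hlip[of x' x] * by (simp add: dist_norm dist_real_def)
      also have "\<dots> < e" using * cpos by (simp add: field_simps)
      finally show "dist (H x') (H x) < e" .
    qed (use e cpos in auto)
  qed
  obtain l where l: "(H \<longlongrightarrow> l) (at_right 0)"
    using uniformly_continuous_on_extension_at_closure[OF uc, of 0] by auto
  have ev0: "eventually (\<lambda>y::real. 0 < y) (at_right 0)" by (rule eventually_at_right_less)
  have Imq: "((\<lambda>y. y * q y) \<longlongrightarrow> 0 * c) (at_right 0)"
    by (intro tendsto_intros qlim tendsto_ident_at)
  have "((\<lambda>y. Im (H y)) \<longlongrightarrow> 0 * c) (at_right 0)"
    by (rule Lim_transform_eventually[OF Imq]) (use ev0 in \<open>eventually_elim, auto simp: q_def\<close>)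
  moreover have "((\<lambda>y. Im (H y)) \<longlongrightarrow> Im l) (at_right 0)" by (intro tendsto_intros l)
  ultimately have Iml: "Im l = 0" using tendsto_unique[of "at_right (0::real)"] by fastforce
  \<comment> \<open>Julia's inequality, from Schwarz-Pick for \<open>z\<close> and \<open>t + iu\<close> as \<open>u \<rightarrow> 0\<close>.\<close>
  have julia: "(cmod (h z - l))\<^sup>2 * Im z \<le> (cmod (z - of_real t))\<^sup>2 * (c * Im (h z))" if z: "0 < Im z" for z
  proof (rule tendsto_le[of "at_right (0::real)"])
    have cx: "((\<lambda>u. Complex t u) \<longlongrightarrow> of_real t) (at_right 0)"
      unfolding tendsto_complex_iff by (auto intro!: tendsto_intros)
    show "((\<lambda>u. (cmod (h z - H u))\<^sup>2 * Im z) \<longlongrightarrow> (cmod (h z - l))\<^sup>2 * Im z) (at_right 0)"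
      by (intro tendsto_intros l)
    show "((\<lambda>u. (cmod (z - Complex t u))\<^sup>2 * (q u * Im (h z))) \<longlongrightarrow> (cmod (z - of_real t))\<^sup>2 * (c * Im (h z))) (at_right 0)"
      by (intro tendsto_intros qlim cx)
    show "\<forall>\<^sub>F u in at_right 0. (cmod (h z - H u))\<^sup>2 * Im z \<le> (cmod (z - Complex t u))\<^sup>2 * (q u * Im (h z))"
      using ev0
    proof eventually_elim
      case (elim u)
      then show ?case using schwarz_pick[OF h z, of "Complex t u"] by (simp add: H_def q_def field_simps)
    qed
  qed simp
  have hl: "h z - l \<noteq> 0" if "0 < Im z" for z
  proof
    assume "h z - l = 0"
    then have "Im (h z - l) = 0" by simp
    then show False using im[OF that] Iml by simp
  qed
  have zt: "z - of_real t \<noteq> 0" if "0 < Im z" for z using that by (auto simp: complex_eq_iff)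
  have zt_eq: "Complex t y - of_real t = \<i> * of_real y" for y by (simp add: complex_eq_iff)
  have zt_norm: "cmod (Complex t y - of_real t) = y" if "0 < y" for y
    using that by (simp add: zt_eq norm_mult)
  define k :: "complex \<Rightarrow> complex" where "k z = 1 / (of_real c * (z - of_real t)) - 1 / (h z - l)" for z
  have holk: "k holomorphic_on upper_half_plane"
    unfolding k_def using hl zt cpos by (intro holomorphic_intros hol) auto
  have Imk: "Im (k z) = Im (h z) / (cmod (h z - l))\<^sup>2 - Im z / (c * (cmod (z - of_real t))\<^sup>2)" if z: "0 < Im z" for z
  proof -
    have 1: "Im (1 / w) = - Im w / (cmod w)\<^sup>2" for w :: complex
      by (simp add: Im_divide cmod_power2)
    have "1 / (of_real c * (z - of_real t)) = of_real (1 / c) * (1 / (z - of_real t))" by simp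
    then have "Im (1 / (of_real c * (z - of_real t))) = 1 / c * Im (1 / (z - of_real t))" by (simp only: scaleR_conv_of_real[symmetric] scaleR_complex.simps)
    then show ?thesis unfolding k_def by (simp add: 1 Iml)
  qed
  have Imk0: "0 \<le> Im (k z)" if z: "0 < Im z" for z
    using julia[OF z] hl[OF z] zt[OF z] cpos by (simp add: Imk[OF z] field_simps)
  have dk: "cmod (deriv k z) * Im z \<le> Im (k z)" if "0 < Im z" for z
    by (rule schwarz_pick_deriv[OF holk Imk0 that])
  \<comment> \<open>Julia's inequality bounds \<open>\<bar>D\<bar>\<^sup>2\<close> by \<open>c q\<close>, while \<open>Im D = q \<rightarrow> c\<close>; so nothing is left for \<open>Re D\<close>.\<close>
  define D where "D y = (H y - l) / of_real y" for y
  have ImD: "Im (D y) = q y" if "0 < y" for y by (simp add: D_def q_def Iml)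
  have D2: "(cmod (D y))\<^sup>2 \<le> c * q y" if y: "0 < y" for y
    using julia[of "Complex t y"] y
    by (simp add: D_def q_def H_def norm_divide power_divide zt_norm field_simps power2_eq_square)
  have Dlim: "(D \<longlongrightarrow> \<i> * c) (at_right 0)"
  proof -
    have r2: "((\<lambda>y. c * q y - (q y)\<^sup>2) \<longlongrightarrow> c * c - c\<^sup>2) (at_right 0)"
      by (intro tendsto_intros qlim)
    have "((\<lambda>y. (Re (D y))\<^sup>2) \<longlongrightarrow> 0) (at_right 0)"
    proof (rule tendsto_sandwich[OF _ _ tendsto_const])
      show "\<forall>\<^sub>F y in at_right 0. (Re (D y))\<^sup>2 \<le> c * q y - (q y)\<^sup>2"
        using ev0 by eventually_elim (use D2 ImD in \<open>auto simp: cmod_power2 add_le_imp_le_diff\<close>)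
      show "((\<lambda>y. c * q y - (q y)\<^sup>2) \<longlongrightarrow> 0) (at_right 0)" using r2 by (simp add: power2_eq_square)
    qed auto
    then have "((\<lambda>y. sqrt ((Re (D y))\<^sup>2)) \<longlongrightarrow> sqrt 0) (at_right 0)" by (intro tendsto_intros)
    then have "((\<lambda>y. Re (D y)) \<longlongrightarrow> 0) (at_right 0)"
      using tendsto_rabs_zero_iff by fastforce
    moreover have "((\<lambda>y. Im (D y)) \<longlongrightarrow> c) (at_right 0)"
      by (rule Lim_transform_eventually[OF qlim]) (use ev0 in \<open>eventually_elim, auto simp: ImD\<close>)
    ultimately show ?thesis by (simp add: tendsto_complex_iff)
  qed
  have kl: "((\<lambda>y. (of_real y)\<^sup>2 * deriv k (Complex t y)) \<longlongrightarrow> 0) (at_right 0)"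
  proof (rule tendsto_0_le[where K = 1])
    have "((\<lambda>y. 1 / q y - 1 / c) \<longlongrightarrow> 1 / c - 1 / c) (at_right 0)"
      by (intro tendsto_intros qlim) (use cpos in auto)
    then show "((\<lambda>y. 1 / q y - 1 / c) \<longlongrightarrow> 0) (at_right 0)" by simp
    show "\<forall>\<^sub>F y in at_right 0. norm ((of_real y)\<^sup>2 * deriv k (Complex t y)) \<le> norm (1 / q y - 1 / c) * 1"
      using ev0
    proof eventually_elim
      case (elim y)
      have "y * y * cmod (deriv k (Complex t y)) \<le> y * Im (k (Complex t y))"
        using dk[of "Complex t y"] elim by (simp add: mult_left_mono mult.commute mult.left_commute)
      also have "\<dots> = y * Im (H y) / (cmod (H y - l))\<^sup>2 - 1 / c"
        using elim by (simp add: Imk H_def[symmetric] zt_norm right_diff_distrib power2_eq_square)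
      also have "y * Im (H y) / (cmod (H y - l))\<^sup>2 \<le> y * Im (H y) / (Im (H y))\<^sup>2"
        using abs_Im_le_cmod[of "H y - l"] Hpos[OF elim] elim Iml
        by (intro divide_left_mono power_mono mult_pos_pos) (auto intro: zero_less_power)
      also have "\<dots> = 1 / q y" using Hpos[OF elim] by (simp add: q_def power2_eq_square)
      finally have "y * y * cmod (deriv k (Complex t y)) \<le> 1 / q y - 1 / c" by simp
      then show ?case by (simp add: norm_mult norm_power power2_eq_square)
    qed
  qed
  have derh: "deriv h (Complex t y) = (D y)\<^sup>2 * ((of_real y)\<^sup>2 * deriv k (Complex t y) - of_real (1 / c))" if y: "0 < y" for y
  proof -
    let ?z = "Complex t y"
    have z: "0 < Im ?z" using y by simp
    have dh: "(h has_field_derivative deriv h ?z) (at ?z)"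
      by (rule holomorphic_derivI[OF hol open_upper_half_plane]) (use z in simp)
    have "(k has_field_derivative (- c / (c * (?z - of_real t))\<^sup>2 + deriv h ?z / (h ?z - l)\<^sup>2)) (at ?z)"
      unfolding k_def using hl[OF z] zt[OF z] cpos
      by (auto intro!: derivative_eq_intros dh simp: power2_eq_square)
    then have "deriv k ?z = - c / (c * (?z - of_real t))\<^sup>2 + deriv h ?z / (h ?z - l)\<^sup>2" by (rule DERIV_imp_deriv)
    moreover have "- of_real c / (of_real c * (\<i> * of_real y))\<^sup>2 = (1 / (of_real c * (of_real y)\<^sup>2) :: complex)"
      using cpos y by (simp add: power_mult_distrib) (simp add: power2_eq_square)
    ultimately have "deriv k ?z - 1 / (of_real c * (of_real y)\<^sup>2) = deriv h ?z / (h ?z - l)\<^sup>2"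
      by (simp add: zt_eq)
    then have "deriv h ?z = (h ?z - l)\<^sup>2 * (deriv k ?z - 1 / (of_real c * (of_real y)\<^sup>2))"
      using hl[OF z] by simp
    also have "\<dots> = (D y)\<^sup>2 * ((of_real y)\<^sup>2 * (deriv k ?z - 1 / (of_real c * (of_real y)\<^sup>2)))"
      using y by (simp add: D_def H_def power_divide)
    also have "(of_real y)\<^sup>2 * (deriv k ?z - 1 / (of_real c * (of_real y)\<^sup>2)) = (of_real y)\<^sup>2 * deriv k ?z - of_real (1 / c)"
      using y cpos by (simp add: right_diff_distrib)
    finally show ?thesis .
  qed
  have "((\<lambda>y. (D y)\<^sup>2 * ((of_real y)\<^sup>2 * deriv k (Complex t y) - of_real (1 / c))) \<longlongrightarrow> (\<i> * c)\<^sup>2 * (0 - of_real (1 / c))) (at_right 0)"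
    by (intro tendsto_intros Dlim kl)
  then have "((\<lambda>y. deriv h (Complex t y)) \<longlongrightarrow> (\<i> * c)\<^sup>2 * (0 - of_real (1 / c))) (at_right 0)"
    by (rule Lim_transform_eventually) (use ev0 in \<open>eventually_elim, auto simp: derh\<close>)
  moreover have "(\<i> * c)\<^sup>2 * (0 - of_real (1 / c)) = complex_of_real c" using cpos by (simp add: power2_eq_square)
  moreover have "l = of_real (Re l)" using Iml by (simp add: complex_eq_iff)
  ultimately show ?thesis using l that[of "Re l" c] unfolding H_def by metis
qed

section \<open>The logarithmic kernel and sets of capacity zero\<close>

text \<open>
The increment of \<open>ln \<bar>z\<bar>\<close> from \<open>z = t\<close> to \<open>z = t + iy\<close>. For \<open>y = 1\<close> it exceeds the negative part of
\<open>ln \<bar>t\<bar>\<close> by at most 1, so it tests finiteness of the logarithmic energy; for \<open>t \<noteq> 0\<close> it decreases to 0 as \<open>y \<rightarrow> 0\<close>.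
\<close>

definition log_kernel :: "real \<Rightarrow> real \<Rightarrow> ennreal" where
  "log_kernel y t = (if t = 0 then \<infinity> else ennreal (ln (1 + (y / t)\<^sup>2) / 2))"

lemma compact_subset_positive:
  fixes M :: "real measure"
  assumes "sets M = sets borel" "emeasure M UNIV \<noteq> \<infinity>" "B \<in> sets borel" "emeasure M B > 0"
  obtains K where "compact K" "K \<subseteq> B" "emeasure M K > 0"
proof -
  have "emeasure M B = (SUP K \<in> {K. K \<subseteq> B \<and> compact K}. emeasure M K)"
    using assms sets_eq_imp_space_eq[OF assms(1)] by (intro inner_regular) auto
  then show ?thesis using assms(4) that by (auto simp: less_SUP_iff)
qed

lemma log_kernel_measurable [measurable]: "log_kernel y \<in> borel_measurable borel"
  unfolding log_kernel_def by measurable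

lemma log_kernel_mono:
  assumes "0 < y" "0 < y'" "y * \<bar>s\<bar> \<le> y' * \<bar>t\<bar>"
  shows "log_kernel y t \<le> log_kernel y' s"
proof (cases "s = 0")
  case False
  then have t: "t \<noteq> 0" using assms by (auto simp: mult_le_0_iff)
  have "\<bar>y / t\<bar> \<le> \<bar>y' / s\<bar>" using assms False t by (simp add: abs_divide field_simps)
  then have "(y / t)\<^sup>2 \<le> (y' / s)\<^sup>2" by (simp only: abs_le_square_iff)
  then have "ln (1 + (y / t)\<^sup>2) \<le> ln (1 + (y' / s)\<^sup>2)"
    by (subst ln_le_cancel_iff) (auto intro: add_pos_nonneg)
  then show ?thesis using False t by (simp add: log_kernel_def ennreal_leI)
qed (simp add: log_kernel_def)

lemma log_kernel_sym: "log_kernel y (t - s) = log_kernel y (s - t)"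
  by (auto simp: log_kernel_def power_divide power2_commute)

lemma log_kernel_ln_norm:
  fixes t l y :: real
  assumes "t \<noteq> l"
  shows "log_kernel y (t - l) = ennreal (ln (cmod (Complex t y - of_real l)) - ln \<bar>t - l\<bar>)"
proof -
  have n: "cmod (Complex t y - of_real l) = sqrt ((t - l)\<^sup>2 + y\<^sup>2)"
    by (simp add: cmod_def)
  have "(t - l)\<^sup>2 + y\<^sup>2 = (t - l)\<^sup>2 * (1 + (y / (t - l))\<^sup>2)"
    using assms by (simp add: field_simps power_divide)
  then have "ln ((t - l)\<^sup>2 + y\<^sup>2) = 2 * ln \<bar>t - l\<bar> + ln (1 + (y / (t - l))\<^sup>2)"
    using assms ln_realpow[of "\<bar>t - l\<bar>" 2] using less_imp_neq[OF add_pos_nonneg[of 1 "(y / (t - l))\<^sup>2"]] by (simp add: ln_mult)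
  moreover have "0 < (t - l)\<^sup>2 + y\<^sup>2" using assms by (intro add_pos_nonneg) auto
  ultimately show ?thesis using assms unfolding log_kernel_def n
    by (simp add: ln_sqrt field_simps)
qed

lemma log_kernel_tendsto_0:
  assumes "t \<noteq> 0" "y \<longlonglongrightarrow> 0"
  shows "(\<lambda>m. log_kernel (y m) t) \<longlonglongrightarrow> 0"
proof -
  have "(\<lambda>m. ennreal (ln (1 + (y m / t)\<^sup>2) / 2)) \<longlonglongrightarrow> ennreal (ln (1 + (0 / t)\<^sup>2) / 2)"
    by (intro tendsto_intros assms) auto
  then show ?thesis using assms by (simp add: log_kernel_def)
qed

abbreviation log_kernel_mass :: ennreal where
  "log_kernel_mass \<equiv> (\<integral>\<^sup>+t. log_kernel 1 t \<partial>lborel)"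

text \<open>
Near 0 the logarithm is dominated by \<open>\<bar>t\<bar>\<^sup>-\<^sup>1\<^sup>/\<^sup>2\<close>, and for large \<open>\<bar>t\<bar>\<close> the kernel is at most \<open>1/t\<^sup>2\<close>.
\<close>

lemma log_kernel_integral_finite: "log_kernel_mass < \<infinity>"
proof -
  \<comment> \<open>Used with \<open>x = 1/t\<^sup>2\<close>, where the fourth root becomes \<open>\<bar>t\<bar>\<^sup>-\<^sup>1\<^sup>/\<^sup>2\<close>.\<close>
  have sq: "ln (1 + x) / 2 \<le> sqrt (sqrt x) * 2" if "1 \<le> x" for x :: real
  proof -
    define r where "r = sqrt (sqrt x)"
    have r: "1 \<le> r" "r ^ 4 = x" using that power_mult[of r 2 2] by (auto simp: r_def)
    have "1 + x \<le> 2 * r ^ 4" using r that by simp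
    then have "ln (1 + x) \<le> ln (2 * r ^ 4)" using that by (subst ln_le_cancel_iff) auto
    also have "\<dots> = ln 2 + 4 * ln r" using r(1) by (simp add: ln_mult ln_realpow)
    also have "\<dots> \<le> 1 + 4 * (r - 1)" using ln_le_minus_one[of r] ln_le_minus_one[of "2::real"] r(1) by simp
    finally show ?thesis using r by (simp add: r_def)
  qed
  define b where "b t = (if \<bar>t\<bar> \<le> 1 then 2 * \<bar>t\<bar> powr (-1/2) else \<bar>t\<bar> powr (-2)) " for t :: real
  have le: "log_kernel 1 t \<le> ennreal (b t)" if "t \<noteq> 0" for t
  proof -
    have "ln (1 + (1 / t)\<^sup>2) / 2 \<le> b t"
    proof (cases "\<bar>t\<bar> \<le> 1")
      case True
      have "1 \<le> (1 / t)\<^sup>2" using True that by (simp add: power_divide abs_square_le_1)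
      from sq[OF this] have "ln (1 + (1 / t)\<^sup>2) / 2 \<le> 2 * sqrt (1 / \<bar>t\<bar>)" by simp
      also have "sqrt (1 / \<bar>t\<bar>) = \<bar>t\<bar> powr (-1/2)" using that
        by (simp add: powr_minus powr_half_sqrt real_sqrt_divide field_simps)
      finally show ?thesis using True by (simp add: b_def)
    next
      case False
      have "ln (1 + (1 / t)\<^sup>2) \<le> (1 / t)\<^sup>2" by (rule ln_add_one_self_le_self) simp
      also have "(1 / t)\<^sup>2 = \<bar>t\<bar> powr (-2)" using that
        by (simp add: powr_minus powr_numeral power_divide field_simps)
      finally have "ln (1 + (1 / t)\<^sup>2) / 2 \<le> \<bar>t\<bar> powr (-2)"
        using powr_ge_zero[of "\<bar>t\<bar>" "-2"] by linarith
      then show ?thesis using False by (simp add: b_def)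
    qed
    then show ?thesis using that by (simp add: log_kernel_def ennreal_leI)
  qed
  have [measurable]: "b \<in> borel_measurable borel" unfolding b_def by measurable
  have half: "(\<integral>\<^sup>+t. ennreal (b t) * indicator {0..} t \<partial>lborel) < \<infinity>"
  proof -
    have "(\<integral>\<^sup>+t. ennreal (b t) * indicator {0..} t \<partial>lborel)
      \<le> (\<integral>\<^sup>+t. ennreal (2 * t powr (-1/2)) * indicator {0..1} t + ennreal (t powr (-2)) * indicator {1..} t \<partial>lborel)"
      by (intro nn_integral_mono) (auto simp: b_def indicator_def)
    also have "\<dots> = (\<integral>\<^sup>+t. ennreal (2 * t powr (-1/2)) * indicator {0..1} t \<partial>lborel)
        + (\<integral>\<^sup>+t. ennreal (t powr (-2)) * indicator {1..} t \<partial>lborel)"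
      by (rule nn_integral_add) auto
    also have "(\<integral>\<^sup>+t. ennreal (2 * t powr (-1/2)) * indicator {0..1} t \<partial>lborel) = ennreal (2 * (1 powr (-1/2 + 1) / (-1/2 + 1)))"
      by (rule nn_integral_has_integral_lebesgue')
         (use has_integral_mult_right[OF has_integral_powr_from_0[of "-1/2" 1], of 2] in auto)
    also have "(\<integral>\<^sup>+t. ennreal (t powr (-2)) * indicator {1..} t \<partial>lborel) = ennreal (- (1 powr (-2 + 1)) / (-2 + 1))"
      by (rule nn_integral_has_integral_lebesgue') (use has_integral_powr_to_inf[of "-2" 1] in auto)
    finally show ?thesis by (rule le_less_trans) (simp add: less_top[symmetric])
  qed
  have "(\<integral>\<^sup>+t. ennreal (b t) * indicator {..0} t \<partial>lborel) = (\<integral>\<^sup>+t. ennreal (b (- t)) * indicator {..0} (- t) \<partial>lborel)"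
    using nn_integral_real_affine[of "\<lambda>t. ennreal (b t) * indicator {..0} t" "-1" 0] by simp
  also have "\<dots> = (\<integral>\<^sup>+t. ennreal (b t) * indicator {0..} t \<partial>lborel)"
    by (intro nn_integral_cong) (auto simp: b_def indicator_def)
  finally have half': "(\<integral>\<^sup>+t. ennreal (b t) * indicator {..0} t \<partial>lborel) < \<infinity>" using half by simp
  have "log_kernel_mass \<le> (\<integral>\<^sup>+t. ennreal (b t) * indicator {0..} t + ennreal (b t) * indicator {..0} t \<partial>lborel)"
  proof (rule nn_integral_mono_AE)
    show "AE t in lborel. log_kernel 1 t \<le> ennreal (b t) * indicator {0..} t + ennreal (b t) * indicator {..0} t"
      using AE_lborel_singleton[of "0::real"]
      by eventually_elim (use le in \<open>auto simp: indicator_def\<close>)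
  qed
  also have "\<dots> = (\<integral>\<^sup>+t. ennreal (b t) * indicator {0..} t \<partial>lborel) + (\<integral>\<^sup>+t. ennreal (b t) * indicator {..0} t \<partial>lborel)"
    by (rule nn_integral_add) auto
  also have "\<dots> < \<infinity>" using half half' by (simp add: ennreal_add_less_top)
  finally show ?thesis .
qed

lemma log_kernel_integral_scale:
  assumes "0 < y"
  shows "(\<integral>\<^sup>+t. log_kernel y (t - l) \<partial>lborel) = ennreal y * log_kernel_mass"
proof -
  have sc: "log_kernel y (y * t) = log_kernel 1 t" for t
    using assms by (auto simp: log_kernel_def)
  have "(\<integral>\<^sup>+t. log_kernel y (t - l) \<partial>lborel) = ennreal \<bar>y\<bar> * (\<integral>\<^sup>+t. log_kernel y ((l + y * t) - l) \<partial>lborel)"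
    by (rule nn_integral_real_affine) (use assms in auto)
  then show ?thesis using assms by (simp add: sc)
qed

abbreviation neg_ln_dist :: "real \<Rightarrow> real \<Rightarrow> ennreal" where
  "neg_ln_dist x y \<equiv> (if x = y then \<infinity> else ennreal (- ln (dist x y)))"

text \<open>
Only the positive part of the energy decides: if it is finite, the energy is not \<open>\<infinity>\<close>, whatever its negative part.
\<close>

lemma log_capacity_pos:
  fixes S :: "real set"
  assumes \<mu>: "\<mu> \<in> compactly_carried_probabilities S"
    and fin: "(\<integral>\<^sup>+x. \<integral>\<^sup>+y. neg_ln_dist x y \<partial>\<mu> \<partial>\<mu>) < \<infinity>"
  shows "log_capacity S \<noteq> 0"
proof -
  let ?P = "\<integral>\<^sup>+x. \<integral>\<^sup>+y. neg_ln_dist x y \<partial>\<mu> \<partial>\<mu>"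
  have "log_energy \<mu> \<noteq> \<infinity>"
    using fin unfolding log_energy_def
    by (cases ?P; cases "\<integral>\<^sup>+x. \<integral>\<^sup>+y. (if x = y then 0 else ennreal (ln (dist x y))) \<partial>\<mu> \<partial>\<mu>") auto
  then have "0 < (if log_energy \<mu> = \<infinity> then 0 else ennreal (exp (- real_of_ereal (log_energy \<mu>))))"
    by simp
  also have "\<dots> \<le> log_capacity S" unfolding log_capacity_def by (rule SUP_upper[OF \<mu>])
  finally show ?thesis by simp
qed

text \<open>
If the positive part of the energy is infinite, the energy is \<open>\<infinity>\<close> even when its negative part is infinite too,
because \<open>\<infinity> - \<infinity> = \<infinity>\<close> for extended reals.
\<close>

lemma log_capacity_zeroI:
  fixes S :: "real set"
  assumes "\<And>\<mu>. \<mu> \<in> compactly_carried_probabilities S \<Longrightarrow>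
    (\<integral>\<^sup>+x. \<integral>\<^sup>+y. neg_ln_dist x y \<partial>\<mu> \<partial>\<mu>) = \<infinity>"
  shows "log_capacity S = 0"
proof -
  have "log_energy \<mu> = \<infinity>" if "\<mu> \<in> compactly_carried_probabilities S" for \<mu>
    using assms[OF that] by (simp add: log_energy_def)
  then show ?thesis unfolding log_capacity_def by (auto simp: SUP_eq_const intro!: antisym SUP_least)
qed

lemma neg_ln_le_log_kernel: "neg_ln_dist x y \<le> log_kernel 1 (x - y)" for x y :: real
proof (cases "x = y")
  case False
  have "- ln (dist x y) \<le> ln (1 + (1 / (x - y))\<^sup>2) / 2"
  proof -
    have "- 2 * ln (dist x y) = ln ((1 / (x - y))\<^sup>2)"
      using False ln_realpow[of "\<bar>1 / (x - y)\<bar>" 2] by (simp add: dist_real_def ln_div power_divide)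
    also have "\<dots> \<le> ln (1 + (1 / (x - y))\<^sup>2)" using False by (subst ln_le_cancel_iff) (auto intro: add_pos_nonneg)
    finally show ?thesis by simp
  qed
  then show ?thesis using False by (simp add: log_kernel_def ennreal_leI)
qed (simp add: log_kernel_def)

lemma log_kernel_le_neg_ln: "log_kernel 1 (x - y) \<le> neg_ln_dist x y + ennreal 1" for x y :: real
proof (cases "x = y")
  case False
  define d where "d = \<bar>x - y\<bar>"
  have d: "0 < d" using False by (simp add: d_def)
  have eq: "(1 / (x - y))\<^sup>2 = 1 / d\<^sup>2" by (simp add: d_def power_divide)
  have "ln (1 + 1 / d\<^sup>2) / 2 \<le> max 0 (- ln d) + 1"
  proof (cases "d \<le> 1")
    case True
    have "1 + 1 / d\<^sup>2 \<le> 2 * (1 / d\<^sup>2)" 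
    proof -
      have "1 \<le> 1 / d\<^sup>2" using True d power_le_one[of d 2] by (simp add: le_divide_eq)
      then show ?thesis by linarith
    qed
    then have "ln (1 + 1 / d\<^sup>2) \<le> ln (2 * (1 / d\<^sup>2))" using d by (subst ln_le_cancel_iff) (auto intro: add_pos_nonneg)
    also have "\<dots> = ln 2 - 2 * ln d" using d by (simp add: ln_mult ln_div ln_realpow)
    also have "\<dots> \<le> 1 - 2 * ln d" using ln_le_minus_one[of 2] by simp
    finally show ?thesis by simp
  next
    case False
    have "ln (1 + 1 / d\<^sup>2) \<le> 1 / d\<^sup>2" by (rule ln_add_one_self_le_self) simp
    also have "\<dots> \<le> 1" using False d by (simp add: field_simps one_le_power)
    finally show ?thesis by simp
  qed
  then have "ennreal (ln (1 + 1 / d\<^sup>2) / 2) \<le> ennreal (max 0 (- ln d) + 1)" by (rule ennreal_leI)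
  also have "\<dots> = ennreal (- ln d) + ennreal 1"
    by (cases "0 \<le> - ln d") (simp_all add: max_def ennreal_neg flip: ennreal_plus ennreal_1)
  finally show ?thesis using False by (simp add: log_kernel_def eq dist_real_def d_def)
qed simp

text \<open>
Normalized Lebesgue measure on a compact set of positive measure has finite energy, since the potential is bounded
by the integral of the kernel over the line.
\<close>

lemma capacity_zero_imp_lebesgue_null:
  fixes S :: "real set"
  assumes S [measurable]: "S \<in> sets borel" and cap: "log_capacity S = 0"
  shows "emeasure lborel S = 0"
proof (rule ccontr)
  assume "emeasure lborel S \<noteq> 0"
  moreover have "S = (\<Union>n. S \<inter> {- real n..real n})"
  proof -
    have "\<exists>n. - real n \<le> x \<and> x \<le> real n" for x
      using real_arch_simple[of "\<bar>x\<bar>"] by (auto simp: abs_le_iff intro: minus_le_iff[THEN iffD1])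
    then show ?thesis by auto
  qed
  ultimately obtain n where n: "emeasure lborel (S \<inter> {- real n..real n}) \<noteq> 0"
    using emeasure_UN_eq_0[of lborel "\<lambda>n. S \<inter> {- real n..real n}"] by (metis (no_types, lifting) S atLeastAtMost_borel image_subset_iff sets.Int sets_lborel)
  define T where "T = S \<inter> {- real n..real n}"
  have T [measurable]: "T \<in> sets borel" by (simp add: T_def)
  have "emeasure lborel T \<le> emeasure lborel {- real n..real n}" by (rule emeasure_mono) (auto simp: T_def)
  then have Tfin: "emeasure lborel T \<noteq> \<infinity>" by (auto simp: top_unique)
  obtain K where K: "compact K" "K \<subseteq> T" "emeasure lborel K > 0"
  proof -
    define M where "M = density lborel (indicator T)"
    have M: "emeasure M A = emeasure lborel (T \<inter> A)" if "A \<in> sets borel" for A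
      unfolding M_def using that by (subst emeasure_density) (auto simp: indicator_inter_arith[symmetric] Int_commute intro!: nn_integral_indicator)
    have "emeasure M T > 0" using n by (simp add: M T_def zero_less_iff_neq_zero)
    from compact_subset_positive[OF _ _ _ this] obtain K where "compact K" "K \<subseteq> T" "emeasure M K > 0"
      using Tfin M[of UNIV] T by (auto simp: M_def)
    moreover from this have "emeasure M K = emeasure lborel K" by (subst M) (auto simp: borel_compact Int_absorb1)
    ultimately show ?thesis using that by auto
  qed
  define c where "c = emeasure lborel K"
  have c: "0 < c" "c < \<infinity>" using K emeasure_compact_finite[OF K(1)] by (auto simp: c_def)
  define \<mu> where "\<mu> = uniform_measure lborel K"
  have [measurable]: "K \<in> sets borel" using K(1) by (simp add: borel_compact)
  have pr: "prob_space \<mu>" unfolding \<mu>_def using c by (intro prob_space_uniform_measure) (auto simp: c_def)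
  have "emeasure \<mu> K = 1" unfolding \<mu>_def using c by (subst emeasure_uniform_measure_1) (auto simp: c_def)
  then have mem: "\<mu> \<in> compactly_carried_probabilities S"
    using K pr by (auto simp: compactly_carried_probabilities_def \<mu>_def T_def intro!: exI[of _ K])
  have "(\<integral>\<^sup>+x. \<integral>\<^sup>+y. neg_ln_dist x y \<partial>\<mu> \<partial>\<mu>)
     \<le> (\<integral>\<^sup>+x. log_kernel_mass / c \<partial>\<mu>)"
  proof (rule nn_integral_mono)
    fix x :: real
    have "(\<integral>\<^sup>+y. neg_ln_dist x y \<partial>\<mu>) \<le> (\<integral>\<^sup>+y. log_kernel 1 (x - y) \<partial>\<mu>)"
      by (intro nn_integral_mono neg_ln_le_log_kernel)
    also have "\<dots> = (\<integral>\<^sup>+y. log_kernel 1 (x - y) * indicator K y \<partial>lborel) / c"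
      unfolding \<mu>_def c_def by (rule nn_integral_uniform_measure) auto
    also have "\<dots> \<le> (\<integral>\<^sup>+y. log_kernel 1 (x - y) \<partial>lborel) / c"
      by (intro divide_right_mono_ennreal nn_integral_mono) (auto simp: indicator_def)
    also have "(\<integral>\<^sup>+y. log_kernel 1 (x - y) \<partial>lborel) = log_kernel_mass"
      using nn_integral_real_affine[of "\<lambda>y. log_kernel 1 (x - y)" "-1" x] by simp
    finally show "(\<integral>\<^sup>+y. neg_ln_dist x y \<partial>\<mu>) \<le> log_kernel_mass / c" .
  qed
  also have "\<dots> = log_kernel_mass / c"
    using prob_space.emeasure_space_1[OF pr] by simp
  also have "\<dots> < \<infinity>" using log_kernel_integral_finite c
    by (auto simp: ennreal_divide_eq_top_iff less_top[symmetric])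
  finally show False using log_capacity_pos[OF mem] cap by simp
qed

text \<open>
Let \<open>H\<^sub>y(s)\<close> be the integral of the kernel over all \<open>t\<close>. Finite energy makes \<open>\<integral> H\<^sub>y d\<mu>\<close> tend to 0 with \<open>y\<close>.
Along a sequence \<open>v\<^sub>m\<close> with \<open>\<integral> H d\<mu> \<le> 4\<^sup>-\<^sup>m\<close> the function \<open>W = \<Sum> 2\<^sup>m H\<close> is integrable, so it is bounded by some \<open>L\<close>
on a compact \<open>K \<subseteq> B\<close> of positive measure, where then \<open>H \<le> L 2\<^sup>-\<^sup>m\<close>. This takes the place of Egorov's
theorem. The bound extends from \<open>s \<in> K\<close> to all \<open>s\<close> by passing to the nearest point \<open>s'\<close> of \<open>K\<close>: for
\<open>t \<in> K\<close> one has \<open>\<bar>t - s'\<bar> \<le> 2\<bar>t - s\<bar>\<close>, which costs only a factor 2 in \<open>y\<close>.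
\<close>

lemma log_potential_uniformly_small:
  fixes \<mu> :: "real measure"
  assumes sets_mu [measurable_cong, simp]: "sets \<mu> = sets borel" and fin: "finite_measure \<mu>"
    and B [measurable]: "B \<in> sets borel" and pos: "emeasure \<mu> B > 0"
    and energy: "(\<integral>\<^sup>+s. \<integral>\<^sup>+t. log_kernel 1 (t - s) \<partial>\<mu> \<partial>\<mu>) < \<infinity>"
  obtains K \<eta> y where "compact K" "K \<subseteq> B" "emeasure \<mu> K > 0" "\<And>m. 0 < y m" "y \<longlonglongrightarrow> (0::real)"
    "\<eta> \<longlonglongrightarrow> (0::ennreal)" "\<And>m s. (\<integral>\<^sup>+t. log_kernel (y m) (t - s) * indicator K t \<partial>\<mu>) \<le> \<eta> m"
proof -
  interpret finite_measure \<mu> by (rule fin)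
  have space_mu [simp]: "space \<mu> = UNIV" using sets_eq_imp_space_eq[OF sets_mu] by simp
  define H where "H y s = (\<integral>\<^sup>+t. log_kernel y (t - s) \<partial>\<mu>)" for y s
  have H_meas [measurable]: "H y \<in> borel_measurable borel" for y
    unfolding H_def by measurable
  have Hmono: "H y s \<le> H y' s" if "0 < y" "y \<le> y'" for y y' s
    unfolding H_def using that by (intro nn_integral_mono log_kernel_mono) (auto intro: mult_right_mono)
  define v where "v k = inverse (real (Suc k))" for k
  have v: "0 < v k" "v k \<le> 1" for k by (auto simp: v_def field_simps)
  have vlim: "v \<longlonglongrightarrow> 0" unfolding v_def by (rule LIMSEQ_inverse_real_of_nat)
  have "AE s in \<mu>. H 1 s \<noteq> \<infinity>"
    using energy by (intro nn_integral_PInf_AE) (auto simp: H_def[symmetric])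
  then have lim: "AE s in \<mu>. (\<lambda>k. H (v k) s) \<longlonglongrightarrow> 0"
  proof eventually_elim
    case (elim s)
    have ne: "AE t in \<mu>. log_kernel 1 (t - s) \<noteq> \<infinity>"
      using elim by (intro nn_integral_PInf_AE) (auto simp: H_def)
    have "(\<lambda>k. \<integral>\<^sup>+t. log_kernel (v k) (t - s) \<partial>\<mu>) \<longlonglongrightarrow> (\<integral>\<^sup>+t. 0 \<partial>\<mu>)"
    proof (rule nn_integral_dominated_convergence[where w = "\<lambda>t. log_kernel 1 (t - s)"])
      show "AE t in \<mu>. log_kernel (v k) (t - s) \<le> log_kernel 1 (t - s)" for k
        using v[of k] by (intro AE_I2 log_kernel_mono) (auto intro: mult_left_le_one_le)
      show "AE t in \<mu>. (\<lambda>k. log_kernel (v k) (t - s)) \<longlonglongrightarrow> 0"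
        using ne by eventually_elim (intro log_kernel_tendsto_0 vlim, auto simp: log_kernel_def split: if_splits)
    qed (use elim in \<open>auto simp: H_def less_top\<close>)
    then show ?case by (simp add: H_def)
  qed
  have elim0: "(\<lambda>k. \<integral>\<^sup>+s. H (v k) s \<partial>\<mu>) \<longlonglongrightarrow> (\<integral>\<^sup>+s. 0 \<partial>\<mu>)"
  proof (rule nn_integral_dominated_convergence[where w = "H 1"])
    show "AE s in \<mu>. H (v k) s \<le> H 1 s" for k using v by (intro AE_I2 Hmono) auto
  qed (use lim energy in \<open>auto simp: H_def[symmetric]\<close>)
  have "\<exists>k\<ge>m. (\<integral>\<^sup>+s. H (v k) s \<partial>\<mu>) < ennreal ((1/4) ^ m)" for m
  proof -
    have "eventually (\<lambda>k. (\<integral>\<^sup>+s. H (v k) s \<partial>\<mu>) < ennreal ((1/4) ^ m)) sequentially"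
      using elim0 by (intro order_tendstoD(2)) auto
    then show ?thesis by (auto simp: eventually_sequentially) (meson nle_le)
  qed
  then obtain k where k: "\<And>m. k m \<ge> m" "\<And>m. (\<integral>\<^sup>+s. H (v (k m)) s \<partial>\<mu>) < ennreal ((1/4) ^ m)" by metis
  define W where "W s = (\<Sum>m. ennreal (2 ^ m) * H (v (k m)) s)" for s
  have [measurable]: "W \<in> borel_measurable borel" unfolding W_def by measurable
  have "(\<integral>\<^sup>+s. W s \<partial>\<mu>) = (\<Sum>m. ennreal (2 ^ m) * (\<integral>\<^sup>+s. H (v (k m)) s \<partial>\<mu>))"
    unfolding W_def by (subst nn_integral_suminf) (auto simp: nn_integral_cmult)
  also have "\<dots> \<le> (\<Sum>m. ennreal ((1/2) ^ m))"
  proof (intro suminf_le summableI)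
    fix m
    have "ennreal (2 ^ m) * (\<integral>\<^sup>+s. H (v (k m)) s \<partial>\<mu>) \<le> ennreal (2 ^ m) * ennreal ((1/4) ^ m)"
      using k(2)[of m] by (intro mult_left_mono) auto
    also have "\<dots> = ennreal ((1/2) ^ m)" by (simp flip: ennreal_mult power_mult_distrib)
    finally show "ennreal (2 ^ m) * (\<integral>\<^sup>+s. H (v (k m)) s \<partial>\<mu>) \<le> ennreal ((1/2) ^ m)" .
  qed
  also have "\<dots> < \<infinity>" by (subst suminf_ennreal2) (auto simp: less_top[symmetric])
  finally have "AE s in \<mu>. W s \<noteq> \<infinity>" by (intro nn_integral_PInf_AE) auto
  then have "AE s in \<mu>. \<exists>L::nat. W s \<le> of_nat L"
    by eventually_elim (metis ennreal_Ex_less_of_nat infinity_ennreal_def less_imp_le less_top)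
  then have "emeasure \<mu> (B \<inter> {s. \<exists>L::nat. W s \<le> of_nat L}) = emeasure \<mu> B"
    by (intro emeasure_eq_AE) auto
  moreover have "B \<inter> {s. \<exists>L::nat. W s \<le> of_nat L} = (\<Union>L::nat. B \<inter> {s. W s \<le> of_nat L})" by auto
  ultimately have "emeasure \<mu> (\<Union>L::nat. B \<inter> {s. W s \<le> of_nat L}) \<noteq> 0" using pos by simp
  moreover have BL [measurable]: "B \<inter> {s. W s \<le> of_nat L} \<in> sets borel" for L :: nat
  proof -
    have "{s \<in> space borel. W s \<le> of_nat L} \<in> sets borel" by measurable
    then show ?thesis by auto
  qed
  ultimately obtain L :: nat where L: "emeasure \<mu> (B \<inter> {s. W s \<le> of_nat L}) \<noteq> 0"
    using emeasure_UN_eq_0[of \<mu> "\<lambda>L::nat. B \<inter> {s. W s \<le> of_nat L}"]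
    by (metis (no_types, lifting) image_subset_iff sets_mu)
  obtain K where K: "compact K" "K \<subseteq> B \<inter> {s. W s \<le> of_nat L}" "emeasure \<mu> K > 0"
    by (rule compact_subset_positive[OF sets_mu _ BL[of L]])
       (use L emeasure_finite[of UNIV] in \<open>auto simp: zero_less_iff_neq_zero\<close>)
  have [measurable]: "K \<in> sets borel" using K(1) by (simp add: borel_compact)
  have HK: "H (v (k m)) s \<le> ennreal (real L * (1/2) ^ m)" if "s \<in> K" for m s
  proof -
    have "ennreal (2 ^ m) * H (v (k m)) s \<le> W s"
      unfolding W_def using sum_le_suminf[of "\<lambda>m. ennreal (2 ^ m) * H (v (k m)) s" "{m}"] by auto
    also have "\<dots> \<le> of_nat L" using K that by auto
    finally have "ennreal ((1/2) ^ m) * (ennreal (2 ^ m) * H (v (k m)) s) \<le> ennreal ((1/2) ^ m) * of_nat L"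
      by (rule mult_left_mono) auto
    moreover have "ennreal ((1/2) ^ m) * ennreal (2 ^ m) = 1" by (simp flip: ennreal_mult power_mult_distrib)
    ultimately have "H (v (k m)) s \<le> ennreal ((1/2) ^ m) * of_nat L" by (simp add: mult.assoc[symmetric])
    also have "\<dots> = ennreal (real L * (1/2) ^ m)"
      unfolding ennreal_of_nat_eq_real_of_nat by (subst ennreal_mult) (auto simp: mult.commute)
    finally show ?thesis .
  qed
  have Kne: "K \<noteq> {}" using K(3) by auto
  show ?thesis
  proof (rule that[where K = K and y = "\<lambda>m. v (k m) / 2" and \<eta> = "\<lambda>m. ennreal (real L * (1/2) ^ m)"])
    show "compact K" "K \<subseteq> B" "emeasure \<mu> K > 0" using K by auto
    show "0 < v (k m) / 2" for m using v by simp
    have "(\<lambda>m. v (k m)) \<longlonglongrightarrow> 0"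
      using vlim filterlim_at_top_mono[OF filterlim_ident, of k] k(1) by (auto intro: filterlim_compose)
    then show "(\<lambda>m. v (k m) / 2) \<longlonglongrightarrow> 0" by (auto intro: tendsto_eq_intros)
    have "(\<lambda>m. ennreal (real L * (1/2) ^ m)) \<longlonglongrightarrow> ennreal (real L * 0)"
      by (intro tendsto_intros LIMSEQ_realpow_zero) auto
    then show "(\<lambda>m. ennreal (real L * (1/2) ^ m)) \<longlonglongrightarrow> 0" by simp
    fix m s
    obtain s' where s': "s' \<in> K" "\<And>t. t \<in> K \<Longrightarrow> dist s s' \<le> dist s t"
      using distance_attains_inf[OF compact_imp_closed[OF K(1)] Kne, of s] by auto
    have "(\<integral>\<^sup>+t. log_kernel (v (k m) / 2) (t - s) * indicator K t \<partial>\<mu>) \<le> H (v (k m)) s'"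
      unfolding H_def
    proof (rule nn_integral_mono)
      fix t
      show "log_kernel (v (k m) / 2) (t - s) * indicator K t \<le> log_kernel (v (k m)) (t - s')"
      proof (cases "t \<in> K")
        case True
        have "\<bar>t - s'\<bar> \<le> \<bar>t - s\<bar> + \<bar>s - s'\<bar>" by simp
        also have "\<bar>s - s'\<bar> \<le> \<bar>t - s\<bar>" using s'(2)[OF True] by (simp add: dist_real_def)
        finally have "v (k m) * \<bar>t - s'\<bar> \<le> v (k m) * (2 * \<bar>t - s\<bar>)" using v(1)[of "k m"] by (intro mult_left_mono) auto
        then show ?thesis using True v(1)[of "k m"] by (auto intro!: log_kernel_mono)
      qed simp
    qed
    also have "\<dots> \<le> ennreal (real L * (1/2) ^ m)" by (rule HK[OF s'(1)])
    finally show "(\<integral>\<^sup>+t. log_kernel (v (k m) / 2) (t - s) * indicator K t \<partial>\<mu>) \<le> ennreal (real L * (1/2) ^ m)" .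
  qed
qed

section \<open>Averaged logarithms of products with real zeros\<close>

text \<open>
An abstract version of the situation \<open>\<gamma> = lim (1/N) ln \<bar>p\<^sub>N\<bar>\<close>, with \<open>c j > 0\<close> the modulus of the leading coefficient and
\<open>x j i\<close> the real zeros of the \<open>j\<close>-th polynomial.
\<close>

locale averaged_log_products =
  fixes c :: "nat \<Rightarrow> real" and x :: "nat \<Rightarrow> nat \<Rightarrow> real" and N :: "nat \<Rightarrow> nat" and \<gamma> :: "complex \<Rightarrow> real"
  assumes c_pos: "\<And>j. 0 < c j"
    and N_lim: "filterlim N at_top sequentially"
    and conv: "\<And>z. 0 < Im z \<Longrightarrow> (\<lambda>j. ln (c j * (\<Prod>i<N j. cmod (z - of_real (x j i)))) / real (N j)) \<longlonglongrightarrow> \<gamma> z"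
    and \<gamma>_nonneg: "\<And>z. 0 < Im z \<Longrightarrow> 0 \<le> \<gamma> z"
begin

abbreviation avg :: "nat \<Rightarrow> complex \<Rightarrow> real" where
  "avg j z \<equiv> ln (c j * (\<Prod>i<N j. cmod (z - of_real (x j i)))) / real (N j)"

abbreviation modulus :: "nat \<Rightarrow> real \<Rightarrow> real" where
  "modulus j t \<equiv> c j * (\<Prod>i<N j. \<bar>t - x j i\<bar>)"

abbreviation mean_kernel :: "nat \<Rightarrow> real \<Rightarrow> real \<Rightarrow> ennreal" where
  "mean_kernel j y t \<equiv> \<Sum>i<N j. ennreal (1 / real (N j)) * log_kernel y (t - x j i)"

lemma norm_pos: "0 < y \<Longrightarrow> 0 < cmod (Complex t y - of_real r)"
  by (auto simp: complex_eq_iff)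

lemma norm_mono:
  assumes "0 \<le> u" "u \<le> y"
  shows "cmod (Complex t u - of_real r) \<le> cmod (Complex t y - of_real r)"
  using assms by (simp add: cmod_def real_sqrt_le_iff power_mono)

lemma avg_eq:
  assumes "0 < y"
  shows "avg j (Complex t y) = (ln (c j) + (\<Sum>i<N j. ln (cmod (Complex t y - of_real (x j i))))) / real (N j)"
  using c_pos[of j] norm_pos[OF assms] by (subst ln_mult_pos) (auto simp: ln_prod prod_pos)

lemma avg_mono:
  assumes "0 < u" "u \<le> y"
  shows "avg j (Complex t u) \<le> avg j (Complex t y)"
  unfolding avg_eq[OF assms(1)] avg_eq[OF less_le_trans[OF assms]] using assms norm_pos norm_mono
  by (intro divide_right_mono add_left_mono sum_mono ln_mono) auto

lemma \<gamma>_mono: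
  assumes "0 < u" "u \<le> y"
  shows "\<gamma> (Complex t u) \<le> \<gamma> (Complex t y)"
  using assms by (intro LIMSEQ_le[OF conv conv] exI[of _ 0]) (auto intro: avg_mono)

text \<open>
The boundary value of \<open>\<gamma>\<close> at \<open>t\<close>, defined by an infimum since \<open>\<gamma>(t+iy)\<close> increases with \<open>y\<close>.
\<close>

definition \<Gamma> :: "real \<Rightarrow> real" where "\<Gamma> t = (INF y\<in>{0<..}. \<gamma> (Complex t y))"

lemma \<gamma>_bdd_below: "bdd_below ((\<lambda>y. \<gamma> (Complex t y)) ` {0<..})"
  using \<gamma>_nonneg by (auto intro!: bdd_belowI2[of _ 0])

lemma \<Gamma>_le: "0 < y \<Longrightarrow> \<Gamma> t \<le> \<gamma> (Complex t y)"
  unfolding \<Gamma>_def by (rule cINF_lower[OF \<gamma>_bdd_below]) auto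

lemma \<Gamma>_nonneg: "0 \<le> \<Gamma> t"
  unfolding \<Gamma>_def using \<gamma>_nonneg by (intro cINF_greatest) auto

lemma tendsto_\<Gamma>: "((\<lambda>y. \<gamma> (Complex t y)) \<longlongrightarrow> \<Gamma> t) (at_right 0)"
proof (rule order_tendstoI)
  fix r assume r: "r < \<Gamma> t"
  show "\<forall>\<^sub>F y in at_right 0. r < \<gamma> (Complex t y)"
    using eventually_at_right_less[of "0::real"] by eventually_elim (rule less_le_trans[OF r \<Gamma>_le])
next
  fix r assume "\<Gamma> t < r"
  then obtain u where u: "0 < u" "\<gamma> (Complex t u) < r"
    using cINF_less_iff[of "{0<..}" "\<lambda>y. \<gamma> (Complex t y)" r] \<gamma>_bdd_below[of t] by (auto simp: \<Gamma>_def)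
  show "\<forall>\<^sub>F y in at_right 0. \<gamma> (Complex t y) < r"
    using eventually_at_right_real[OF u(1)]
  proof eventually_elim
    case (elim y)
    then have "\<gamma> (Complex t y) \<le> \<gamma> (Complex t u)" by (intro \<gamma>_mono) auto
    then show ?case using u(2) by simp
  qed
qed

lemma tendsto_\<Gamma>_sequence:
  assumes "\<And>m. 0 < y m" "y \<longlonglongrightarrow> 0"
  shows "(\<lambda>m. \<gamma> (Complex t (y m))) \<longlonglongrightarrow> \<Gamma> t"
proof -
  have "\<forall>n. y n \<in> {0<..} \<and> y n \<noteq> 0" using assms(1) by (metis greaterThan_iff less_irrefl)
  then have "filterlim y (at_right 0) sequentially" using assms(2) by (simp add: filterlim_at)
  then show ?thesis by (rule filterlim_compose[OF tendsto_\<Gamma>])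
qed

lemma avg_measurable [measurable]: "(\<lambda>t. avg j (Complex t y)) \<in> borel_measurable borel"
  unfolding complex_diff cmod_def by simp

lemma \<gamma>_measurable:
  assumes "0 < y"
  shows "(\<lambda>t. \<gamma> (Complex t y)) \<in> borel_measurable borel"
  by (rule borel_measurable_LIMSEQ_real[OF conv]) (use assms in auto)

lemma \<Gamma>_measurable [measurable]: "\<Gamma> \<in> borel_measurable borel"
  by (rule borel_measurable_LIMSEQ_real[OF tendsto_\<Gamma>_sequence[of "\<lambda>k. inverse (real (Suc k))"]])
     (use LIMSEQ_inverse_real_of_nat in \<open>auto intro!: \<gamma>_measurable\<close>)

text \<open>
The right hand side is the full increment from height 0 to height \<open>y\<close>. If \<open>t\<close> is itself a zero it is infinite.
\<close>

lemma avg_diff_le: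
  assumes "0 < u" "u \<le> y"
  shows "ennreal (avg j (Complex t y) - avg j (Complex t u)) \<le> mean_kernel j y t"
proof (cases "\<exists>i<N j. t = x j i")
  case True
  then obtain i where i: "i < N j" "t = x j i" by auto
  have "\<infinity> = ennreal (1 / real (N j)) * log_kernel y (t - x j i)"
    using i by (simp add: log_kernel_def ennreal_mult_top)
  also have "\<dots> \<le> mean_kernel j y t"
    using i by (intro member_le_sum) auto
  finally show ?thesis by (rule order_trans[rotated]) simp
next
  case False
  have y: "0 < y" using assms by simp
  define d where "d i = ln (cmod (Complex t y - of_real (x j i))) - ln \<bar>t - x j i\<bar>" for i
  have abs: "\<bar>t - x j i\<bar> = cmod (Complex t 0 - of_real (x j i))" for i by (simp add: cmod_def)
  have d0: "0 \<le> d i" if "i < N j" for i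
  proof -
    have "\<bar>t - x j i\<bar> > 0" using False that by auto
    then show ?thesis unfolding d_def using norm_mono[of 0 y t "x j i"] y norm_pos[OF y] by (simp add: abs)
  qed
  have "avg j (Complex t y) - avg j (Complex t u) =
      (\<Sum>i<N j. ln (cmod (Complex t y - of_real (x j i))) - ln (cmod (Complex t u - of_real (x j i)))) / real (N j)"
    unfolding avg_eq[OF assms(1)] avg_eq[OF y] by (simp add: sum_subtractf diff_divide_distrib add_divide_distrib)
  also have "\<dots> \<le> (\<Sum>i<N j. d i) / real (N j)"
  proof (intro divide_right_mono sum_mono)
    fix i assume "i \<in> {..<N j}"
    then have "\<bar>t - x j i\<bar> > 0" using False by auto
    moreover have "\<bar>t - x j i\<bar> \<le> cmod (Complex t u - of_real (x j i))" using norm_mono[of 0 u t "x j i"] assms by (simp add: abs)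
    ultimately have "ln \<bar>t - x j i\<bar> \<le> ln (cmod (Complex t u - of_real (x j i)))" by (intro ln_mono) auto
    then show "ln (cmod (Complex t y - of_real (x j i))) - ln (cmod (Complex t u - of_real (x j i))) \<le> d i"
      by (simp add: d_def)
  qed auto
  also have "\<dots> = (\<Sum>i<N j. 1 / real (N j) * d i)" by (simp add: sum_distrib_left sum_divide_distrib)
  finally have "ennreal (avg j (Complex t y) - avg j (Complex t u)) \<le> ennreal (\<Sum>i<N j. 1 / real (N j) * d i)"
    by (rule ennreal_leI)
  also have "\<dots> = (\<Sum>i<N j. ennreal (1 / real (N j)) * ennreal (d i))"
    using d0 by (subst sum_ennreal[symmetric]) (auto intro!: sum.cong ennreal_mult simp del: times_divide_eq_left)
  also have "\<dots> = mean_kernel j y t"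
  proof (rule sum.cong)
    fix i assume "i \<in> {..<N j}"
    then have "t \<noteq> x j i" using False by auto
    from log_kernel_ln_norm[OF this, of y] show "ennreal (1 / real (N j)) * ennreal (d i) = ennreal (1 / real (N j)) * log_kernel y (t - x j i)"
      by (simp add: d_def)
  qed simp
  finally show ?thesis .
qed

lemma sum_average: "0 < n \<Longrightarrow> (\<Sum>i<n. ennreal (1 / real n) * C) = C"
  by (simp add: mult.assoc[symmetric] ennreal_of_nat_eq_real_of_nat flip: ennreal_mult')

lemma N_pos: "eventually (\<lambda>j. 0 < N j) sequentially"
  using eventually_compose_filterlim[OF eventually_gt_at_top[of 0] N_lim] .

text \<open>
For each \<open>j\<close> the bound is an average of \<open>N j\<close> integrals with the same value; Fatou's lemma passes to the limit.
\<close>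

lemma integral_\<gamma>_diff_le:
  assumes "0 < u" "u \<le> y"
  shows "(\<integral>\<^sup>+t. ennreal (\<gamma> (Complex t y) - \<gamma> (Complex t u)) \<partial>lborel) \<le> ennreal y * log_kernel_mass"
proof -
  have y: "0 < y" using assms by simp
  have "(\<integral>\<^sup>+t. ennreal (\<gamma> (Complex t y) - \<gamma> (Complex t u)) \<partial>lborel)
      = (\<integral>\<^sup>+t. liminf (\<lambda>j. ennreal (avg j (Complex t y) - avg j (Complex t u))) \<partial>lborel)"
  proof (rule nn_integral_cong)
    fix t
    have "(\<lambda>j. ennreal (avg j (Complex t y) - avg j (Complex t u))) \<longlonglongrightarrow> ennreal (\<gamma> (Complex t y) - \<gamma> (Complex t u))"
      using assms by (intro tendsto_intros conv) auto
    then show "ennreal (\<gamma> (Complex t y) - \<gamma> (Complex t u)) = liminf (\<lambda>j. ennreal (avg j (Complex t y) - avg j (Complex t u)))"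
      by (rule lim_imp_Liminf[OF sequentially_bot, symmetric])
  qed
  also have "\<dots> \<le> liminf (\<lambda>j. \<integral>\<^sup>+t. ennreal (avg j (Complex t y) - avg j (Complex t u)) \<partial>lborel)"
    by (rule nn_integral_liminf) measurable
  also have "\<dots> \<le> liminf (\<lambda>j. ennreal y * log_kernel_mass)"
  proof (rule Liminf_mono, use N_pos in eventually_elim)
    case (elim j)
    have "(\<integral>\<^sup>+t. ennreal (avg j (Complex t y) - avg j (Complex t u)) \<partial>lborel)
        \<le> (\<integral>\<^sup>+t. mean_kernel j y t \<partial>lborel)"
      by (intro nn_integral_mono avg_diff_le assms)
    also have "\<dots> = (\<Sum>i<N j. ennreal (1 / real (N j)) * (\<integral>\<^sup>+t. log_kernel y (t - x j i) \<partial>lborel))"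
      by (subst nn_integral_sum) (auto simp: nn_integral_cmult)
    also have "\<dots> = ennreal y * log_kernel_mass"
      using elim by (simp add: log_kernel_integral_scale[OF y] sum_average del: sum_constant)
    finally show ?case .
  qed
  also have "\<dots> = ennreal y * log_kernel_mass" by (simp add: Liminf_const)
  finally show ?thesis .
qed

lemma integral_\<gamma>_minus_\<Gamma>_le:
  assumes y: "0 < y"
  shows "(\<integral>\<^sup>+t. ennreal (\<gamma> (Complex t y) - \<Gamma> t) \<partial>lborel) \<le> ennreal y * log_kernel_mass"
proof -
  define u where "u k = y * inverse (real (Suc k))" for k
  have u: "0 < u k" "u k \<le> y" for k using y by (auto simp: u_def field_simps)
  have "u \<longlonglongrightarrow> y * 0" unfolding u_def by (intro tendsto_intros LIMSEQ_inverse_real_of_nat)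
  then have u0: "u \<longlonglongrightarrow> 0" by simp
  note [measurable] = \<gamma>_measurable[OF y] \<gamma>_measurable[OF u(1)]
  have "(\<integral>\<^sup>+t. ennreal (\<gamma> (Complex t y) - \<Gamma> t) \<partial>lborel)
      = (\<integral>\<^sup>+t. liminf (\<lambda>k. ennreal (\<gamma> (Complex t y) - \<gamma> (Complex t (u k)))) \<partial>lborel)"
  proof (rule nn_integral_cong)
    fix t
    have "(\<lambda>k. ennreal (\<gamma> (Complex t y) - \<gamma> (Complex t (u k)))) \<longlonglongrightarrow> ennreal (\<gamma> (Complex t y) - \<Gamma> t)"
      by (intro tendsto_intros tendsto_\<Gamma>_sequence u u0)
    then show "ennreal (\<gamma> (Complex t y) - \<Gamma> t) = liminf (\<lambda>k. ennreal (\<gamma> (Complex t y) - \<gamma> (Complex t (u k))))"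
      by (rule lim_imp_Liminf[OF sequentially_bot, symmetric])
  qed
  also have "\<dots> \<le> liminf (\<lambda>k. \<integral>\<^sup>+t. ennreal (\<gamma> (Complex t y) - \<gamma> (Complex t (u k))) \<partial>lborel)"
    by (rule nn_integral_liminf) measurable
  also have "\<dots> \<le> liminf (\<lambda>k. ennreal y * log_kernel_mass)"
    by (intro Liminf_mono always_eventually allI integral_\<gamma>_diff_le u)
  also have "\<dots> = ennreal y * log_kernel_mass" by (simp add: Liminf_const)
  finally show ?thesis .
qed

text \<open>
By Fatou's lemma \<open>liminf (\<gamma>(t+iy) - \<Gamma>(t))/y\<close> is integrable over the line, along \<open>y = 1/k\<close>, hence finite almost everywhere.
\<close>

lemma AE_linear_decay:
  "AE t in lborel. \<Gamma> t = 0 \<longrightarrow> (\<exists>y C. (\<forall>n. 0 < y n) \<and> y \<longlonglongrightarrow> 0 \<and> (\<forall>n. \<gamma> (Complex t (y n)) \<le> C * y n))"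
proof -
  define v where "v k = inverse (real (Suc k))" for k
  have v: "0 < v k" for k by (auto simp: v_def)
  have v0: "v \<longlonglongrightarrow> 0" unfolding v_def by (rule LIMSEQ_inverse_real_of_nat)
  note [measurable] = \<gamma>_measurable[OF v]
  define F where "F k t = ennreal (real (Suc k)) * ennreal (\<gamma> (Complex t (v k)) - \<Gamma> t)" for k t
  have [measurable]: "F k \<in> borel_measurable borel" for k unfolding F_def by measurable
  have "(\<integral>\<^sup>+t. liminf (\<lambda>k. F k t) \<partial>lborel) \<le> liminf (\<lambda>k. \<integral>\<^sup>+t. F k t \<partial>lborel)"
    by (rule nn_integral_liminf) measurable
  also have "\<dots> \<le> liminf (\<lambda>k. log_kernel_mass)"
  proof (intro Liminf_mono always_eventually allI)
    fix k
    have "(\<integral>\<^sup>+t. F k t \<partial>lborel) = ennreal (real (Suc k)) * (\<integral>\<^sup>+t. ennreal (\<gamma> (Complex t (v k)) - \<Gamma> t) \<partial>lborel)"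
      unfolding F_def by (rule nn_integral_cmult) measurable
    also have "\<dots> \<le> ennreal (real (Suc k)) * (ennreal (v k) * log_kernel_mass)"
      by (intro mult_left_mono integral_\<gamma>_minus_\<Gamma>_le v) auto
    also have "\<dots> = log_kernel_mass"
    proof -
      have "ennreal (real (Suc k)) * ennreal (v k) = 1"
        by (subst ennreal_mult[symmetric]) (auto simp: v_def)
      then show ?thesis by (simp add: mult.assoc[symmetric] del: of_nat_Suc)
    qed
    finally show "(\<integral>\<^sup>+t. F k t \<partial>lborel) \<le> log_kernel_mass" .
  qed
  also have "\<dots> < \<infinity>" using log_kernel_integral_finite by (simp add: Liminf_const)
  finally have "AE t in lborel. liminf (\<lambda>k. F k t) \<noteq> \<infinity>"
    by (intro nn_integral_PInf_AE) auto
  then show ?thesis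
  proof (eventually_elim, intro impI)
    case (elim t)
    assume G: "\<Gamma> t = 0"
    from elim obtain B where B: "liminf (\<lambda>k. F k t) < ennreal B" "0 \<le> B"
      by (metis ennreal_cases ennreal_less_iff gt_ex infinity_ennreal_def linorder_not_less order_less_imp_le order_trans)
    have "\<exists>k\<ge>m. F k t \<le> ennreal B" for m
    proof (rule ccontr)
      assume "\<not> ?thesis"
      then have "eventually (\<lambda>k. ennreal B \<le> F k t) sequentially"
        unfolding eventually_sequentially by (metis less_imp_le not_le)
      then have "ennreal B \<le> liminf (\<lambda>k. F k t)" by (rule Liminf_bounded)
      with B show False by simp
    qed
    then obtain k where k: "\<And>m. m \<le> k m" "\<And>m. F (k m) t \<le> ennreal B" by metis
    have "\<gamma> (Complex t (v (k m))) \<le> B * v (k m)" for m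
    proof -
      have "ennreal (real (Suc (k m)) * \<gamma> (Complex t (v (k m)))) \<le> ennreal B"
        using k(2)[of m] G by (simp add: F_def ennreal_mult' del: of_nat_Suc)
      then have "real (Suc (k m)) * \<gamma> (Complex t (v (k m))) \<le> B"
        using B by (simp del: of_nat_Suc)
      then show ?thesis by (simp add: v_def field_simps)
    qed
    moreover have "(\<lambda>m. v (k m)) \<longlonglongrightarrow> 0"
      using v0 filterlim_at_top_mono[OF filterlim_ident, of k] k(1) by (auto intro: filterlim_compose)
    ultimately show "\<exists>y C. (\<forall>n. 0 < y n) \<and> y \<longlonglongrightarrow> 0 \<and> (\<forall>n. \<gamma> (Complex t (y n)) \<le> C * y n)"
      using v by (intro exI[of _ "\<lambda>m. v (k m)"] exI[of _ B]) auto
  qed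
qed

text \<open>
Obtained from the increment bound between heights \<open>u\<close> and \<open>y\<close> by letting \<open>u \<rightarrow> 0\<close>, where the average is at most the
growth rate. At a zero \<open>t\<close> the right hand side is infinite.
\<close>

lemma avg_le_of_growth:
  assumes y: "0 < y" and C: "1 \<le> C" and growth: "modulus j t \<le> C * real (Suc (N j))"
  shows "ennreal (avg j (Complex t y)) \<le> ennreal (ln (C * real (Suc (N j))) / real (N j))
     + mean_kernel j y t"
proof (cases "\<exists>i<N j. t = x j i")
  case True
  then obtain i where i: "i < N j" "t = x j i" by auto
  have "\<infinity> = ennreal (1 / real (N j)) * log_kernel y (t - x j i)"
    using i by (simp add: log_kernel_def ennreal_mult_top)
  also have "\<dots> \<le> mean_kernel j y t"
    using i by (intro member_le_sum) auto
  also have "\<dots> \<le> ennreal (ln (C * real (Suc (N j))) / real (N j)) + mean_kernel j y t"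
    by (rule add_increasing) auto
  finally show ?thesis by (rule order_trans[rotated]) simp
next
  case False
  define L where "L = ln (C * real (Suc (N j))) / real (N j)"
  have lim: "((\<lambda>u. avg j (Complex t u)) \<longlongrightarrow> ln (modulus j t) / real (N j)) (at_right 0)"
  proof -
    have "((\<lambda>u. avg j (Complex t u)) \<longlongrightarrow> ln (c j * (\<Prod>i<N j. cmod (Complex t 0 - of_real (x j i)))) / real (N j)) (at_right 0)"
    proof (cases "N j = 0")
      case N0: False
      have "((\<lambda>u. Complex t u) \<longlongrightarrow> Complex t 0) (at_right 0)"
        unfolding tendsto_complex_iff by (auto intro!: tendsto_intros)
      moreover have "c j * (\<Prod>i<N j. cmod (Complex t 0 - of_real (x j i))) \<noteq> 0"
        using c_pos[of j] False by (auto simp: complex_eq_iff)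
      ultimately show ?thesis using N0 by (intro tendsto_intros) auto
    qed simp
    moreover have "cmod (Complex t 0 - of_real (x j i)) = \<bar>t - x j i\<bar>" for i by (simp add: cmod_def)
    ultimately show ?thesis by simp
  qed
  have "0 < modulus j t" using c_pos[of j] False by (auto intro!: mult_pos_pos prod_pos)
  then have le: "ln (modulus j t) / real (N j) \<le> L"
    unfolding L_def using growth by (intro divide_right_mono ln_mono) auto
  have L0: "0 \<le> L" unfolding L_def using C
    by (intro divide_nonneg_nonneg ln_ge_zero) (auto intro: order_trans[OF _ mult_mono[of 1 C 1]])
  have "ennreal (avg j (Complex t y) - ln (modulus j t) / real (N j))
      \<le> mean_kernel j y t"
  proof (rule tendsto_upperbound)
    show "((\<lambda>u. ennreal (avg j (Complex t y) - avg j (Complex t u))) \<longlongrightarrow>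
        ennreal (avg j (Complex t y) - ln (modulus j t) / real (N j))) (at_right 0)"
      by (intro tendsto_intros lim)
    show "\<forall>\<^sub>F u in at_right 0. ennreal (avg j (Complex t y) - avg j (Complex t u))
        \<le> mean_kernel j y t"
      using eventually_at_right_real[OF y] by eventually_elim (rule avg_diff_le, auto)
  qed simp
  then have "ennreal (avg j (Complex t y) - L) \<le> mean_kernel j y t"
    by (rule order_trans[rotated]) (use le in \<open>intro ennreal_leI, simp\<close>)
  moreover have "ennreal (avg j (Complex t y)) \<le> ennreal L + ennreal (avg j (Complex t y) - L)"
  proof (cases "L \<le> avg j (Complex t y)")
    case True
    then show ?thesis using L0 by (simp flip: ennreal_plus)
  next
    case False
    then have "ennreal (avg j (Complex t y)) \<le> ennreal L" by (intro ennreal_leI) auto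
    then show ?thesis by (simp add: add_increasing2)
  qed
  ultimately show ?thesis unfolding L_def[symmetric] by (meson add_left_mono order_trans)
qed

lemma growth_rate_tendsto_0:
  assumes "0 < C"
  shows "(\<lambda>j. ln (C * real (Suc (N j))) / real (N j)) \<longlonglongrightarrow> 0"
proof -
  have "(\<lambda>n. ln (C * real (Suc n)) / real n) \<longlonglongrightarrow> 0" using assms by real_asymp
  from filterlim_compose[OF this N_lim] show ?thesis .
qed

lemma growth_constant_nat:
  "(\<exists>C. \<forall>j. modulus j t \<le> C * real (Suc (N j))) \<longleftrightarrow> (\<exists>C::nat. \<forall>j. modulus j t \<le> real C * real (Suc (N j)))"
proof
  assume "\<exists>C. \<forall>j. modulus j t \<le> C * real (Suc (N j))"
  then obtain C where C: "\<And>j. modulus j t \<le> C * real (Suc (N j))" by blast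
  obtain n :: nat where "C \<le> real n" using real_arch_simple by blast
  then have "C * real (Suc (N j)) \<le> real n * real (Suc (N j))" for j by (intro mult_right_mono) auto
  with C show "\<exists>C::nat. \<forall>j. modulus j t \<le> real C * real (Suc (N j))" by (meson order_trans)
qed blast

lemma exceptional_set_measurable:
  "{t. 0 < \<Gamma> t \<and> (\<exists>C. \<forall>j. modulus j t \<le> C * real (Suc (N j)))} \<in> sets borel"
proof -
  note growth_constant_nat
  moreover have "{t \<in> space borel. 0 < \<Gamma> t \<and> (\<exists>C::nat. \<forall>j. modulus j t \<le> real C * real (Suc (N j)))} \<in> sets borel"
    by measurable
  ultimately show ?thesis by simp
qed

text \<open>
The upper envelope theorem in the form needed here. On a compact subset \<open>K\<close> where the growth bound is uniform and the
averaged kernel is uniformly small, integrating \<open>avg_le_of_growth\<close> gives \<open>\<integral>\<^sub>K \<gamma>(t+iy\<^sub>m) d\<mu> \<le> \<eta>\<^sub>m \<rightarrow> 0\<close>,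
although \<open>\<gamma>(t+iy) \<ge> \<Gamma>(t) > 0\<close> on \<open>K\<close>.
\<close>

lemma capacity_zero_polynomial_growth:
  "log_capacity {t. 0 < \<Gamma> t \<and> (\<exists>C. \<forall>j. modulus j t \<le> C * real (Suc (N j)))} = 0"
proof (rule log_capacity_zeroI, rule ccontr)
  fix \<mu> :: "real measure"
  let ?S = "{t. 0 < \<Gamma> t \<and> (\<exists>C. \<forall>j. modulus j t \<le> C * real (Suc (N j)))}"
  assume "\<mu> \<in> compactly_carried_probabilities ?S"
  then obtain K0 where pr: "prob_space \<mu>" and sets_mu [measurable_cong, simp]: "sets \<mu> = sets borel"
    and K0: "compact K0" "K0 \<subseteq> ?S" "emeasure \<mu> K0 = 1"
    by (auto simp: compactly_carried_probabilities_def)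
  interpret prob_space \<mu> by (rule pr)
  have [measurable]: "K0 \<in> sets borel" using K0 by (simp add: borel_compact)
  assume "(\<integral>\<^sup>+x. \<integral>\<^sup>+y. neg_ln_dist x y \<partial>\<mu> \<partial>\<mu>) \<noteq> \<infinity>"
  then have e: "(\<integral>\<^sup>+x. \<integral>\<^sup>+y. neg_ln_dist x y \<partial>\<mu> \<partial>\<mu>) < \<infinity>"
    by (simp add: less_top)
  have "(\<integral>\<^sup>+s. \<integral>\<^sup>+t. log_kernel 1 (t - s) \<partial>\<mu> \<partial>\<mu>) \<le> (\<integral>\<^sup>+s. (\<integral>\<^sup>+t. neg_ln_dist s t \<partial>\<mu>) + 1 \<partial>\<mu>)"
  proof (rule nn_integral_mono)
    fix s
    have "(\<integral>\<^sup>+t. log_kernel 1 (t - s) \<partial>\<mu>) \<le> (\<integral>\<^sup>+t. neg_ln_dist s t + 1 \<partial>\<mu>)"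
      using log_kernel_le_neg_ln[of s] log_kernel_sym[of 1 _ s] by (intro nn_integral_mono) auto
    also have "\<dots> = (\<integral>\<^sup>+t. neg_ln_dist s t \<partial>\<mu>) + (\<integral>\<^sup>+t. 1 \<partial>\<mu>)"
      by (rule nn_integral_add) auto
    finally show "(\<integral>\<^sup>+t. log_kernel 1 (t - s) \<partial>\<mu>) \<le> (\<integral>\<^sup>+t. neg_ln_dist s t \<partial>\<mu>) + 1"
      by (simp add: emeasure_space_1)
  qed
  also have "\<dots> = (\<integral>\<^sup>+s. \<integral>\<^sup>+t. neg_ln_dist s t \<partial>\<mu> \<partial>\<mu>) + (\<integral>\<^sup>+s. 1 \<partial>\<mu>)"
    by (rule nn_integral_add) auto
  also have "\<dots> < \<infinity>" using e by (simp add: emeasure_space_1 ennreal_add_less_top)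
  finally have energy: "(\<integral>\<^sup>+s. \<integral>\<^sup>+t. log_kernel 1 (t - s) \<partial>\<mu> \<partial>\<mu>) < \<infinity>" .
  \<comment> \<open>Countably many sets with a uniform constant exhaust \<open>K0\<close>, so one of them has positive measure.\<close>
  define G where "G C = K0 \<inter> {t. \<forall>j. modulus j t \<le> real (Suc C) * real (Suc (N j))}" for C :: nat
  have G_meas [measurable]: "G C \<in> sets borel" for C
  proof -
    have "{t \<in> space borel. \<forall>j. modulus j t \<le> real (Suc C) * real (Suc (N j))} \<in> sets borel"
      by measurable
    then show ?thesis by (simp add: G_def)
  qed
  have "K0 = (\<Union>C. G C)"
  proof -
    have "\<exists>C. t \<in> G C" if "t \<in> K0" for t
    proof -
      obtain n :: nat where n: "\<And>j. modulus j t \<le> real n * real (Suc (N j))"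
        using K0 \<open>t \<in> K0\<close> growth_constant_nat[of t] by blast
      have "real n * real (Suc (N j)) \<le> real (Suc n) * real (Suc (N j))" for j by (intro mult_right_mono) auto
      with n have "\<forall>j. modulus j t \<le> real (Suc n) * real (Suc (N j))" by (meson order_trans)
      then show ?thesis using that by (auto simp: G_def)
    qed
    then show ?thesis by (auto simp: G_def)
  qed
  then have "emeasure \<mu> (\<Union>C. G C) \<noteq> 0" using K0 by simp
  then obtain C where C: "emeasure \<mu> (G C) \<noteq> 0"
    using emeasure_UN_eq_0[of \<mu> G] by (metis G_meas image_subset_iff sets_mu)
  obtain K \<eta> y where K: "compact K" "K \<subseteq> G C" "emeasure \<mu> K > 0" and y: "\<And>m. 0 < y m" "y \<longlonglongrightarrow> (0::real)"
    and \<eta>: "\<eta> \<longlonglongrightarrow> (0::ennreal)" "\<And>m s. (\<integral>\<^sup>+t. log_kernel (y m) (t - s) * indicator K t \<partial>\<mu>) \<le> \<eta> m"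
    by (rule log_potential_uniformly_small[OF sets_mu finite_measure_axioms G_meas[of C] _ energy])
       (use C in \<open>auto simp: zero_less_iff_neq_zero\<close>)
  have [measurable]: "K \<in> sets borel" using K by (simp add: borel_compact)
  note [measurable] = \<gamma>_measurable[OF y(1)]
  have bound: "(\<integral>\<^sup>+t. ennreal (\<gamma> (Complex t (y m))) * indicator K t \<partial>\<mu>) \<le> \<eta> m" for m
  proof -
    define L where "L j = ln (real (Suc C) * real (Suc (N j))) / real (N j)" for j
    have L: "L \<longlonglongrightarrow> 0" unfolding L_def by (rule growth_rate_tendsto_0) simp
    have "(\<integral>\<^sup>+t. ennreal (\<gamma> (Complex t (y m))) * indicator K t \<partial>\<mu>)
       = (\<integral>\<^sup>+t. liminf (\<lambda>j. ennreal (avg j (Complex t (y m))) * indicator K t) \<partial>\<mu>)"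
    proof (rule nn_integral_cong)
      fix t
      have "(\<lambda>j. ennreal (avg j (Complex t (y m)))) \<longlonglongrightarrow> ennreal (\<gamma> (Complex t (y m)))"
        using y by (intro tendsto_intros conv) auto
      then have "(\<lambda>j. ennreal (avg j (Complex t (y m))) * indicator K t) \<longlonglongrightarrow> ennreal (\<gamma> (Complex t (y m))) * indicator K t"
        by (cases "t \<in> K") auto
      then show "ennreal (\<gamma> (Complex t (y m))) * indicator K t = liminf (\<lambda>j. ennreal (avg j (Complex t (y m))) * indicator K t)"
        by (rule lim_imp_Liminf[OF sequentially_bot, symmetric])
    qed
    also have "\<dots> \<le> liminf (\<lambda>j. \<integral>\<^sup>+t. ennreal (avg j (Complex t (y m))) * indicator K t \<partial>\<mu>)"
      by (rule nn_integral_liminf) measurable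
    also have "\<dots> \<le> liminf (\<lambda>j. ennreal (L j) + \<eta> m)"
    proof (rule Liminf_mono, use N_pos in eventually_elim)
      case (elim j)
      have "(\<integral>\<^sup>+t. ennreal (avg j (Complex t (y m))) * indicator K t \<partial>\<mu>)
         \<le> (\<integral>\<^sup>+t. ennreal (L j) + (\<Sum>i<N j. ennreal (1 / real (N j)) * (log_kernel (y m) (t - x j i) * indicator K t)) \<partial>\<mu>)"
      proof (rule nn_integral_mono)
        fix t
        show "ennreal (avg j (Complex t (y m))) * indicator K t \<le>
           ennreal (L j) + (\<Sum>i<N j. ennreal (1 / real (N j)) * (log_kernel (y m) (t - x j i) * indicator K t))"
        proof (cases "t \<in> K")
          case True
          then have "modulus j t \<le> real (Suc C) * real (Suc (N j))" using K(2) by (auto simp: G_def)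
          from avg_le_of_growth[OF y(1) _ this] True show ?thesis by (simp add: L_def)
        qed simp
      qed
      also have "\<dots> = (\<integral>\<^sup>+t. ennreal (L j) \<partial>\<mu>) + (\<integral>\<^sup>+t. (\<Sum>i<N j. ennreal (1 / real (N j)) * (log_kernel (y m) (t - x j i) * indicator K t)) \<partial>\<mu>)"
        by (rule nn_integral_add) auto
      also have "(\<integral>\<^sup>+t. (\<Sum>i<N j. ennreal (1 / real (N j)) * (log_kernel (y m) (t - x j i) * indicator K t)) \<partial>\<mu>)
          = (\<Sum>i<N j. ennreal (1 / real (N j)) * (\<integral>\<^sup>+t. log_kernel (y m) (t - x j i) * indicator K t \<partial>\<mu>))"
        by (subst nn_integral_sum) (auto simp: nn_integral_cmult)
      also have "\<dots> \<le> (\<Sum>i<N j. ennreal (1 / real (N j)) * \<eta> m)"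
        by (intro sum_mono mult_left_mono \<eta>) auto
      also have "\<dots> = \<eta> m" using elim by (rule sum_average)
      finally show ?case by (simp add: emeasure_space_1)
    qed
    also have "\<dots> = \<eta> m"
    proof (rule lim_imp_Liminf[OF sequentially_bot])
      have "(\<lambda>j. ennreal (L j) + \<eta> m) \<longlonglongrightarrow> ennreal 0 + \<eta> m" by (intro tendsto_intros L)
      then show "(\<lambda>j. ennreal (L j) + \<eta> m) \<longlonglongrightarrow> \<eta> m" by simp
    qed
    finally show ?thesis .
  qed
  have "(\<integral>\<^sup>+t. ennreal (\<Gamma> t) * indicator K t \<partial>\<mu>) \<le> \<eta> m" for m
  proof -
    have "(\<integral>\<^sup>+t. ennreal (\<Gamma> t) * indicator K t \<partial>\<mu>) \<le> (\<integral>\<^sup>+t. ennreal (\<gamma> (Complex t (y m))) * indicator K t \<partial>\<mu>)"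
      by (intro nn_integral_mono mult_right_mono ennreal_leI \<Gamma>_le y) auto
    then show ?thesis using bound[of m] by (rule order_trans)
  qed
  then have "(\<integral>\<^sup>+t. ennreal (\<Gamma> t) * indicator K t \<partial>\<mu>) \<le> 0"
    by (intro tendsto_lowerbound[OF \<eta>(1)]) auto
  then have "AE t in \<mu>. ennreal (\<Gamma> t) * indicator K t = 0"
    by (subst (asm) le_zero_eq, subst (asm) nn_integral_0_iff_AE) auto
  then have "AE t in \<mu>. t \<notin> K"
  proof eventually_elim
    case (elim t)
    then show ?case using K(2) K0(2) by (fastforce simp: G_def indicator_def split: if_splits)
  qed
  then have "emeasure \<mu> K = 0" using AE_iff_measurable[of K \<mu> "\<lambda>t. t \<notin> K"] sets_eq_imp_space_eq[OF sets_mu] by auto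
  with K(3) show False by simp
qed

end

section \<open>The space of square summable sequences\<close>

definition lincomb :: "complex \<Rightarrow> (nat \<Rightarrow> complex) \<Rightarrow> complex \<Rightarrow> (nat \<Rightarrow> complex) \<Rightarrow> nat \<Rightarrow> complex" where
  "lincomb c u d v = (\<lambda>n. c * u n + d * v n)"

lemma ell2_lincomb: 
  assumes "u \<in> ell2" "v \<in> ell2"
  shows "lincomb c u d v \<in> ell2"
proof -
  have "summable (\<lambda>n. 2 * ((cmod c)\<^sup>2 * (cmod (u n))\<^sup>2) + 2 * ((cmod d)\<^sup>2 * (cmod (v n))\<^sup>2))"
    using assms by (intro summable_add summable_mult) (auto simp: ell2_def)
  moreover have "norm ((cmod (lincomb c u d v n))\<^sup>2) \<le> 2 * ((cmod c)\<^sup>2 * (cmod (u n))\<^sup>2) + 2 * ((cmod d)\<^sup>2 * (cmod (v n))\<^sup>2)" for n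
  proof -
    have "(cmod (c * u n + d * v n))\<^sup>2 \<le> (cmod (c * u n) + cmod (d * v n))\<^sup>2"
      by (intro power_mono norm_triangle_ineq) auto
    also have "\<dots> \<le> 2 * (cmod (c * u n))\<^sup>2 + 2 * (cmod (d * v n))\<^sup>2"
      using sum_squares_bound[of "cmod (c * u n)" "cmod (d * v n)"] by (simp add: power2_sum)
    finally show ?thesis by (simp add: lincomb_def norm_mult power_mult_distrib)
  qed
  ultimately have "summable (\<lambda>n. (cmod (lincomb c u d v n))\<^sup>2)" by (rule summable_comparison_test'[where N = 0])
  then show ?thesis using assms by (simp add: ell2_def lincomb_def)
qed

lemma ell2_inner_summable:
  assumes "u \<in> ell2" "v \<in> ell2"
  shows "summable (\<lambda>n. cnj (u n) * v n)"
proof (rule summable_comparison_test'[where N = 0])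
  show "summable (\<lambda>n. (cmod (u n))\<^sup>2 + (cmod (v n))\<^sup>2)" using assms by (intro summable_add) (auto simp: ell2_def)
  fix n
  have "2 * (cmod (u n) * cmod (v n)) \<le> (cmod (u n))\<^sup>2 + (cmod (v n))\<^sup>2"
    using sum_squares_bound[of "cmod (u n)" "cmod (v n)"] by simp
  moreover have "0 \<le> cmod (u n) * cmod (v n)" by simp
  moreover have "norm (cnj (u n) * v n) = cmod (u n) * cmod (v n)" by (simp add: norm_mult)
  ultimately show "norm (cnj (u n) * v n) \<le> (cmod (u n))\<^sup>2 + (cmod (v n))\<^sup>2" by linarith
qed

lemma inner_lincomb_right:
  assumes "w \<in> ell2" "u \<in> ell2" "v \<in> ell2"
  shows "ell2_inner w (lincomb c u d v) = c * ell2_inner w u + d * ell2_inner w v"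
proof -
  have "(\<lambda>n. cnj (w n) * lincomb c u d v n) = (\<lambda>n. c * (cnj (w n) * u n) + d * (cnj (w n) * v n))"
    by (auto simp: lincomb_def algebra_simps)
  moreover have "(\<lambda>n. c * (cnj (w n) * u n) + d * (cnj (w n) * v n)) sums (c * ell2_inner w u + d * ell2_inner w v)"
    unfolding ell2_inner_def by (intro sums_add sums_mult summable_sums ell2_inner_summable assms)
  ultimately show ?thesis unfolding ell2_inner_def by (simp add: sums_iff)
qed

lemma inner_commute:
  assumes "u \<in> ell2" "v \<in> ell2"
  shows "ell2_inner u v = cnj (ell2_inner v u)"
proof -
  have "(\<lambda>n. cnj (cnj (v n) * u n)) sums cnj (ell2_inner v u)"
    unfolding ell2_inner_def sums_cnj by (intro summable_sums ell2_inner_summable assms)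
  then show ?thesis unfolding ell2_inner_def by (simp add: sums_iff mult.commute)
qed

lemma inner_lincomb_left:
  assumes "w \<in> ell2" "u \<in> ell2" "v \<in> ell2"
  shows "ell2_inner (lincomb c u d v) w = cnj c * ell2_inner u w + cnj d * ell2_inner v w"
  using inner_lincomb_right[OF assms, of c d] inner_commute[of _ w] assms by (simp add: ell2_lincomb)

lemma norm_sq_inner:
  assumes "u \<in> ell2"
  shows "complex_of_real ((ell2_norm u)\<^sup>2) = ell2_inner u u"
proof -
  have s: "summable (\<lambda>n. (cmod (u n))\<^sup>2)" using assms by (simp add: ell2_def)
  have "(ell2_norm u)\<^sup>2 = (\<Sum>n. (cmod (u n))\<^sup>2)"
    unfolding ell2_norm_def using suminf_nonneg[OF s] by simp
  moreover have "cnj (u n) * u n = complex_of_real ((cmod (u n))\<^sup>2)" for n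
    using complex_norm_square[of "u n"] by (simp add: mult.commute del: of_real_power)
  ultimately show ?thesis unfolding ell2_inner_def using suminf_of_real[OF s, where 'a = complex] by simp
qed

lemma norm_sq_Re: "u \<in> ell2 \<Longrightarrow> (ell2_norm u)\<^sup>2 = Re (ell2_inner u u)"
  using norm_sq_inner[of u] by (metis Re_complex_of_real)

lemma delta_ell2: "1 \<le> n \<Longrightarrow> delta n \<in> ell2"
  unfolding ell2_def using summable_finite[of "{n}" "\<lambda>k. (cmod (delta n k))\<^sup>2"] by (auto simp: delta_def)

lemma inner_delta: "ell2_inner (delta n) v = v n"
proof -
  have "(\<lambda>k. cnj (delta n k) * v k) = (\<lambda>k. if k = n then v k else 0)" by (auto simp: delta_def)
  then show ?thesis using sums_single[of n v] unfolding ell2_inner_def by (metis sums_unique)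
qed

lemma norm_sq_delta: "1 \<le> n \<Longrightarrow> (ell2_norm (delta n))\<^sup>2 = 1"
  using norm_sq_Re[OF delta_ell2, of n] by (simp add: inner_delta) (simp add: delta_def)

lemma ell2_tendsto_0:
  assumes "u \<in> ell2"
  shows "u \<longlonglongrightarrow> 0"
proof -
  have "(\<lambda>n. (cmod (u n))\<^sup>2) \<longlonglongrightarrow> 0"
    by (rule summable_LIMSEQ_zero) (use assms in \<open>simp add: ell2_def\<close>)
  then have "(\<lambda>n. sqrt ((cmod (u n))\<^sup>2)) \<longlonglongrightarrow> sqrt 0" by (intro tendsto_intros)
  then show ?thesis by (simp add: tendsto_norm_zero_iff)
qed

lemma ell2I_bounded:
  assumes "u 0 = 0" "\<And>L. (\<Sum>n=1..L. (cmod (u n))\<^sup>2) \<le> B"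
  shows "u \<in> ell2"
proof -
  have "(\<Sum>k\<le>n. (cmod (u k))\<^sup>2) \<le> B" for n
    using assms by (simp add: atMost_atLeast0 sum.atLeast_Suc_atMost)
  then show ?thesis using assms(1) by (auto simp: ell2_def intro!: bounded_imp_summable)
qed

section \<open>Finite Borel measures on the line\<close>

lemma finite_borel_measureI:
  fixes M :: "real measure"
  assumes "sets M = sets borel" "emeasure M UNIV \<noteq> \<infinity>"
  shows "finite_borel_measure M"
proof -
  have sp: "space M = UNIV" using sets_eq_imp_space_eq[OF assms(1)] by simp
  interpret finite_measure M by standard (use assms sp in auto)
  show ?thesis by standard (use assms in auto)
qed

lemma measure_eqI_Iic:
  fixes M N :: "real measure"
  assumes "sets M = sets borel" "sets N = sets borel" "emeasure M UNIV \<noteq> \<infinity>" "emeasure N UNIV \<noteq> \<infinity>"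
    and "\<And>s. emeasure M {..s} = emeasure N {..s}"
  shows "M = N"
  by (rule cdf_unique'[OF finite_borel_measureI finite_borel_measureI])
     (use assms in \<open>auto simp: cdf_def measure_def\<close>)

text \<open>
Sums of measures let identities with coefficients of both signs be stated between positive measures.
\<close>

definition add_measure :: "real measure \<Rightarrow> real measure \<Rightarrow> real measure" where
  "add_measure M N = measure_of UNIV (sets borel) (\<lambda>A. emeasure M A + emeasure N A)"

lemma sets_add_measure [simp, measurable_cong]: "sets (add_measure M N) = sets borel"
  unfolding add_measure_def using sets.sigma_sets_eq[of "borel :: real measure"] by simp

lemma emeasure_add_measure:
  assumes M: "sets M = sets borel" and N: "sets N = sets borel" and A: "A \<in> sets borel"
  shows "emeasure (add_measure M N) A = emeasure M A + emeasure N A"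
  unfolding add_measure_def
proof (rule emeasure_measure_of_sigma)
  show "sigma_algebra UNIV (sets (borel :: real measure))" using sets.sigma_algebra_axioms[of borel] by simp
  show "positive (sets borel) (\<lambda>A. emeasure M A + emeasure N A)" by (simp add: positive_def)
  show "countably_additive (sets borel) (\<lambda>A. emeasure M A + emeasure N A)"
  proof (rule countably_additiveI)
    fix B :: "nat \<Rightarrow> real set" assume B: "range B \<subseteq> sets borel" "disjoint_family B"
    then have "(\<Sum>i. emeasure M (B i)) = emeasure M (\<Union>i. B i)" "(\<Sum>i. emeasure N (B i)) = emeasure N (\<Union>i. B i)"
      using M N by (auto intro!: suminf_emeasure)
    then show "(\<Sum>i. emeasure M (B i) + emeasure N (B i)) = emeasure M (\<Union>i. B i) + emeasure N (\<Union>i. B i)"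
      by (simp add: suminf_add[symmetric])
  qed
qed (rule A)

lemma nn_integral_add_measure:
  assumes M [measurable_cong]: "sets M = sets borel" and N [measurable_cong]: "sets N = sets borel"
    and f: "f \<in> borel_measurable borel"
  shows "(\<integral>\<^sup>+t. f t \<partial>(add_measure M N)) = (\<integral>\<^sup>+t. f t \<partial>M) + (\<integral>\<^sup>+t. f t \<partial>N)"
  using f
proof (induction rule: borel_measurable_induct)
  case (cong f g)
  then show ?case by (metis (no_types) UNIV_I ext space_borel)
next
  case (set A)
  then show ?case by (simp add: M N emeasure_add_measure)
next
  case (mult u c)
  note [measurable] = mult(2)
  show ?case by (simp add: nn_integral_cmult mult distrib_left)
next
  case (add u v)
  have [measurable]: "u \<in> borel_measurable borel" "v \<in> borel_measurable borel" using add by auto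
  show ?case by (simp add: nn_integral_add add.IH ac_simps)
next
  case (seq U)
  note [measurable] = seq(1)
  have [measurable]: "(\<lambda>x. U i x) \<in> borel_measurable borel" for i by measurable
  have S: "(\<integral>\<^sup>+t. (SUP i. U i) t \<partial>L) = (SUP i. \<integral>\<^sup>+t. U i t \<partial>L)" if [measurable_cong]: "sets L = sets borel" for L :: "real measure"
    unfolding SUP_apply using seq by (intro nn_integral_monotone_convergence_SUP) auto
  have inc: "incseq (\<lambda>i. \<integral>\<^sup>+t. U i t \<partial>L)" for L :: "real measure"
    using seq(3) by (auto simp: incseq_def le_fun_def intro!: nn_integral_mono)
  show ?case unfolding S[OF sets_add_measure] S[OF M] S[OF N] seq.IH
    by (rule ennreal_SUP_add) (rule inc)+
qed

section \<open>Spectral measures of a bounded symmetric operator\<close>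

text \<open>
\<open>F u\<close> below denotes the distribution function \<open>t \<mapsto> \<parallel>E(t)u\<parallel>\<^sup>2\<close> and \<open>\<mu> u\<close> its measure. The resolution of the identity
is tied to \<open>T\<close> only by \<open>\<integral> t d\<mu>\<^sub>u = \<langle>u, Tu\<rangle>\<close>; the aim is the second moment
\<open>\<integral> t\<^sup>2 d\<mu>\<^sub>u = \<parallel>Tu\<parallel>\<^sup>2\<close> and, from it, the functional calculus \<open>\<mu>\<^bsub>q(T)u\<^esub> = q\<^sup>2 \<mu>\<^sub>u\<close> for products \<open>q\<close> of real linear factors.
\<close>

locale spectral_operator =
  fixes T :: "(nat \<Rightarrow> complex) \<Rightarrow> nat \<Rightarrow> complex" and E :: "real \<Rightarrow> (nat \<Rightarrow> complex) \<Rightarrow> nat \<Rightarrow> complex"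
  assumes T_ell2: "u \<in> ell2 \<Longrightarrow> T u \<in> ell2"
    and T_lincomb: "u \<in> ell2 \<Longrightarrow> v \<in> ell2 \<Longrightarrow> T (lincomb c u d v) = lincomb c (T u) d (T v)"
    and T_symmetric: "u \<in> ell2 \<Longrightarrow> v \<in> ell2 \<Longrightarrow> ell2_inner (T u) v = ell2_inner u (T v)"
    and resolution: "spectral_resolution T E"
begin

lemma E_ell2 [simp]: "u \<in> ell2 \<Longrightarrow> E t u \<in> ell2"
  and E_idem: "u \<in> ell2 \<Longrightarrow> E t (E t u) = E t u"
  and E_lincomb: "u \<in> ell2 \<Longrightarrow> v \<in> ell2 \<Longrightarrow> E t (lincomb c u d v) = lincomb c (E t u) d (E t v)"
  and E_symmetric: "u \<in> ell2 \<Longrightarrow> v \<in> ell2 \<Longrightarrow> ell2_inner (E t u) v = ell2_inner u (E t v)"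
  using resolution unfolding spectral_resolution_def ell2_projection_def lincomb_def by blast+

lemma E_min: "u \<in> ell2 \<Longrightarrow> E s (E t u) = E (min s t) u"
  using resolution E_idem[of u] unfolding spectral_resolution_def by (metis linear min_absorb1 min_absorb2)

lemma inner_E: "u \<in> ell2 \<Longrightarrow> v \<in> ell2 \<Longrightarrow> ell2_inner (E s u) (E t v) = ell2_inner u (E (min s t) v)"
  by (simp add: E_symmetric E_min)

definition F :: "(nat \<Rightarrow> complex) \<Rightarrow> real \<Rightarrow> real" where "F u t = (ell2_norm (E t u))\<^sup>2"

lemma F_inner: "u \<in> ell2 \<Longrightarrow> complex_of_real (F u t) = ell2_inner u (E t u)"
  by (simp only: F_def norm_sq_inner E_ell2 inner_E min.idem)

lemma norm_sq_lincomb: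
  assumes "u \<in> ell2" "v \<in> ell2"
  shows "complex_of_real ((ell2_norm (lincomb c u d v))\<^sup>2) =
    cnj c * c * ell2_inner u u + cnj c * d * ell2_inner u v + cnj d * c * ell2_inner v u + cnj d * d * ell2_inner v v"
  using assms by (simp add: norm_sq_inner ell2_lincomb inner_lincomb_left inner_lincomb_right algebra_simps del: of_real_power)

lemma F_diff:
  assumes u: "u \<in> ell2" and "s \<le> t"
  shows "(ell2_norm (lincomb 1 (E t u) (-1) (E s u)))\<^sup>2 = F u t - F u s"
proof -
  have "complex_of_real ((ell2_norm (lincomb 1 (E t u) (-1) (E s u)))\<^sup>2) = complex_of_real (F u t - F u s)"
    using assms by (subst norm_sq_lincomb) (simp_all add: inner_E F_inner min_absorb1 min_absorb2)
  then show ?thesis by (simp only: of_real_eq_iff)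
qed

lemma F_total_diff:
  assumes u: "u \<in> ell2"
  shows "(ell2_norm (lincomb 1 (E s u) (-1) u))\<^sup>2 = (ell2_norm u)\<^sup>2 - F u s"
proof -
  have "complex_of_real ((ell2_norm (lincomb 1 (E s u) (-1) u))\<^sup>2) = complex_of_real ((ell2_norm u)\<^sup>2 - F u s)"
    using assms by (subst norm_sq_lincomb) (simp_all add: inner_E F_inner E_symmetric E_idem norm_sq_inner del: of_real_power)
  then show ?thesis by (simp only: of_real_eq_iff)
qed

lemma F_mono: "u \<in> ell2 \<Longrightarrow> s \<le> t \<Longrightarrow> F u s \<le> F u t"
  using F_diff[of u s t] zero_le_power2 by (metis diff_ge_0_iff_ge)

lemma F_right_cont: 
  assumes u: "u \<in> ell2"
  shows "continuous (at_right t) (F u)"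
proof -
  have "((\<lambda>s. ell2_norm (\<lambda>n. E s u n - E t u n)) \<longlongrightarrow> 0) (at_right t)"
    using resolution u unfolding spectral_resolution_def by blast
  then have "((\<lambda>s. F u t + (ell2_norm (\<lambda>n. E s u n - E t u n))\<^sup>2) \<longlongrightarrow> F u t + 0\<^sup>2) (at_right t)"
    by (intro tendsto_intros)
  then have "(F u \<longlongrightarrow> F u t + 0\<^sup>2) (at_right t)"
  proof (rule Lim_transform_eventually)
    show "\<forall>\<^sub>F s in at_right t. F u t + (ell2_norm (\<lambda>n. E s u n - E t u n))\<^sup>2 = F u s"
      using eventually_at_right_less[of t]
      by eventually_elim (use F_diff[OF u] in \<open>simp add: lincomb_def\<close>)
  qed
  then show ?thesis by (simp add: continuous_within)
qed

lemma F_at_bot: "u \<in> ell2 \<Longrightarrow> (F u \<longlongrightarrow> 0) at_bot"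
proof -
  assume u: "u \<in> ell2"
  then have "((\<lambda>s. ell2_norm (E s u)) \<longlongrightarrow> 0) at_bot" using resolution unfolding spectral_resolution_def by blast
  then have "((\<lambda>s. (ell2_norm (E s u))\<^sup>2) \<longlongrightarrow> 0\<^sup>2) at_bot" by (intro tendsto_intros)
  then show ?thesis unfolding F_def[abs_def] by simp
qed

lemma F_at_top:
  assumes u: "u \<in> ell2"
  shows "(F u \<longlongrightarrow> (ell2_norm u)\<^sup>2) at_top"
proof -
  have "((\<lambda>s. ell2_norm (\<lambda>n. E s u n - u n)) \<longlongrightarrow> 0) at_top"
    using resolution u unfolding spectral_resolution_def by blast
  then have "((\<lambda>s. (ell2_norm u)\<^sup>2 - (ell2_norm (\<lambda>n. E s u n - u n))\<^sup>2) \<longlongrightarrow> (ell2_norm u)\<^sup>2 - 0\<^sup>2) at_top"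
    by (intro tendsto_intros)
  moreover have "(ell2_norm u)\<^sup>2 - (ell2_norm (\<lambda>n. E s u n - u n))\<^sup>2 = F u s" for s
    using F_total_diff[OF u, of s] by (simp add: lincomb_def)
  ultimately show ?thesis by simp
qed

definition \<mu> :: "(nat \<Rightarrow> complex) \<Rightarrow> real measure" where "\<mu> u = interval_measure (F u)"

lemma sets_\<mu> [simp, measurable_cong]: "sets (\<mu> u) = sets borel" and space_\<mu> [simp]: "space (\<mu> u) = UNIV"
  by (simp_all add: \<mu>_def)

lemma emeasure_\<mu>_Iic: "u \<in> ell2 \<Longrightarrow> emeasure (\<mu> u) {..s} = ennreal (F u s)"
  unfolding \<mu>_def by (rule emeasure_interval_measure_Iic) (auto intro: F_mono F_right_cont F_at_bot)

lemma emeasure_\<mu>_UNIV: "u \<in> ell2 \<Longrightarrow> emeasure (\<mu> u) UNIV = ennreal ((ell2_norm u)\<^sup>2)"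
  unfolding \<mu>_def by (rule interval_measure_UNIV) (auto intro: F_mono F_right_cont F_at_bot F_at_top)

lemma finite_\<mu>: "u \<in> ell2 \<Longrightarrow> finite_measure (\<mu> u)"
  by standard (simp add: emeasure_\<mu>_UNIV)

lemma first_moment:
  assumes "u \<in> ell2"
  shows "integrable (\<mu> u) (\<lambda>t. t)" "complex_of_real (\<integral>t. t \<partial>\<mu> u) = ell2_inner u (T u)"
  using resolution assms unfolding spectral_resolution_def \<mu>_def F_def[abs_def] by blast+

lemma F_E: "u \<in> ell2 \<Longrightarrow> F (E s u) t = F u (min s t)"
  by (simp add: F_def E_min min.commute)

lemma \<mu>_E:
  assumes u: "u \<in> ell2"
  shows "\<mu> (E s u) = density (\<mu> u) (indicator {..s})"
proof (rule measure_eqI_Iic)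
  have d: "emeasure (density (\<mu> u) (indicator {..s})) A = emeasure (\<mu> u) ({..s} \<inter> A)" if "A \<in> sets borel" for A
    using that by (subst emeasure_density) (simp_all flip: indicator_inter_arith)
  show "emeasure (\<mu> (E s u)) {..t} = emeasure (density (\<mu> u) (indicator {..s})) {..t}" for t
    using u by (simp add: d emeasure_\<mu>_Iic F_E)
  show "emeasure (\<mu> (E s u)) UNIV \<noteq> \<infinity>" using u by (simp add: emeasure_\<mu>_UNIV)
  show "emeasure (density (\<mu> u) (indicator {..s})) UNIV \<noteq> \<infinity>"
    using u by (simp add: d emeasure_\<mu>_Iic)
qed auto

lemma \<mu>_complement:
  assumes u: "u \<in> ell2"
  shows "\<mu> (lincomb 1 u (-1) (E s u)) = density (\<mu> u) (indicator {s<..})"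
proof (rule measure_eqI_Iic)
  let ?y = "lincomb 1 u (-1) (E s u)"
  have y: "?y \<in> ell2" using u by (simp add: ell2_lincomb)
  have d: "emeasure (density (\<mu> u) (indicator {s<..})) A = emeasure (\<mu> u) ({s<..} \<inter> A)" if "A \<in> sets borel" for A
    using that by (subst emeasure_density) (simp_all flip: indicator_inter_arith)
  show "emeasure (\<mu> ?y) {..t} = emeasure (density (\<mu> u) (indicator {s<..})) {..t}" for t
  proof -
    have "F ?y t = F u t - F u (min s t)"
      using F_diff[OF u, of "min s t" t] u by (simp add: F_def E_lincomb E_min min.commute)
    moreover have "emeasure (\<mu> u) ({s<..} \<inter> {..t}) = ennreal (F u t - F u (min s t))"
    proof -
      interpret finite_measure "\<mu> u" by (rule finite_\<mu>[OF u])
      have "{s<..} \<inter> {..t} = {..t} - {..min s t}" by auto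
      then show ?thesis using u by (simp add: emeasure_Diff emeasure_\<mu>_Iic ennreal_minus[symmetric] F_def)
    qed
    ultimately show ?thesis using y by (simp add: d emeasure_\<mu>_Iic)
  qed
  show "emeasure (\<mu> ?y) UNIV \<noteq> \<infinity>" using y by (simp add: emeasure_\<mu>_UNIV)
  have "emeasure (\<mu> u) ({s<..} \<inter> UNIV) \<le> emeasure (\<mu> u) UNIV" by (intro emeasure_mono) auto
  then show "emeasure (density (\<mu> u) (indicator {s<..})) UNIV \<noteq> \<infinity>"
    using u by (auto simp: d emeasure_\<mu>_UNIV top_unique)
qed auto

lemma integral_density_indicator:
  assumes [measurable]: "A \<in> sets borel"
  shows "(\<integral>t. t \<partial>density (\<mu> u) (indicator A)) = (\<integral>t. indicator A t * t \<partial>\<mu> u)"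
proof -
  have "density (\<mu> u) (indicator A) = density (\<mu> u) (\<lambda>t. ennreal (indicator A t))"
    by (intro density_cong) (auto simp: indicator_def)
  then show ?thesis by (simp add: integral_density)
qed

text \<open>
The first moment is additive over the two pieces \<open>E(s)u\<close> and \<open>u - E(s)u\<close>, hence so is \<open>\<langle>u, Tu\<rangle>\<close>, and the
cross terms cancel. Applying this to \<open>x + y\<close> and to \<open>x + iy\<close>, with \<open>x\<close> in the range of \<open>E(s)\<close> and \<open>y\<close> in its
complement, shows that each cross term vanishes.
\<close>

lemma E_T_orthogonal:
  assumes p: "p \<in> ell2" and q: "q \<in> ell2"
  shows "ell2_inner (E s p) (T (lincomb 1 q (-1) (E s q))) = 0"
    and "ell2_inner (lincomb 1 q (-1) (E s q)) (T (E s p)) = 0"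
proof -
  define x where "x = E s p"
  define y where "y = lincomb 1 q (-1) (E s q)"
  have xy: "x \<in> ell2" "y \<in> ell2" using p q by (simp_all add: x_def y_def ell2_lincomb)
  have Ex: "E s x = x" using p by (simp add: x_def E_idem)
  have Ey: "E s y = (\<lambda>n. 0)" using q by (simp add: y_def E_lincomb E_idem) (simp add: lincomb_def)
  \<comment> \<open>The cross terms for \<open>x + cy\<close>; the values \<open>c = 1\<close> and \<open>c = i\<close> separate them.\<close>
  have cross: "c * ell2_inner x (T y) + cnj c * ell2_inner y (T x) = 0" for c
  proof -
    define u where "u = lincomb 1 x c y"
    have u: "u \<in> ell2" using xy by (simp add: u_def ell2_lincomb)
    have Eu: "E s u = x" using xy by (simp add: u_def E_lincomb Ex Ey) (simp add: lincomb_def)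
    have uE: "lincomb 1 u (-1) (E s u) = lincomb 1 (\<lambda>n. 0) c y" by (simp add: Eu) (simp add: u_def lincomb_def)
    have z: "(\<lambda>n. 0) \<in> ell2" by (simp add: ell2_def)
    have split: "(\<integral>t. t \<partial>\<mu> u) = (\<integral>t. t \<partial>\<mu> (E s u)) + (\<integral>t. t \<partial>\<mu> (lincomb 1 u (-1) (E s u)))"
    proof -
      have "(\<integral>t. t \<partial>\<mu> (E s u)) + (\<integral>t. t \<partial>\<mu> (lincomb 1 u (-1) (E s u)))
          = (\<integral>t. indicator {..s} t * t \<partial>\<mu> u) + (\<integral>t. indicator {s<..} t * t \<partial>\<mu> u)"
        unfolding \<mu>_E[OF u] \<mu>_complement[OF u] by (simp add: integral_density_indicator)
      also have "\<dots> = (\<integral>t. indicator {..s} t * t + indicator {s<..} t * t \<partial>\<mu> u)"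
        using first_moment(1)[OF u] by (intro Bochner_Integration.integral_add[symmetric] integrable_mult_indicator[where 'b = real, simplified]) auto
      also have "\<dots> = (\<integral>t. t \<partial>\<mu> u)" by (intro Bochner_Integration.integral_cong) (auto simp: indicator_def)
      finally show ?thesis by simp
    qed
    have z0: "ell2_inner (\<lambda>n. 0) w = 0" "ell2_inner w (\<lambda>n. 0) = 0" for w by (simp_all add: ell2_inner_def)
    have "ell2_inner u (T u) = ell2_inner x (T x) + ell2_inner (lincomb 1 (\<lambda>n. 0) c y) (T (lincomb 1 (\<lambda>n. 0) c y))"
      unfolding uE[symmetric] first_moment(2)[OF u, symmetric] split of_real_add
      using u xy by (simp add: first_moment(2)[symmetric] Eu ell2_lincomb)
    moreover have "lincomb 1 (\<lambda>n. 0) c y = lincomb 0 y c y" by (simp add: lincomb_def)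
    ultimately have "ell2_inner u (T u) = ell2_inner x (T x) + cnj c * c * ell2_inner y (T y)"
      using xy by (simp add: T_lincomb T_ell2 ell2_lincomb inner_lincomb_left inner_lincomb_right)
    then show ?thesis unfolding u_def
      using xy by (simp add: T_lincomb T_ell2 ell2_lincomb inner_lincomb_left inner_lincomb_right algebra_simps)
  qed
  have "ell2_inner x (T y) + ell2_inner y (T x) = 0" using cross[of 1] by simp
  moreover have "\<i> * (ell2_inner x (T y) - ell2_inner y (T x)) = 0" using cross[of \<i>] by (simp add: algebra_simps)
  ultimately have "ell2_inner x (T y) = 0" "ell2_inner y (T x) = 0" by (auto simp: add_eq_0_iff)
  then show "ell2_inner (E s p) (T (lincomb 1 q (-1) (E s q))) = 0"
    "ell2_inner (lincomb 1 q (-1) (E s q)) (T (E s p)) = 0" by (simp_all add: x_def y_def)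
qed

lemma inner_E_T:
  assumes u: "u \<in> ell2" and p: "p \<in> ell2"
  shows "ell2_inner (E s p) (T u) = ell2_inner (E s p) (T (E s u))"
  using E_T_orthogonal(1)[OF p u, of s] u p by (simp add: T_lincomb T_ell2 inner_lincomb_right)

text \<open>
Both sides have the same inner product with every \<open>\<delta>\<^sub>n\<close>.
\<close>

lemma E_T_commute:
  assumes u: "u \<in> ell2"
  shows "E s (T u) = T (E s u)"
proof
  fix n
  show "E s (T u) n = T (E s u) n"
  proof (cases "n = 0")
    case True
    have "E s (T u) \<in> ell2" "T (E s u) \<in> ell2" using u by (simp_all add: T_ell2)
    then show ?thesis using True by (simp add: ell2_def)
  next
    case False
    then have d: "delta n \<in> ell2" by (intro delta_ell2) simp
    have "ell2_inner (delta n) (E s (T u)) = ell2_inner (E s (delta n)) (T u)" using u d by (simp add: E_symmetric T_ell2)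
    also have "\<dots> = ell2_inner (E s (delta n)) (T (E s u))" by (rule inner_E_T[OF u d])
    also have "\<dots> = ell2_inner (delta n) (T (E s u))"
      using E_T_orthogonal(2)[OF u d, of s] u d by (simp add: inner_lincomb_left T_ell2)
    finally show ?thesis by (simp add: inner_delta)
  qed
qed

lemma partial_first_moment:
  assumes u: "u \<in> ell2"
  shows "ell2_inner (E s u) (T u) = complex_of_real (\<integral>t. indicator {..s} t * t \<partial>\<mu> u)"
  using inner_E_T[OF u u, of s] first_moment(2)[of "E s u"] u by (simp add: \<mu>_E integral_density_indicator)

lemma partial_first_moment_integrable:
  assumes u: "u \<in> ell2"
  shows "integrable (\<mu> u) (\<lambda>t. indicator {..s} t * t)"
  using first_moment(1)[OF u] by (rule integrable_mult_indicator[where 'b = real, simplified, rotated]) auto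

text \<open>
With \<open>v = Tu\<close>, the partial first moments give \<open>d\<mu>\<^bsub>u+v\<^esub> = d\<mu>\<^sub>u + d\<mu>\<^sub>v + 2t d\<mu>\<^sub>u\<close>. Comparing the first moments of
both sides yields \<open>2 \<integral> t\<^sup>2 d\<mu>\<^sub>u = \<langle>u, Tv\<rangle> + \<langle>v, Tu\<rangle> = 2\<parallel>v\<parallel>\<^sup>2\<close>. As \<open>2t\<close> changes sign, its negative part is
moved to the other side, so that both sides are positive measures.
\<close>

lemma second_moment:
  assumes u: "u \<in> ell2"
  shows "(\<integral>\<^sup>+t. ennreal (t\<^sup>2) \<partial>\<mu> u) = ennreal ((ell2_norm (T u))\<^sup>2)"
proof -
  define v where "v = T u"
  define w where "w = lincomb 1 u 1 v"
  have v: "v \<in> ell2" and w: "w \<in> ell2" using u by (simp_all add: v_def w_def T_ell2 ell2_lincomb)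
  have Fw: "F w s = F u s + F v s + 2 * (\<integral>t. indicator {..s} t * t \<partial>\<mu> u)" for s
  proof -
    have 1: "ell2_inner (E s u) (E s v) = complex_of_real (\<integral>t. indicator {..s} t * t \<partial>\<mu> u)"
      using partial_first_moment[OF u, of s] u v by (simp add: E_symmetric E_idem v_def)
    then have 2: "ell2_inner (E s v) (E s u) = complex_of_real (\<integral>t. indicator {..s} t * t \<partial>\<mu> u)"
      using inner_commute[of "E s v" "E s u"] u v by simp
    have "E s w = lincomb 1 (E s u) 1 (E s v)" using u v by (simp add: w_def E_lincomb)
    then have "complex_of_real (F w s) = complex_of_real (F u s + F v s + 2 * (\<integral>t. indicator {..s} t * t \<partial>\<mu> u))"
      unfolding F_def using u v
      by (simp add: norm_sq_lincomb 1 2 del: of_real_power) (simp add: norm_sq_inner[symmetric])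
    then show ?thesis by (simp only: of_real_eq_iff)
  qed
  define L where "L = add_measure (\<mu> w) (density (\<mu> u) (\<lambda>t. ennreal (- 2 * t)))"
  define R where "R = add_measure (density (\<mu> u) (\<lambda>t. 1 + ennreal (2 * t))) (\<mu> v)"
  interpret u: finite_measure "\<mu> u" by (rule finite_\<mu>[OF u])
  have fin: "(\<integral>\<^sup>+t. ennreal (c * t) \<partial>\<mu> x) < \<infinity>" if "x \<in> ell2" for c :: real and x
  proof -
    have "integrable (\<mu> x) (\<lambda>t. c * t)" using first_moment(1)[OF that] by simp
    then show ?thesis by (auto simp only: real_integrable_def less_top infinity_ennreal_def)
  qed
  have LR: "L = R"
  proof (rule measure_eqI_Iic)
    fix s
    define P where "P = (\<integral>\<^sup>+t. ennreal (2 * t) * indicator {..s} t \<partial>\<mu> u)"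
    define Q where "Q = (\<integral>\<^sup>+t. ennreal (- 2 * t) * indicator {..s} t \<partial>\<mu> u)"
    have "P \<le> (\<integral>\<^sup>+t. ennreal (2 * t) \<partial>\<mu> u)" "Q \<le> (\<integral>\<^sup>+t. ennreal (- 2 * t) \<partial>\<mu> u)"
      unfolding P_def Q_def by (auto intro!: nn_integral_mono simp: indicator_def)
    then have PQ: "P < \<infinity>" "Q < \<infinity>" using fin[OF u, of 2] fin[OF u, of "-2"] by (auto intro: le_less_trans)
    have "2 * (\<integral>t. indicator {..s} t * t \<partial>\<mu> u) = (\<integral>t. indicator {..s} t * (2 * t) \<partial>\<mu> u)"
      by (subst integral_mult_right_zero[symmetric]) (simp add: ac_simps)
    also have "\<dots> = enn2real (\<integral>\<^sup>+t. ennreal (indicator {..s} t * (2 * t)) \<partial>\<mu> u) - enn2real (\<integral>\<^sup>+t. ennreal (- (indicator {..s} t * (2 * t))) \<partial>\<mu> u)"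
      using integrable_mult_right[OF partial_first_moment_integrable[OF u, of s], of 2]
      by (intro real_lebesgue_integral_def) (simp add: ac_simps)
    also have "(\<integral>\<^sup>+t. ennreal (indicator {..s} t * (2 * t)) \<partial>\<mu> u) = P"
      unfolding P_def by (intro nn_integral_cong) (auto simp: indicator_def)
    also have "(\<integral>\<^sup>+t. ennreal (- (indicator {..s} t * (2 * t))) \<partial>\<mu> u) = Q"
      unfolding Q_def by (intro nn_integral_cong) (auto simp: indicator_def)
    finally have "F w s + enn2real Q = F u s + enn2real P + F v s" using Fw[of s] by simp
    then have "ennreal (F w s) + ennreal (enn2real Q) = ennreal (F u s) + ennreal (enn2real P) + ennreal (F v s)"
      by (simp add: F_def flip: ennreal_plus)
    then have eq: "ennreal (F w s) + Q = ennreal (F u s) + P + ennreal (F v s)" using PQ by simp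
    have "emeasure (density (\<mu> u) (\<lambda>t. 1 + ennreal (2 * t))) {..s} = (\<integral>\<^sup>+t. indicator {..s} t + ennreal (2 * t) * indicator {..s} t \<partial>\<mu> u)"
      by (subst emeasure_density) (auto simp: distrib_right)
    also have "\<dots> = ennreal (F u s) + P" using u by (subst nn_integral_add) (auto simp: P_def emeasure_\<mu>_Iic)
    finally have "emeasure (density (\<mu> u) (\<lambda>t. 1 + ennreal (2 * t))) {..s} = ennreal (F u s) + P" .
    moreover have "emeasure (density (\<mu> u) (\<lambda>t. ennreal (- 2 * t))) {..s} = Q"
      unfolding Q_def by (subst emeasure_density) auto
    ultimately show "emeasure L {..s} = emeasure R {..s}"
      using eq v w by (simp add: L_def R_def emeasure_add_measure emeasure_\<mu>_Iic)
  next
    have "emeasure L UNIV = ennreal ((ell2_norm w)\<^sup>2) + (\<integral>\<^sup>+t. ennreal (- 2 * t) \<partial>\<mu> u)"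
      using w by (simp add: L_def emeasure_add_measure emeasure_\<mu>_UNIV emeasure_density)
    then show "emeasure L UNIV \<noteq> \<infinity>" using fin[OF u, of "-2"] by auto
    have "emeasure R UNIV = (ennreal ((ell2_norm u)\<^sup>2) + (\<integral>\<^sup>+t. ennreal (2 * t) \<partial>\<mu> u)) + ennreal ((ell2_norm v)\<^sup>2)"
      using u v by (simp add: R_def emeasure_add_measure emeasure_\<mu>_UNIV emeasure_density nn_integral_add)
    then show "emeasure R UNIV \<noteq> \<infinity>" using fin[OF u, of 2] by auto
  qed (simp_all add: L_def R_def)
  have L_int: "(\<integral>\<^sup>+t. f t \<partial>L) = (\<integral>\<^sup>+t. f t \<partial>\<mu> w) + (\<integral>\<^sup>+t. ennreal (- 2 * t) * f t \<partial>\<mu> u)"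
    if [measurable]: "f \<in> borel_measurable borel" for f
    unfolding L_def by (subst nn_integral_add_measure) (auto simp: nn_integral_density)
  have R_int: "(\<integral>\<^sup>+t. f t \<partial>R) = (\<integral>\<^sup>+t. f t \<partial>\<mu> u) + (\<integral>\<^sup>+t. ennreal (2 * t) * f t \<partial>\<mu> u) + (\<integral>\<^sup>+t. f t \<partial>\<mu> v)"
    if [measurable]: "f \<in> borel_measurable borel" for f
    unfolding R_def by (subst nn_integral_add_measure) (auto simp: nn_integral_density distrib_right nn_integral_add)
  define p where "p x = (\<integral>\<^sup>+t. ennreal t \<partial>\<mu> x)" for x
  define n where "n x = (\<integral>\<^sup>+t. ennreal (- t) \<partial>\<mu> x)" for x
  have pn: "p x < \<infinity>" "n x < \<infinity>" if "x \<in> ell2" for x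
    using fin[OF that, of 1] fin[OF that, of "-1"] by (simp_all add: p_def n_def)
  have moment: "Re (ell2_inner x (T x)) = enn2real (p x) - enn2real (n x)" if "x \<in> ell2" for x
    using first_moment[OF that] real_lebesgue_integral_def[OF first_moment(1)[OF that]]
    by (metis Re_complex_of_real n_def p_def)
  define Sp where "Sp = (\<integral>\<^sup>+t. ennreal (2 * t) * ennreal t \<partial>\<mu> u)"
  define Sn where "Sn = (\<integral>\<^sup>+t. ennreal (- 2 * t) * ennreal (- t) \<partial>\<mu> u)"
  have "(\<integral>\<^sup>+t. ennreal (- 2 * t) * ennreal t \<partial>\<mu> u) = 0" "(\<integral>\<^sup>+t. ennreal (2 * t) * ennreal (- t) \<partial>\<mu> u) = 0"
  proof -
    have z: "ennreal (- 2 * t) * ennreal t = 0" "ennreal (2 * t) * ennreal (- t) = 0" for t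
      by (cases "t \<ge> 0"; simp add: ennreal_neg)+
    then show "(\<integral>\<^sup>+t. ennreal (- 2 * t) * ennreal t \<partial>\<mu> u) = 0" "(\<integral>\<^sup>+t. ennreal (2 * t) * ennreal (- t) \<partial>\<mu> u) = 0"
      unfolding z by simp_all
  qed
  then have e1: "p w = p u + Sp + p v" and e2: "n w + Sn = n u + n v"
    using L_int[of "\<lambda>t. ennreal t"] R_int[of "\<lambda>t. ennreal t"] L_int[of "\<lambda>t. ennreal (- t)"] R_int[of "\<lambda>t. ennreal (- t)"]
    by (simp_all add: LR p_def n_def Sp_def Sn_def)
  have Sfin: "Sp < \<infinity>" "Sn < \<infinity>"
  proof -
    have "Sp \<le> p w" unfolding e1 by (metis add.assoc add.commute le_iff_add)
    then show "Sp < \<infinity>" using pn(1)[OF w] by (rule le_less_trans)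
    have "Sn \<le> n u + n v" unfolding e2[symmetric] by (metis add.commute le_iff_add)
    also have "\<dots> < \<infinity>" using pn(2)[OF u] pn(2)[OF v] by (simp add: ennreal_add_less_top)
    finally show "Sn < \<infinity>" .
  qed
  have r1: "enn2real (p w) = enn2real (p u) + enn2real Sp + enn2real (p v)"
    unfolding e1 using pn[OF u] pn[OF v] Sfin by (simp add: enn2real_plus ennreal_add_less_top)
  have "enn2real (n w) + enn2real Sn = enn2real (n u) + enn2real (n v)"
    using arg_cong[OF e2, of enn2real] pn[OF u] pn[OF v] pn[OF w] Sfin by (simp add: enn2real_plus)
  moreover have "Re (ell2_inner w (T w)) = Re (ell2_inner u (T u)) + Re (ell2_inner v (T v)) + 2 * (ell2_norm v)\<^sup>2"
  proof -
    have "ell2_inner u (T v) = ell2_inner v v" using T_symmetric[OF u v] by (simp add: v_def)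
    moreover have "ell2_inner v (T u) = ell2_inner v v" by (simp add: v_def)
    ultimately have "ell2_inner w (T w) = ell2_inner u (T u) + ell2_inner v (T v) + 2 * ell2_inner v v"
      unfolding w_def using u v by (simp add: T_lincomb T_ell2 ell2_lincomb inner_lincomb_left inner_lincomb_right)
    then show ?thesis using norm_sq_Re[OF v] by simp
  qed
  ultimately have S: "enn2real Sp + enn2real Sn = 2 * (ell2_norm v)\<^sup>2"
    using r1 moment[OF u] moment[OF v] moment[OF w] by simp
  have "2 * (\<integral>\<^sup>+t. ennreal (t\<^sup>2) \<partial>\<mu> u) = (\<integral>\<^sup>+t. 2 * ennreal (t\<^sup>2) \<partial>\<mu> u)" by (simp add: nn_integral_cmult)
  also have "\<dots> = (\<integral>\<^sup>+t. ennreal (2 * t) * ennreal t + ennreal (- 2 * t) * ennreal (- t) \<partial>\<mu> u)"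
  proof (rule nn_integral_cong)
    fix t :: real
    have dbl: "2 * ennreal (t\<^sup>2) = ennreal (2 * t * t)"
    proof -
      have "ennreal (2 * t\<^sup>2) = ennreal 2 * ennreal (t\<^sup>2)" by (rule ennreal_mult) simp_all
      then show ?thesis by (simp only: ennreal_numeral power2_eq_square mult.assoc)
    qed
    show "2 * ennreal (t\<^sup>2) = ennreal (2 * t) * ennreal t + ennreal (- 2 * t) * ennreal (- t)"
    proof (cases "0 \<le> t")
      case True
      have "ennreal (2 * t) * ennreal t = ennreal (2 * t * t)" by (rule ennreal_mult[symmetric]) (use True in simp_all)
      moreover have "ennreal (- 2 * t) = 0" by (rule ennreal_neg) (use True in simp)
      ultimately show ?thesis using dbl by (simp only: mult_zero_left add_0_right)
    next
      case False
      have "ennreal (- 2 * t) * ennreal (- t) = ennreal (- 2 * t * - t)" by (rule ennreal_mult[symmetric]) (use False in simp_all)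
      moreover have "ennreal t = 0" by (rule ennreal_neg) (use False in simp)
      moreover have "- 2 * t * - t = 2 * t * t" by simp
      ultimately show ?thesis using dbl by (simp only: mult_zero_right add_0_left)
    qed
  qed
  also have "\<dots> = Sp + Sn" unfolding Sp_def Sn_def by (rule nn_integral_add) auto
  also have "\<dots> = ennreal (enn2real Sp + enn2real Sn)" using Sfin by (simp add: ennreal_plus)
  also have "\<dots> = 2 * ennreal ((ell2_norm v)\<^sup>2)" unfolding S by (simp add: ennreal_mult)
  finally show ?thesis by (simp add: v_def ennreal_mult_cancel_left)
qed

text \<open>
\<open>E(s)\<close> commutes with \<open>T\<close>, so the moments of order 0, 1, 2 over \<open>(-\<infinity>, s]\<close> are \<open>F u s\<close>, \<open>\<langle>E(s)u, Tu\<rangle>\<close> and \<open>F (T u) s\<close>,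
the coefficients in the expansion of \<open>\<parallel>E(s)(T - l)u\<parallel>\<^sup>2\<close>.
\<close>

lemma \<mu>_shift:
  assumes u: "u \<in> ell2"
  shows "\<mu> (lincomb 1 (T u) (- of_real l) u) = density (\<mu> u) (\<lambda>t. ennreal ((t - l)\<^sup>2))"
proof (rule measure_eqI_Iic)
  let ?y = "lincomb 1 (T u) (- of_real l) u"
  have y: "?y \<in> ell2" using u by (simp add: T_ell2 ell2_lincomb)
  interpret u: finite_measure "\<mu> u" by (rule finite_\<mu>[OF u])
  have int1: "integrable (\<mu> u) (\<lambda>t. t)" by (rule first_moment(1)[OF u])
  have int2: "integrable (\<mu> u) (\<lambda>t. t\<^sup>2)"
    using second_moment[OF u] by (intro integrableI_nonneg) auto
  have intl: "integrable (\<mu> u) (\<lambda>t. (t - l)\<^sup>2)"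
  proof -
    have "integrable (\<mu> u) (\<lambda>t. t\<^sup>2 - 2 * l * t + l\<^sup>2)" using int1 int2 by simp
    then show ?thesis by (simp add: power2_diff algebra_simps)
  qed
  note ind = integrable_mult_indicator[where 'b = real, simplified, rotated]
  show "emeasure (\<mu> ?y) {..s} = emeasure (density (\<mu> u) (\<lambda>t. ennreal ((t - l)\<^sup>2))) {..s}" for s
  proof -
    have i1: "integrable (\<mu> u) (\<lambda>t. indicator {..s} t * t)" by (rule partial_first_moment_integrable[OF u])
    have i2: "integrable (\<mu> u) (\<lambda>t. indicator {..s} t * t\<^sup>2)" by (rule ind[OF int2]) auto
    have i0: "integrable (\<mu> u) (\<lambda>t. indicator {..s} t * (1::real))" by (rule ind) auto
    have il: "integrable (\<mu> u) (\<lambda>t. indicator {..s} t * (t - l)\<^sup>2)" by (rule ind[OF intl]) auto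
    have "ennreal (\<integral>t. indicator {..s} t * t\<^sup>2 \<partial>\<mu> u) = (\<integral>\<^sup>+t. ennreal (indicator {..s} t * t\<^sup>2) \<partial>\<mu> u)"
      by (rule nn_integral_eq_integral[OF i2, symmetric]) auto
    also have "\<dots> = (\<integral>\<^sup>+t. ennreal (t\<^sup>2) \<partial>\<mu> (E s u))"
      unfolding \<mu>_E[OF u] by (subst nn_integral_density) (auto intro!: nn_integral_cong simp: indicator_def)
    also have "\<dots> = ennreal ((ell2_norm (T (E s u)))\<^sup>2)" using u by (intro second_moment) simp
    also have "\<dots> = ennreal (F (T u) s)" using u by (simp add: F_def E_T_commute)
    finally have m2: "F (T u) s = (\<integral>t. indicator {..s} t * t\<^sup>2 \<partial>\<mu> u)"
      by (subst (asm) ennreal_inj) (auto simp: F_def intro!: integral_nonneg_AE)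
    have m0: "F u s = (\<integral>t. indicator {..s} t * 1 \<partial>\<mu> u)"
      using emeasure_\<mu>_Iic[OF u, of s] by (simp add: measure_def F_def)
    have c1: "ell2_inner (E s u) (E s (T u)) = complex_of_real (\<integral>t. indicator {..s} t * t \<partial>\<mu> u)"
      using partial_first_moment[OF u, of s] u by (simp add: E_symmetric E_idem T_ell2)
    then have c2: "ell2_inner (E s (T u)) (E s u) = complex_of_real (\<integral>t. indicator {..s} t * t \<partial>\<mu> u)"
      using inner_commute[of "E s (T u)" "E s u"] u by (simp add: T_ell2)
    have "E s ?y = lincomb 1 (E s (T u)) (- of_real l) (E s u)" using u by (simp add: E_lincomb T_ell2)
    then have "complex_of_real (F ?y s) = complex_of_real (F (T u) s - 2 * l * (\<integral>t. indicator {..s} t * t \<partial>\<mu> u) + l\<^sup>2 * F u s)"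
      unfolding F_def using u
      by (simp add: norm_sq_lincomb T_ell2 c1 c2 del: of_real_power)
         (simp add: norm_sq_inner[symmetric] T_ell2 algebra_simps power2_eq_square)
    then have "F ?y s = F (T u) s - 2 * l * (\<integral>t. indicator {..s} t * t \<partial>\<mu> u) + l\<^sup>2 * F u s" by (simp only: of_real_eq_iff)
    also have "\<dots> = (\<integral>t. indicator {..s} t * t\<^sup>2 - 2 * l * (indicator {..s} t * t) + l\<^sup>2 * (indicator {..s} t * 1) \<partial>\<mu> u)"
      unfolding m2 m0 using i0 i1 i2 by simp
    also have "\<dots> = (\<integral>t. indicator {..s} t * (t - l)\<^sup>2 \<partial>\<mu> u)"
      by (intro Bochner_Integration.integral_cong) (auto simp: power2_diff algebra_simps)
    finally have "ennreal (F ?y s) = (\<integral>\<^sup>+t. ennreal (indicator {..s} t * (t - l)\<^sup>2) \<partial>\<mu> u)"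
      using nn_integral_eq_integral[OF il] by simp
    also have "\<dots> = emeasure (density (\<mu> u) (\<lambda>t. ennreal ((t - l)\<^sup>2))) {..s}"
      by (subst emeasure_density) (auto intro!: nn_integral_cong simp: indicator_def)
    finally show ?thesis using y by (simp add: emeasure_\<mu>_Iic)
  qed
  show "emeasure (\<mu> ?y) UNIV \<noteq> \<infinity>" using y by (simp add: emeasure_\<mu>_UNIV)
  have "emeasure (density (\<mu> u) (\<lambda>t. ennreal ((t - l)\<^sup>2))) UNIV = (\<integral>\<^sup>+t. ennreal ((t - l)\<^sup>2) \<partial>\<mu> u)"
    by (subst emeasure_density) auto
  then show "emeasure (density (\<mu> u) (\<lambda>t. ennreal ((t - l)\<^sup>2))) UNIV \<noteq> \<infinity>"
    using nn_integral_eq_integral[OF intl] by simp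
qed auto

fun shifted :: "(nat \<Rightarrow> real) \<Rightarrow> (nat \<Rightarrow> complex) \<Rightarrow> nat \<Rightarrow> nat \<Rightarrow> complex" where
  "shifted x u 0 = u"
| "shifted x u (Suc k) = lincomb 1 (T (shifted x u k)) (- of_real (x k)) (shifted x u k)"

lemma shifted_ell2: "u \<in> ell2 \<Longrightarrow> shifted x u k \<in> ell2"
  by (induction k) (auto simp: ell2_lincomb T_ell2)

lemma \<mu>_shifted:
  "u \<in> ell2 \<Longrightarrow> \<mu> (shifted x u k) = density (\<mu> u) (\<lambda>t. ennreal ((\<Prod>i<k. t - x i)\<^sup>2))"
proof (induction k)
  case 0
  then show ?case by (simp add: density_1)
next
  case (Suc k)
  have "\<mu> (shifted x u (Suc k)) = density (density (\<mu> u) (\<lambda>t. ennreal ((\<Prod>i<k. t - x i)\<^sup>2))) (\<lambda>t. ennreal ((t - x k)\<^sup>2))"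
    using \<mu>_shift[OF shifted_ell2[OF Suc.prems], of x k "x k"] Suc by simp
  also have "\<dots> = density (\<mu> u) (\<lambda>t. ennreal ((\<Prod>i<k. t - x i)\<^sup>2) * ennreal ((t - x k)\<^sup>2))"
    by (rule density_density_eq) auto
  also have "(\<lambda>t. ennreal ((\<Prod>i<k. t - x i)\<^sup>2) * ennreal ((t - x k)\<^sup>2)) = (\<lambda>t. ennreal ((\<Prod>i<Suc k. t - x i)\<^sup>2))"
    by (simp add: power_mult_distrib ennreal_mult)
  finally show ?case .
qed

lemma integral_shifted:
  assumes "u \<in> ell2"
  shows "(\<integral>\<^sup>+t. ennreal ((\<Prod>i<k. t - x i)\<^sup>2) \<partial>\<mu> u) = ennreal ((ell2_norm (shifted x u k))\<^sup>2)"
  using emeasure_\<mu>_UNIV[OF shifted_ell2[OF assms], of x k] by (simp add: \<mu>_shifted[OF assms] emeasure_density)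

end

section \<open>Polynomial solutions of the Jacobi recurrence\<close>

definition jacobi_recurrence :: "(nat \<Rightarrow> real) \<Rightarrow> (nat \<Rightarrow> real) \<Rightarrow> complex \<Rightarrow> (nat \<Rightarrow> complex) \<Rightarrow> bool" where
  "jacobi_recurrence a b z f \<longleftrightarrow> (\<forall>n\<ge>1. of_real (a n) * f (n + 1) + of_real (a (n - 1)) * f (n - 1) + of_real (b n) * f n = z * f n)"

lemma jacobi_recurrenceD:
  "jacobi_recurrence a b z f \<Longrightarrow> of_real (a (Suc n)) * f (Suc (Suc n)) = (z - of_real (b (Suc n))) * f (Suc n) - of_real (a n) * f n"
  unfolding jacobi_recurrence_def by (drule spec[of _ "Suc n"]) (simp add: algebra_simps)

locale bounded_jacobi =
  fixes a b :: "nat \<Rightarrow> real" and M :: real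
  assumes M_pos: "M > 0" and a_zero: "a 0 = 1"
    and a_bounds: "\<And>n. n \<ge> 1 \<Longrightarrow> 1 / (M + 1) \<le> a n \<and> a n \<le> M + 1"
    and b_bounds: "\<And>n. n \<ge> 1 \<Longrightarrow> \<bar>b n\<bar> \<le> M"
begin

lemma a_pos: "0 < a n"
proof (cases n)
  case 0
  then show ?thesis by (simp add: a_zero)
next
  case (Suc m)
  have "0 < 1 / (M + 1)" using M_pos by simp
  also have "\<dots> \<le> a n" using a_bounds[of n] Suc by simp
  finally show ?thesis .
qed

lemma a_le: "a n \<le> M + 1"
  using a_bounds[of n] M_pos by (cases n) (auto simp: a_zero)

lemma a_ne [simp]: "complex_of_real (a n) \<noteq> 0" "a n \<noteq> 0"
  using a_pos[of n] by auto

lemma recurrence_solution: "jacobi_recurrence a b z (jacobi_solution a b z c0 c1)"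
  using jacobi_solution_unique[of a "jacobi_solution a b z c0 c1" b z c0 c1] a_ne by (simp add: jacobi_recurrence_def)

text \<open>
The imaginary part of the recurrence multiplied by \<open>cnj (f n)\<close>, summed over \<open>n\<close>.
\<close>

lemma green_identity:
  assumes "jacobi_recurrence a b z f"
  shows "a N * Im (f (Suc N) * cnj (f N)) = a 0 * Im (f 1 * cnj (f 0)) + Im z * (\<Sum>n=1..N. (cmod (f n))\<^sup>2)"
proof (induction N)
  case (Suc N)
  have "a (Suc N) * Im (f (Suc (Suc N)) * cnj (f (Suc N))) = Im ((of_real (a (Suc N)) * f (Suc (Suc N))) * cnj (f (Suc N)))"
    by (simp add: algebra_simps)
  also have "\<dots> = Im z * (cmod (f (Suc N)))\<^sup>2 + a N * Im (f (Suc N) * cnj (f N))"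
    unfolding jacobi_recurrenceD[OF assms] by (simp only: cmod_power2) (simp add: algebra_simps power2_eq_square)
  also have "a N * Im (f (Suc N) * cnj (f N)) = a 0 * Im (f 1 * cnj (f 0)) + Im z * (\<Sum>n=1..N. (cmod (f n))\<^sup>2)"
    by (rule Suc.IH)
  finally show ?case by (simp add: ring_distribs del: times_complex.simps)
qed simp

lemma wronskian_constant:
  assumes "jacobi_recurrence a b z f" "jacobi_recurrence a b z g"
  shows "of_real (a N) * (f (Suc N) * g N - f N * g (Suc N)) = of_real (a 0) * (f 1 * g 0 - f 0 * g 1)"
proof (induction N)
  case (Suc N)
  have "of_real (a (Suc N)) * (f (Suc (Suc N)) * g (Suc N) - f (Suc N) * g (Suc (Suc N)))
      = (of_real (a (Suc N)) * f (Suc (Suc N))) * g (Suc N) - f (Suc N) * (of_real (a (Suc N)) * g (Suc (Suc N)))"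
    by (simp add: algebra_simps)
  also have "\<dots> = of_real (a N) * (f (Suc N) * g N - f N * g (Suc N))"
    unfolding jacobi_recurrenceD[OF assms(1)] jacobi_recurrenceD[OF assms(2)] by (simp add: algebra_simps)
  finally show ?case by (simp add: Suc.IH)
qed simp

abbreviation fm :: "nat \<Rightarrow> complex \<Rightarrow> complex" where "fm \<equiv> f_minus a b"

lemma fm_0 [simp]: "fm 0 z = 0" and fm_1 [simp]: "fm (Suc 0) z = 1"
  by (simp_all add: f_minus_def)

lemma fm_recurrence: "jacobi_recurrence a b z (\<lambda>n. fm n z)"
  unfolding f_minus_def by (rule recurrence_solution)

lemma fm_green: "a N * Im (fm (Suc N) z * cnj (fm N z)) = Im z * (\<Sum>n=1..N. (cmod (fm n z))\<^sup>2)"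
  using green_identity[OF fm_recurrence] by simp

lemma Im_mult_cnj_le: "Im (w * cnj v) \<le> cmod w * cmod v"
  using abs_Im_le_cmod[of "w * cnj v"] by (simp add: norm_mult)

lemma fm_norm_product_ge:
  assumes z: "0 < Im z"
  shows "Im z * (\<Sum>n=1..N. (cmod (fm n z))\<^sup>2) \<le> (M + 1) * (cmod (fm (Suc N) z) * cmod (fm N z))"
proof -
  have "Im z * (\<Sum>n=1..N. (cmod (fm n z))\<^sup>2) \<le> a N * (cmod (fm (Suc N) z) * cmod (fm N z))"
    unfolding fm_green[symmetric] using a_pos[of N] Im_mult_cnj_le by (intro mult_left_mono) auto
  also have "\<dots> \<le> (M + 1) * (cmod (fm (Suc N) z) * cmod (fm N z))"
    using a_le by (intro mult_right_mono) auto
  finally show ?thesis .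
qed

text \<open>
Keep only the last term of the sum in \<open>fm_norm_product_ge\<close>.
\<close>

lemma fm_ratio:
  assumes z: "0 < Im z"
  shows "Im z * cmod (fm N z) \<le> (M + 1) * cmod (fm (Suc N) z)"
proof (cases "fm N z = 0")
  case False
  then have "1 \<le> N" by (cases N) auto
  then have "(cmod (fm N z))\<^sup>2 \<le> (\<Sum>n=1..N. (cmod (fm n z))\<^sup>2)" by (intro member_le_sum) auto
  then have "Im z * (cmod (fm N z))\<^sup>2 \<le> (M + 1) * (cmod (fm (Suc N) z) * cmod (fm N z))"
    using fm_norm_product_ge[OF z, of N] z by (meson mult_left_mono less_imp_le order_trans)
  then have "(Im z * cmod (fm N z)) * cmod (fm N z) \<le> ((M + 1) * cmod (fm (Suc N) z)) * cmod (fm N z)"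
    by (simp add: power2_eq_square algebra_simps)
  then show ?thesis by (rule mult_right_le_imp_le) (use False in simp)
qed (use M_pos in simp)

lemma fm_nonzero:
  assumes z: "0 < Im z" and N: "1 \<le> N"
  shows "fm N z \<noteq> 0"
proof -
  have "1 \<le> (\<Sum>n=1..N. (cmod (fm n z))\<^sup>2)"
    using member_le_sum[of 1 "{1..N}" "\<lambda>n. (cmod (fm n z))\<^sup>2"] N by auto
  then have "0 < Im z * (\<Sum>n=1..N. (cmod (fm n z))\<^sup>2)" using z by (simp add: zero_less_mult_iff)
  then show ?thesis using fm_norm_product_ge[OF z, of N] by auto
qed

lemma fm_ratio_Im:
  assumes z: "0 < Im z" and N: "1 \<le> N"
  shows "Im z \<le> a N * Im (fm (Suc N) z / fm N z)"
proof -
  have n0: "fm N z \<noteq> 0" using fm_nonzero[OF assms] .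
  have "(cmod (fm N z))\<^sup>2 \<le> (\<Sum>n=1..N. (cmod (fm n z))\<^sup>2)" using N by (intro member_le_sum) auto
  then have "Im z * (cmod (fm N z))\<^sup>2 \<le> a N * Im (fm (Suc N) z * cnj (fm N z))"
    unfolding fm_green using z by (intro mult_left_mono) auto
  then have "Im z \<le> a N * Im (fm (Suc N) z * cnj (fm N z)) / (cmod (fm N z))\<^sup>2"
    using n0 by (subst pos_le_divide_eq) (simp_all del: times_complex.simps)
  moreover have "Im (fm (Suc N) z / fm N z) = Im (fm (Suc N) z * cnj (fm N z)) / (cmod (fm N z))\<^sup>2"
    by (subst complex_div_cnj) (simp add: Im_divide_of_real flip: of_real_power)
  ultimately show ?thesis by (simp only: times_divide_eq_right)
qed

text \<open>
Keep the first term in \<open>fm_norm_product_ge\<close>, and eliminate \<open>fm N z\<close> by \<open>fm_ratio\<close>.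
\<close>

lemma fm_growth:
  assumes z: "0 < Im z"
  shows "min 1 ((Im z / (M + 1))\<^sup>2) \<le> (cmod (fm (Suc N) z))\<^sup>2"
proof (cases "N = 0")
  case False
  have "1 \<le> (\<Sum>n=1..N. (cmod (fm n z))\<^sup>2)"
    using member_le_sum[of 1 "{1..N}" "\<lambda>n. (cmod (fm n z))\<^sup>2"] False by auto
  then have 1: "Im z \<le> (M + 1) * (cmod (fm (Suc N) z) * cmod (fm N z))"
    using fm_norm_product_ge[OF z, of N] z by (smt (verit, best) mult_le_cancel_left1)
  have "(Im z / (M + 1))\<^sup>2 \<le> Im z / (M + 1) * (cmod (fm (Suc N) z) * cmod (fm N z))"
    using 1 z M_pos unfolding power2_eq_square by (intro mult_left_mono) (auto simp: field_simps)
  also have "\<dots> = (Im z * cmod (fm N z)) / (M + 1) * cmod (fm (Suc N) z)" by simp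
  also have "\<dots> \<le> cmod (fm (Suc N) z) * cmod (fm (Suc N) z)"
    using fm_ratio[OF z, of N] M_pos by (intro mult_right_mono) (auto simp: field_simps)
  finally show ?thesis by (simp add: power2_eq_square)
qed simp

lemma fm_cnj: "fm n (cnj z) = cnj (fm n z)"
  by (induction n rule: induct_nat_012) (simp_all add: f_minus_def)

fun fm_poly :: "nat \<Rightarrow> complex poly" where
  "fm_poly 0 = 0"
| "fm_poly (Suc 0) = 1"
| "fm_poly (Suc (Suc n)) = Polynomial.smult (1 / of_real (a (Suc n))) ([:- of_real (b (Suc n)), 1:] * fm_poly (Suc n) - Polynomial.smult (of_real (a n)) (fm_poly n))"

lemma poly_fm_poly: "poly (fm_poly n) z = fm n z"
  by (induction n rule: fm_poly.induct) (simp_all add: f_minus_def field_simps)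

lemma fm_poly_degree: "degree (fm_poly (Suc n)) = n \<and> fm_poly (Suc n) \<noteq> 0 \<and> (\<exists>r>0. lead_coeff (fm_poly (Suc n)) = complex_of_real r)"
proof (induction n rule: less_induct)
  case (less n)
  show ?case
  proof (cases n)
    case 0
    then show ?thesis by (auto intro: exI[of _ 1])
  next
    case (Suc m)
    have IH: "degree (fm_poly (Suc m)) = m" "fm_poly (Suc m) \<noteq> 0" using less.IH[of m] Suc by auto
    obtain r where r: "r > 0" "lead_coeff (fm_poly (Suc m)) = complex_of_real r" using less.IH[of m] Suc by auto
    let ?p = "[:- of_real (b (Suc m)), 1:] * fm_poly (Suc m)" and ?q = "Polynomial.smult (of_real (a m)) (fm_poly m)"
    have dp: "degree ?p = Suc m" using IH by (subst degree_mult_eq) auto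
    have dq: "degree ?q < Suc m"
    proof (cases m)
      case (Suc k)
      then show ?thesis using less.IH[of k] \<open>n = Suc m\<close> by simp
    qed simp
    have d: "degree (?p - ?q) = Suc m" using dp dq by (simp only: diff_conv_add_uminus degree_add_eq_left degree_minus)
    have "lead_coeff (?p - ?q) = lead_coeff ?p" using d dp dq by (simp add: coeff_eq_0)
    also have "\<dots> = of_real r" using r by (simp add: lead_coeff_mult del: mult_pCons_left)
    finally have l: "lead_coeff (?p - ?q) = of_real r" .
    have "fm_poly (Suc n) = Polynomial.smult (1 / of_real (a (Suc m))) (?p - ?q)" using Suc by simp
    moreover have "degree (Polynomial.smult (1 / of_real (a (Suc m))) (?p - ?q)) = Suc m" using d by simp
    moreover have "lead_coeff (Polynomial.smult (1 / of_real (a (Suc m))) (?p - ?q)) = of_real (r / a (Suc m))" by (simp only: lead_coeff_smult l) simp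
    moreover have "r / a (Suc m) > 0" using r a_pos by simp
    ultimately show ?thesis using Suc by (metis leading_coeff_0_iff of_real_eq_0_iff order_less_irrefl)
  qed
qed

text \<open>
A nonreal zero is impossible, because it or its conjugate would lie in the upper half plane.
\<close>

lemma fm_factorization:
  obtains c x where "0 < c" "fm_poly (Suc N) = Polynomial.smult (complex_of_real c) (\<Prod>i<N. [:- complex_of_real (x i), 1:])"
proof -
  obtain as where as: "Polynomial.smult (lead_coeff (fm_poly (Suc N))) (\<Prod>a\<leftarrow>as. [:- a, 1:]) = fm_poly (Suc N)" "length as = N"
    using fundamental_theorem_algebra_factorized[of "fm_poly (Suc N)"] fm_poly_degree[of N] by auto
  obtain c where c: "0 < c" "lead_coeff (fm_poly (Suc N)) = complex_of_real c" using fm_poly_degree[of N] by auto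
  have real: "Im r = 0" if "r \<in> set as" for r
  proof (rule ccontr)
    assume "Im r \<noteq> 0"
    have "poly (\<Prod>a\<leftarrow>as. [:- a, 1:]) r = 0" using that by (auto simp: poly_prod_list prod_list_zero_iff)
    then have "poly (fm_poly (Suc N)) r = 0" by (subst as(1)[symmetric]) simp
    then have "fm (Suc N) r = 0" by (simp add: poly_fm_poly)
    moreover from this have "fm (Suc N) (cnj r) = 0" by (simp add: fm_cnj)
    ultimately show False using fm_nonzero[of r "Suc N"] fm_nonzero[of "cnj r" "Suc N"] \<open>Im r \<noteq> 0\<close> by (cases "Im r > 0") auto
  qed
  have "(\<Prod>a\<leftarrow>as. [:- a, 1:]) = (\<Prod>i<N. [:- complex_of_real (Re (as ! i)), 1:])"
  proof -
    have "(\<Prod>a\<leftarrow>as. [:- a, 1:]) = (\<Prod>i<N. [:- (as ! i), 1:])"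
      using as(2) by (simp add: prod.list_conv_set_nth atLeast0LessThan)
    also have "\<dots> = (\<Prod>i<N. [:- complex_of_real (Re (as ! i)), 1:])"
      using as(2) real by (intro prod.cong) (auto simp: complex_eq_iff)
    finally show ?thesis .
  qed
  then show ?thesis using that[of c "\<lambda>i. Re (as ! i)"] c as by simp
qed

section \<open>The Weyl solution and the Green function\<close>

lemma solution_affine:
  "jacobi_solution a b z 1 (- m) n = jacobi_solution a b z 1 0 n - m * fm n z"
proof (induction n rule: induct_nat_012)
  case (ge2 n)
  show ?case by (simp add: f_minus_def ge2[unfolded f_minus_def]) (simp add: field_simps)
qed (simp_all add: f_minus_def)

text \<open>
The nested disks of Weyl, reduced to a compactness argument for numbers: choose \<open>m\<^sub>N\<close> so that the solution with initial values \<open>1, -m\<^sub>N\<close>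
vanishes at \<open>N+1\<close>. Green's identity then reads \<open>Im z \<Sum> \<bar>f(n)\<bar>\<^sup>2 = Im m\<^sub>N\<close>; its first term bounds \<open>\<bar>m\<^sub>N\<bar>\<close> by \<open>1 / Im z\<close>,
and any limit point of the \<open>m\<^sub>N\<close> works.
\<close>

lemma weyl_solution_exists:
  assumes z: "0 < Im z"
  obtains m where "\<And>L. Im z * (\<Sum>n=1..L. (cmod (jacobi_solution a b z 1 (- m) n))\<^sup>2) \<le> Im m"
proof -
  define s where "s m n = jacobi_solution a b z 1 (- m) n" for m n
  have s_affine: "s m n = s 0 n - m * fm n z" for m n
    using solution_affine[of z m n] by (simp add: s_def)
  have s01: "s m 0 = 1" "s m (Suc 0) = - m" for m by (simp_all add: s_def)
  define mN where "mN k = s 0 (Suc (Suc k)) / fm (Suc (Suc k)) z" for k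
  have zero: "s (mN k) (Suc (Suc k)) = 0" for k
    using fm_nonzero[OF z, of "Suc (Suc k)"] by (subst s_affine) (simp add: mN_def)
  have eq: "Im z * (\<Sum>n=1..Suc k. (cmod (s (mN k) n))\<^sup>2) = Im (mN k)" for k
  proof -
    have "a (Suc k) * Im (s (mN k) (Suc (Suc k)) * cnj (s (mN k) (Suc k)))
        = a 0 * Im (s (mN k) 1 * cnj (s (mN k) 0)) + Im z * (\<Sum>n=1..Suc k. (cmod (s (mN k) n))\<^sup>2)"
      unfolding s_def by (rule green_identity[OF recurrence_solution])
    then show ?thesis unfolding zero by (simp add: s01 a_zero)
  qed
  have le: "Im z * (\<Sum>n=1..L. (cmod (s (mN k) n))\<^sup>2) \<le> Im (mN k)" if "L \<le> Suc k" for L k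
    unfolding eq[symmetric] using z that by (intro mult_left_mono sum_mono2) auto
  have "cmod (mN k) \<le> 1 / Im z" for k
  proof -
    have "Im z * (cmod (mN k) * cmod (mN k)) \<le> cmod (mN k)"
      using le[of 1 k] abs_Im_le_cmod[of "mN k"] by (simp add: s01 power2_eq_square)
    then show ?thesis using z by (cases "mN k = 0") (auto simp: field_simps)
  qed
  then have "\<forall>k. mN k \<in> cball 0 (1 / Im z)" by simp
  then obtain m r where r: "strict_mono r" "(mN \<circ> r) \<longlonglongrightarrow> m"
    using compact_cball[of "0::complex" "1 / Im z", unfolded compact_def] by blast
  have "Im z * (\<Sum>n=1..L. (cmod (s m n))\<^sup>2) \<le> Im m" for L
  proof (rule LIMSEQ_le)
    show "(\<lambda>k. Im z * (\<Sum>n=1..L. (cmod (s 0 n - (mN \<circ> r) k * fm n z))\<^sup>2)) \<longlonglongrightarrow> Im z * (\<Sum>n=1..L. (cmod (s m n))\<^sup>2)"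
      unfolding s_affine[of m] by (intro tendsto_intros r)
    show "(\<lambda>k. Im ((mN \<circ> r) k)) \<longlonglongrightarrow> Im m" by (intro tendsto_intros r)
    show "\<exists>K. \<forall>k\<ge>K. Im z * (\<Sum>n=1..L. (cmod (s 0 n - (mN \<circ> r) k * fm n z))\<^sup>2) \<le> Im ((mN \<circ> r) k)"
    proof (intro exI[of _ L] allI impI)
      fix k assume "L \<le> k"
      then have "L \<le> Suc (r k)" using seq_suble[OF r(1), of k] by simp
      then show "Im z * (\<Sum>n=1..L. (cmod (s 0 n - (mN \<circ> r) k * fm n z))\<^sup>2) \<le> Im ((mN \<circ> r) k)"
        using le[of L "r k"] by (simp add: s_affine[symmetric])
    qed
  qed
  then show ?thesis using that unfolding s_def by blast
qed

text \<open>
In Green's identity for the difference of two preimages, the boundary term tends to 0.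
\<close>

lemma jacobi_minus_z_inj:
  assumes z: "0 < Im z"
  shows "inj_on (\<lambda>u n. jacobi a b u n - z * u n) ell2"
proof (rule inj_onI, rule ext)
  fix u v k assume u: "u \<in> ell2" and v: "v \<in> ell2"
    and eq: "(\<lambda>n. jacobi a b u n - z * u n) = (\<lambda>n. jacobi a b v n - z * v n)"
  define d where "d n = u n - v n" for n
  have d0: "d 0 = 0" using u v by (simp add: d_def ell2_def)
  have rec: "jacobi_recurrence a b z d"
    unfolding jacobi_recurrence_def
  proof (intro allI impI)
    fix n :: nat assume n: "1 \<le> n"
    have "jacobi a b u n - z * u n = jacobi a b v n - z * v n" using eq by metis
    then show "of_real (a n) * d (n + 1) + of_real (a (n - 1)) * d (n - 1) + of_real (b n) * d n = z * d n"
      using n d0 by (cases "n = 1") (simp_all add: jacobi_def d_def algebra_simps)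
  qed
  have dlim: "d \<longlonglongrightarrow> 0" unfolding d_def using tendsto_diff[OF ell2_tendsto_0[OF u] ell2_tendsto_0[OF v]] by simp
  show "u k = v k"
  proof (cases "k = 0")
    case False
    have "Im z * (cmod (d k))\<^sup>2 \<le> 0"
    proof (rule LIMSEQ_le[OF tendsto_const])
      have "(\<lambda>N. (M + 1) * (cmod (d (Suc N)) * cmod (d N))) \<longlonglongrightarrow> (M + 1) * (cmod 0 * cmod 0)"
        by (intro tendsto_intros dlim LIMSEQ_Suc)
      then show "(\<lambda>N. (M + 1) * (cmod (d (Suc N)) * cmod (d N))) \<longlonglongrightarrow> 0" by simp
      show "\<exists>N0. \<forall>N\<ge>N0. Im z * (cmod (d k))\<^sup>2 \<le> (M + 1) * (cmod (d (Suc N)) * cmod (d N))"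
      proof (intro exI[of _ k] allI impI)
        fix N assume "k \<le> N"
        then have "Im z * (cmod (d k))\<^sup>2 \<le> Im z * (\<Sum>n=1..N. (cmod (d n))\<^sup>2)"
          using z False by (intro mult_left_mono member_le_sum) auto
        also have "\<dots> = a N * Im (d (Suc N) * cnj (d N))" using green_identity[OF rec, of N] d0 by simp
        also have "\<dots> \<le> (M + 1) * (cmod (d (Suc N)) * cmod (d N))"
          using a_le[of N] a_pos[of N] Im_mult_cnj_le[of "d (Suc N)" "d N"] M_pos
          by (meson less_imp_le mult_left_mono mult_right_mono norm_ge_zero order_trans zero_le_mult_iff)
        finally show "Im z * (cmod (d k))\<^sup>2 \<le> (M + 1) * (cmod (d (Suc N)) * cmod (d N))" .
      qed
    qed
    then have "d k = 0" using z by (simp add: mult_le_0_iff)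
    then show ?thesis by (simp add: d_def)
  qed (use u v in \<open>simp add: ell2_def\<close>)
qed

lemma resolvent_eqI:
  assumes "0 < Im z" "u \<in> ell2" "\<And>n. jacobi a b u n - z * u n = v n"
  shows "resolvent (jacobi a b) z v = u"
  unfolding resolvent_def by (rule the_inv_into_f_eq[OF jacobi_minus_z_inj]) (use assms in auto)

abbreviation fp :: "nat \<Rightarrow> complex \<Rightarrow> complex" where "fp \<equiv> f_plus a b"

text \<open>
The negative of the square summable Weyl solution, set to 0 at 0, solves \<open>(J - z)u = \<delta>\<^sub>1\<close>: its value 1 at 0 enters the
equation at \<open>n = 1\<close> with the weight \<open>a(0) = 1\<close>. So it is the resolvent applied to \<open>\<delta>\<^sub>1\<close>, and \<open>m = \<langle>\<delta>\<^sub>1, (J-z)\<^sup>-\<^sup>1\<delta>\<^sub>1\<rangle>\<close>.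
\<close>

lemma fp_square_summable:
  assumes z: "0 < Im z"
  shows "Im z * (\<Sum>n=1..L. (cmod (fp n z))\<^sup>2) \<le> - Im (fp 1 z)"
    and "(\<lambda>n. if n = 0 then 0 else fp n z) \<in> ell2"
proof -
  obtain m where m: "\<And>L. Im z * (\<Sum>n=1..L. (cmod (jacobi_solution a b z 1 (- m) n))\<^sup>2) \<le> Im m"
    using weyl_solution_exists[OF z] by blast
  let ?s = "jacobi_solution a b z 1 (- m)"
  define u where "u n = (if n = 0 then 0 else - ?s n)" for n
  have bound: "(\<Sum>n=1..L. (cmod (?s n))\<^sup>2) \<le> Im m / Im z" for L
    using m[of L] z by (simp add: field_simps)
  have u: "u \<in> ell2"
  proof (rule ell2I_bounded)
    show "(\<Sum>n=1..L. (cmod (u n))\<^sup>2) \<le> Im m / Im z" for L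
      using bound[of L] by (simp add: u_def)
  qed (simp add: u_def)
  have "resolvent (jacobi a b) z (delta 1) = u"
  proof (rule resolvent_eqI[OF z u])
    fix n
    show "jacobi a b u n - z * u n = delta 1 n"
    proof (cases n)
      case (Suc k)
      have "of_real (a (Suc k)) * ?s (Suc (Suc k)) = (z - of_real (b (Suc k))) * ?s (Suc k) - of_real (a k) * ?s k"
        by (rule jacobi_recurrenceD[OF recurrence_solution])
      then show ?thesis using Suc by (cases "k = 0") (simp_all add: jacobi_def u_def delta_def a_zero algebra_simps del: jacobi_solution.simps(3))
    qed (simp add: jacobi_def u_def delta_def)
  qed
  then have "ell2_inner (delta 1) (resolvent (jacobi a b) z (delta 1)) = m"
    by (simp add: inner_delta) (simp add: u_def)
  then have fp: "fp n z = ?s n" for n by (simp add: f_plus_def)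
  then show "Im z * (\<Sum>n=1..L. (cmod (fp n z))\<^sup>2) \<le> - Im (fp 1 z)" using m[of L] by simp
  show "(\<lambda>n. if n = 0 then 0 else fp n z) \<in> ell2"
    using bound fp by (intro ell2I_bounded[of _ "Im m / Im z"]) auto
qed

lemma fp_recurrence: "jacobi_recurrence a b z (\<lambda>n. fp n z)"
  unfolding f_plus_def by (rule recurrence_solution)

lemma fp_0 [simp]: "fp 0 z = 1" by (simp add: f_plus_def)

lemma fp_tendsto_0: "0 < Im z \<Longrightarrow> (\<lambda>n. fp n z) \<longlonglongrightarrow> 0"
  by (rule Lim_transform_eventually[OF ell2_tendsto_0[OF fp_square_summable(2)]])
     (auto simp: eventually_sequentially intro!: exI[of _ 1])

text \<open>
Green's identity between \<open>N\<close> and infinity, where the boundary term vanishes.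
\<close>

lemma fp_tail:
  assumes z: "0 < Im z" and K: "N < K"
  shows "Im z * (cmod (fp K z))\<^sup>2 \<le> - (a N * Im (fp (Suc N) z * cnj (fp N z)))"
proof -
  define X where "X L = a L * Im (fp (Suc L) z * cnj (fp L z))" for L
  have "(\<lambda>L. (M + 1) * (cmod (fp (Suc L) z) * cmod (fp L z))) \<longlonglongrightarrow> (M + 1) * (cmod 0 * cmod 0)"
    by (intro tendsto_intros fp_tendsto_0[OF z] LIMSEQ_Suc)
  then have lim: "(\<lambda>L. (M + 1) * (cmod (fp (Suc L) z) * cmod (fp L z)) - X N) \<longlonglongrightarrow> 0 - X N" by (intro tendsto_intros) simp
  have "Im z * (cmod (fp K z))\<^sup>2 \<le> 0 - X N"
  proof (rule LIMSEQ_le[OF tendsto_const lim], intro exI[of _ K] allI impI)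
    fix L assume "K \<le> L"
    have "(cmod (fp K z))\<^sup>2 \<le> (\<Sum>n\<in>{1..L} - {1..N}. (cmod (fp n z))\<^sup>2)"
      using K \<open>K \<le> L\<close> by (intro member_le_sum) auto
    also have "\<dots> = (\<Sum>n=1..L. (cmod (fp n z))\<^sup>2) - (\<Sum>n=1..N. (cmod (fp n z))\<^sup>2)"
      using K \<open>K \<le> L\<close> by (intro sum_diff) auto
    finally have "Im z * (cmod (fp K z))\<^sup>2 \<le> Im z * (\<Sum>n=1..L. (cmod (fp n z))\<^sup>2) - Im z * (\<Sum>n=1..N. (cmod (fp n z))\<^sup>2)"
      using z unfolding right_diff_distrib[symmetric] by (intro mult_left_mono) auto
    also have "\<dots> = X L - X N" using green_identity[OF fp_recurrence, of L] green_identity[OF fp_recurrence, of N]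
      by (simp add: X_def)
    also have "X L \<le> (M + 1) * (cmod (fp (Suc L) z) * cmod (fp L z))" unfolding X_def
      using a_le[of L] a_pos[of L] Im_mult_cnj_le[of "fp (Suc L) z" "fp L z"] M_pos
      by (meson less_imp_le mult_left_mono mult_right_mono norm_ge_zero order_trans zero_le_mult_iff)
    finally show "Im z * (cmod (fp K z))\<^sup>2 \<le> (M + 1) * (cmod (fp (Suc L) z) * cmod (fp L z)) - X N" by simp
  qed
  then show ?thesis by (simp add: X_def)
qed

lemma wronskian: "of_real (a N) * (fm (Suc N) z * fp N z - fm N z * fp (Suc N) z) = 1"
  using wronskian_constant[OF fm_recurrence[of z] fp_recurrence[of z], of N] by (simp add: a_zero)

lemma fp_nonzero:
  assumes z: "0 < Im z"
  shows "fp N z \<noteq> 0"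
proof
  assume 0: "fp N z = 0"
  then have "Im z * (cmod (fp (Suc N) z))\<^sup>2 \<le> 0" using fp_tail[OF z, of N "Suc N"] by simp
  then have "fp (Suc N) z = 0" using z by (simp add: mult_le_0_iff)
  with 0 wronskian[of N z] show False by simp
qed

lemma fp_ratio:
  assumes z: "0 < Im z"
  shows "Im z * cmod (fp (Suc N) z) \<le> (M + 1) * cmod (fp N z)"
proof -
  have "Im z * (cmod (fp (Suc N) z))\<^sup>2 \<le> a N * - Im (fp (Suc N) z * cnj (fp N z))"
    using fp_tail[OF z, of N "Suc N"] by (simp only: mult_minus_right lessI)
  also have "\<dots> \<le> a N * (cmod (fp (Suc N) z) * cmod (fp N z))"
    using abs_Im_le_cmod[of "fp (Suc N) z * cnj (fp N z)"] a_pos[of N] by (intro mult_left_mono) (auto simp: norm_mult)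
  also have "\<dots> \<le> (M + 1) * (cmod (fp (Suc N) z) * cmod (fp N z))"
    using a_le by (intro mult_right_mono) auto
  finally have "(Im z * cmod (fp (Suc N) z)) * cmod (fp (Suc N) z) \<le> ((M + 1) * cmod (fp N z)) * cmod (fp (Suc N) z)"
    by (simp add: power2_eq_square algebra_simps)
  then show ?thesis by (rule mult_right_le_imp_le) (use fp_nonzero[OF z] in simp)
qed

lemma fp_ratio_Im:
  assumes z: "0 < Im z"
  shows "Im (fp (Suc N) z / fp N z) < 0"
proof -
  have "0 < Im z * (cmod (fp (Suc N) z))\<^sup>2" using z fp_nonzero[OF z] by simp
  also have "\<dots> \<le> - (a N * Im (fp (Suc N) z * cnj (fp N z)))" by (rule fp_tail[OF z]) simp
  finally have "a N * Im (fp (Suc N) z * cnj (fp N z)) < 0" by linarith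
  then have neg: "Im (fp (Suc N) z * cnj (fp N z)) < 0" using a_pos[of N] by (metis mult_less_0_iff not_less_iff_gr_or_eq)
  have "Im (fp (Suc N) z / fp N z) = Im (fp (Suc N) z * cnj (fp N z)) / (cmod (fp N z))\<^sup>2"
    by (subst complex_div_cnj) (simp add: Im_divide_of_real flip: of_real_power)
  then show ?thesis using neg fp_nonzero[OF z] by (simp only: divide_less_0_iff) auto
qed

lemma inverse_green:
  assumes z: "0 < Im z" and N: "1 \<le> N"
  shows "1 / (fm N z * fp N z) = of_real (a N) * (fm (Suc N) z / fm N z - fp (Suc N) z / fp N z)"
  using wronskian[of N z] fm_nonzero[OF assms] fp_nonzero[OF z, of N] by (simp add: field_simps)

text \<open>
The two ratios in \<open>inverse_green\<close> have imaginary parts of opposite sign, so that of the first alone bounds \<open>1/G\<close> below.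
\<close>

lemma green_upper:
  assumes z: "0 < Im z" and N: "1 \<le> N"
  shows "cmod (fm N z * fp N z) \<le> 1 / Im z"
proof -
  have "Im z \<le> a N * Im (fm (Suc N) z / fm N z)" by (rule fm_ratio_Im[OF assms])
  also have "\<dots> \<le> a N * (Im (fm (Suc N) z / fm N z) - Im (fp (Suc N) z / fp N z))"
    using fp_ratio_Im[OF z, of N] a_pos[of N] by (intro mult_left_mono) auto
  also have "\<dots> = Im (1 / (fm N z * fp N z))" unfolding inverse_green[OF assms] by simp
  also have "\<dots> \<le> cmod (1 / (fm N z * fp N z))" using abs_Im_le_cmod[of "1 / (fm N z * fp N z)"] by linarith
  finally have "Im z \<le> 1 / cmod (fm N z * fp N z)" by (simp add: norm_divide)
  then show ?thesis using fm_nonzero[OF assms] fp_nonzero[OF z, of N] z by (simp add: field_simps norm_mult)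
qed

text \<open>
The ratio \<open>fm (Suc N) z / fm N z\<close> is bounded through the recurrence and the bound for \<open>fm (N - 1) z / fm N z\<close>.
\<close>

lemma green_lower:
  assumes z: "0 < Im z" and N: "1 \<le> N"
  shows "1 / (cmod z + M + 2 * (M + 1)\<^sup>2 / Im z) \<le> cmod (fm N z * fp N z)"
proof -
  obtain k where k: "N = Suc k" using N by (cases N) auto
  have fN: "fm N z \<noteq> 0" using fm_nonzero[OF assms] .
  have "of_real (a N) * (fm (Suc N) z / fm N z) = (z - of_real (b N)) - of_real (a k) * (fm k z / fm N z)"
    using jacobi_recurrenceD[OF fm_recurrence, of k z] fN k by (simp add: field_simps)
  then have "1 / (fm N z * fp N z) = (z - of_real (b N)) - of_real (a k) * (fm k z / fm N z) - of_real (a N) * (fp (Suc N) z / fp N z)"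
    unfolding inverse_green[OF assms] right_diff_distrib by simp
  also have "cmod \<dots> \<le> (cmod z + M) + (M + 1) * ((M + 1) / Im z) + (M + 1) * ((M + 1) / Im z)"
  proof (intro order_trans[OF norm_triangle_ineq4] add_mono)
    show "cmod (complex_of_real (b N)) \<le> M" using b_bounds[OF N] by simp
    have "cmod (fm k z / fm N z) \<le> (M + 1) / Im z"
      using fm_ratio[OF z, of k] fN z k by (simp add: norm_divide field_simps)
    then show "cmod (of_real (a k) * (fm k z / fm N z)) \<le> (M + 1) * ((M + 1) / Im z)"
      using a_le[of k] a_pos[of k] M_pos by (simp only: norm_mult) (intro mult_mono, auto)
    have "cmod (fp (Suc N) z / fp N z) \<le> (M + 1) / Im z"
      using fp_ratio[OF z, of N] fp_nonzero[OF z, of N] z by (simp add: norm_divide field_simps)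
    then show "cmod (of_real (a N) * (fp (Suc N) z / fp N z)) \<le> (M + 1) * ((M + 1) / Im z)"
      using a_le[of N] a_pos[of N] M_pos by (simp only: norm_mult) (intro mult_mono, auto)
  qed simp
  finally have "1 / cmod (fm N z * fp N z) \<le> cmod z + M + 2 * (M + 1)\<^sup>2 / Im z"
    by (simp add: norm_divide power2_eq_square)
  moreover have "0 < cmod (fm N z * fp N z)" using fN fp_nonzero[OF z, of N] by simp
  moreover have "0 < cmod z + M + 2 * (M + 1)\<^sup>2 / Im z" using z M_pos by (intro add_nonneg_pos) auto
  ultimately show ?thesis by (simp add: field_simps)
qed

text \<open>
The column \<open>u(k) = -f\<^sub>-(min k N) f\<^sub>+(max k N)\<close> solves \<open>(J - z)u = \<delta>\<^sub>N\<close>; at \<open>k = N\<close> this is the constancy of the Wronskian.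
\<close>

lemma green_diagonal:
  assumes z: "0 < Im z" and N: "1 \<le> N"
  shows "ell2_inner (delta N) (resolvent (jacobi a b) z (delta N)) = - (fm N z * fp N z)"
proof -
  define u where "u k = (if k = 0 then 0 else - (fm (min k N) z * fp (max k N) z))" for k
  have "summable (\<lambda>k. (cmod (fm N z))\<^sup>2 * (cmod (if k = 0 then 0 else fp k z))\<^sup>2)"
    using fp_square_summable(2)[OF z] by (intro summable_mult) (auto simp: ell2_def)
  then have "summable (\<lambda>k. (cmod (u k))\<^sup>2)"
    by (rule summable_comparison_test'[where N = N])
       (use N in \<open>auto simp: u_def norm_mult power_mult_distrib min_absorb2 max_absorb1\<close>)
  then have u: "u \<in> ell2" by (simp add: ell2_def u_def)
  have "resolvent (jacobi a b) z (delta N) = u"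
  proof (rule resolvent_eqI[OF z u])
    fix n
    show "jacobi a b u n - z * u n = delta N n"
    proof (cases n)
      case (Suc k)
      have m: "of_real (a (Suc k)) * fm (Suc (Suc k)) z = (z - of_real (b (Suc k))) * fm (Suc k) z - of_real (a k) * fm k z"
        by (rule jacobi_recurrenceD[OF fm_recurrence])
      have p: "of_real (a (Suc k)) * fp (Suc (Suc k)) z = (z - of_real (b (Suc k))) * fp (Suc k) z - of_real (a k) * fp k z"
        by (rule jacobi_recurrenceD[OF fp_recurrence])
      have J: "jacobi a b u n = of_real (a (Suc k)) * u (Suc (Suc k)) + of_real (a k) * u k + of_real (b (Suc k)) * u (Suc k)"
        using Suc by (simp add: jacobi_def u_def)
      consider "n < N" | "n = N" | "N < n" by linarith
      then show ?thesis
      proof cases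
        case 1
        have uu: "u i = - (fm i z * fp N z)" if "i \<le> N" for i using that by (simp add: u_def)
        have "jacobi a b u n - z * u n = - fp N z * (of_real (a (Suc k)) * fm (Suc (Suc k)) z
            + of_real (a k) * fm k z + of_real (b (Suc k)) * fm (Suc k) z - z * fm (Suc k) z)"
          using 1 Suc unfolding J by (simp add: uu algebra_simps)
        then show ?thesis using 1 unfolding m by (simp add: delta_def algebra_simps)
      next
        case 3
        have uu: "u i = - (fm N z * fp i z)" if "N \<le> i" for i using that N by (simp add: u_def)
        have "jacobi a b u n - z * u n = - fm N z * (of_real (a (Suc k)) * fp (Suc (Suc k)) z
            + of_real (a k) * fp k z + of_real (b (Suc k)) * fp (Suc k) z - z * fp (Suc k) z)"
          using 3 Suc unfolding J by (simp add: uu algebra_simps)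
        then show ?thesis using 3 unfolding p by (simp add: delta_def algebra_simps)
      next
        case 2
        have "jacobi a b u n - z * u n = - (of_real (a N) * (fm N z * fp (Suc N) z))
            - fp N z * (of_real (a k) * fm k z + of_real (b (Suc k)) * fm (Suc k) z - z * fm (Suc k) z)"
          using 2 Suc unfolding J by (simp add: u_def algebra_simps)
        also have "of_real (a k) * fm k z + of_real (b (Suc k)) * fm (Suc k) z - z * fm (Suc k) z = - (of_real (a (Suc k)) * fm (Suc (Suc k)) z)"
          unfolding m by (simp add: algebra_simps)
        finally have "jacobi a b u n - z * u n = of_real (a N) * (fm (Suc N) z * fp N z - fm N z * fp (Suc N) z)"
          using 2 Suc by (simp add: algebra_simps)
        then show ?thesis using 2 by (simp add: wronskian delta_def)
      qed
    qed (use N in \<open>simp add: jacobi_def u_def delta_def\<close>)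
  qed
  then show ?thesis using N by (simp add: inner_delta u_def)
qed

section \<open>The averages of logarithms and of the Green function\<close>

lemma Re_w_minus_avg:
  assumes z: "0 < Im z"
  shows "Re (w_minus_avg a b N z) = ln (cmod (fm (Suc N) z)) / real N"
proof -
  have "Re (\<Sum>n=1..N. Ln (fm (n + 1) z / fm n z)) = ln (cmod (fm (Suc N) z))"
  proof (induction N)
    case (Suc N)
    then show ?case using fm_nonzero[OF z, of "Suc N"] fm_nonzero[OF z, of "Suc (Suc N)"]
      by (simp add: norm_divide ln_div)
  qed simp
  moreover have "Re (1 / of_nat N * w) = Re w / real N" for w by (simp add: Re_divide_of_nat)
  ultimately show ?thesis unfolding w_minus_avg_def by simp
qed

lemma Re_w_plus_avg:
  assumes z: "0 < Im z"
  shows "Re (w_plus_avg a b N z) = (ln (cmod (fp (Suc N) z)) - ln (cmod (fp 1 z))) / real N"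
proof -
  have "Re (\<Sum>n=1..N. Ln (- (fp (n + 1) z / fp n z))) = ln (cmod (fp (Suc N) z)) - ln (cmod (fp 1 z))"
  proof (induction N)
    case (Suc N)
    then show ?case using fp_nonzero[OF z, of "Suc N"] fp_nonzero[OF z, of "Suc (Suc N)"]
      by (simp add: norm_divide ln_div)
  qed simp
  moreover have "Re (1 / of_nat N * w) = Re w / real N" for w by (simp add: Re_divide_of_nat)
  ultimately show ?thesis unfolding w_plus_avg_def by simp
qed

text \<open>
Both sums of logarithms telescope, and together they leave the logarithm of one Green function and a constant.
\<close>

lemma Re_w_sum_bounded:
  assumes z: "0 < Im z"
  obtains B where "\<And>N. \<bar>Re (w_plus_avg a b N z) + Re (w_minus_avg a b N z)\<bar> \<le> B / real N"
proof -
  define l where "l = ln (1 / (cmod z + M + 2 * (M + 1)\<^sup>2 / Im z))"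
  define u where "u = ln (1 / Im z)"
  have pos: "0 < cmod z + M + 2 * (M + 1)\<^sup>2 / Im z" using z M_pos by (intro add_nonneg_pos) auto
  have "\<bar>Re (w_plus_avg a b N z) + Re (w_minus_avg a b N z)\<bar> \<le> (\<bar>l\<bar> + \<bar>u\<bar> + \<bar>ln (cmod (fp 1 z))\<bar>) / real N" for N
  proof -
    have nz: "cmod (fm (Suc N) z) > 0" "cmod (fp (Suc N) z) > 0"
      using fm_nonzero[OF z, of "Suc N"] fp_nonzero[OF z, of "Suc N"] by auto
    have eq: "Re (w_plus_avg a b N z) + Re (w_minus_avg a b N z) = (ln (cmod (fm (Suc N) z * fp (Suc N) z)) - ln (cmod (fp 1 z))) / real N"
      unfolding Re_w_plus_avg[OF z] Re_w_minus_avg[OF z] using nz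
      by (simp add: norm_mult ln_mult add_divide_distrib diff_divide_distrib)
    have "l \<le> ln (cmod (fm (Suc N) z * fp (Suc N) z))"
      unfolding l_def using green_lower[OF z, of "Suc N"] pos by (intro ln_mono) auto
    moreover have "ln (cmod (fm (Suc N) z * fp (Suc N) z)) \<le> u"
      unfolding u_def using green_upper[OF z, of "Suc N"] nz by (intro ln_mono) (auto simp: norm_mult)
    ultimately have "\<bar>ln (cmod (fm (Suc N) z * fp (Suc N) z)) - ln (cmod (fp 1 z))\<bar> \<le> \<bar>l\<bar> + \<bar>u\<bar> + \<bar>ln (cmod (fp 1 z))\<bar>" by linarith
    then show ?thesis unfolding eq abs_divide abs_of_nat by (intro divide_right_mono) auto
  qed
  then show ?thesis using that by blast
qed

definition fm_deriv :: "nat \<Rightarrow> complex \<Rightarrow> complex" where "fm_deriv n z = poly (pderiv (fm_poly n)) z"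

lemma fm_has_derivative: "((\<lambda>z. fm n z) has_field_derivative fm_deriv n z) (at z)"
  unfolding poly_fm_poly[symmetric] fm_deriv_def by (rule poly_DERIV)

lemma fm_deriv_recurrence: "of_real (a (Suc n)) * fm_deriv (Suc (Suc n)) z = fm (Suc n) z + (z - of_real (b (Suc n))) * fm_deriv (Suc n) z - of_real (a n) * fm_deriv n z"
  by (simp add: fm_deriv_def pderiv_smult pderiv_diff pderiv_mult pderiv_pCons pderiv_add poly_fm_poly algebra_simps)

lemma christoffel_darboux:
  assumes "jacobi_recurrence a b z f"
  shows "of_real (a N) * (fm_deriv (Suc N) z * f N - fm_deriv N z * f (Suc N)) = (\<Sum>n=1..N. fm n z * f n)"
proof (induction N)
  case 0
  show ?case by (simp add: fm_deriv_def)
next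
  case (Suc N)
  have "of_real (a (Suc N)) * (fm_deriv (Suc (Suc N)) z * f (Suc N) - fm_deriv (Suc N) z * f (Suc (Suc N)))
      = (of_real (a (Suc N)) * fm_deriv (Suc (Suc N)) z) * f (Suc N) - fm_deriv (Suc N) z * (of_real (a (Suc N)) * f (Suc (Suc N)))"
    by (simp add: algebra_simps)
  also have "\<dots> = fm (Suc N) z * f (Suc N) + of_real (a N) * (fm_deriv (Suc N) z * f N - fm_deriv N z * f (Suc N))"
    unfolding fm_deriv_recurrence jacobi_recurrenceD[OF assms] by (simp add: algebra_simps)
  finally show ?case by (simp add: Suc.IH)
qed

lemma w_minus_avg_derivative:
  assumes z: "0 < Im z"
  shows "(w_minus_avg a b N has_field_derivative (1 / of_nat N) * (fm_deriv (Suc N) z / fm (Suc N) z)) (at z)"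
proof -
  have summand: "((\<lambda>z. Ln (fm (n + 1) z / fm n z)) has_field_derivative (fm_deriv (n + 1) z / fm (n + 1) z - fm_deriv n z / fm n z)) (at z)"
    if n: "1 \<le> n" for n
  proof -
    have nz: "fm n z \<noteq> 0" "fm (Suc n) z \<noteq> 0" using fm_nonzero[OF z] n by auto
    have "0 < a n * Im (fm (Suc n) z / fm n z)" using fm_ratio_Im[OF z n] z by linarith
    then have "0 < Im (fm (Suc n) z / fm n z)" using a_pos[of n] by (simp only: zero_less_mult_iff) auto
    then have "fm (Suc n) z / fm n z \<notin> \<real>\<^sub>\<le>\<^sub>0" by (auto simp: complex_nonpos_Reals_iff)
    then show ?thesis using nz
      by (auto intro!: derivative_eq_intros fm_has_derivative simp: field_simps)
  qed
  have "((\<lambda>z. (1 / of_nat N) * (\<Sum>n=1..N. Ln (fm (n + 1) z / fm n z))) has_field_derivative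
      (1 / of_nat N) * (\<Sum>n=1..N. fm_deriv (n + 1) z / fm (n + 1) z - fm_deriv n z / fm n z)) (at z)"
    by (intro DERIV_cmult DERIV_sum summand) auto
  moreover have "(\<Sum>n=1..N. fm_deriv (n + 1) z / fm (n + 1) z - fm_deriv n z / fm n z) = fm_deriv (Suc N) z / fm (Suc N) z"
    by (induction N) (simp_all add: fm_deriv_def)
  ultimately show ?thesis unfolding w_minus_avg_def[abs_def] by (simp only:)
qed

text \<open>
By Christoffel-Darboux, \<open>\<Sum> G\<^sub>n\<^sub>n\<close> and the logarithmic derivative of \<open>p\<^sub>N\<close> differ only by
\<open>(f\<^sub>+(N+1) / f\<^sub>-(N+1)) \<Sum> f\<^sub>-(n)\<^sup>2\<close>, and this is bounded in \<open>N\<close> by the estimates for the two solutions.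
\<close>

lemma green_avg_plus_deriv:
  assumes z: "0 < Im z"
  shows "cmod (green_avg a b N z + (1 / of_nat N) * (fm_deriv (Suc N) z / fm (Suc N) z)) \<le> ((M + 1)\<^sup>2 / (Im z) ^ 3) / real N"
proof (cases "N = 0")
  let ?G = "\<Sum>n=1..N. ell2_inner (delta n) (resolvent (jacobi a b) z (delta n))"
  case False
  then have N: "1 \<le> N" by simp
  have nz: "fm (Suc N) z \<noteq> 0" using fm_nonzero[OF z] by simp
  have "?G = - (\<Sum>n=1..N. fm n z * fp n z)"
    unfolding sum_negf[symmetric] by (intro sum.cong green_diagonal[OF z]) auto
  also have "\<dots> = - (of_real (a N) * (fm_deriv (Suc N) z * fp N z - fm_deriv N z * fp (Suc N) z))"
    by (simp only: christoffel_darboux[OF fp_recurrence[of z]])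
  finally have G: "?G = - (of_real (a N) * (fm_deriv (Suc N) z * fp N z - fm_deriv N z * fp (Suc N) z))" .
  have W: "fm_deriv (Suc N) z / fm (Suc N) z = fm_deriv (Suc N) z / fm (Suc N) z * (of_real (a N) * (fm (Suc N) z * fp N z - fm N z * fp (Suc N) z))"
    by (simp only: wronskian mult_1_right)
  have "fm_deriv (Suc N) z / fm (Suc N) z - of_real (a N) * (fm_deriv (Suc N) z * fp N z - fm_deriv N z * fp (Suc N) z)
     = - (fp (Suc N) z / fm (Suc N) z * (of_real (a N) * (fm_deriv (Suc N) z * fm N z - fm_deriv N z * fm (Suc N) z)))"
    by (subst W) (use nz in \<open>simp add: field_simps\<close>)
  also have "\<dots> = - (fp (Suc N) z / fm (Suc N) z * (\<Sum>n=1..N. fm n z * fm n z))"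
    by (simp only: christoffel_darboux[OF fm_recurrence[of z]])
  finally have eq: "?G + fm_deriv (Suc N) z / fm (Suc N) z
      = - (fp (Suc N) z / fm (Suc N) z * (\<Sum>n=1..N. fm n z * fm n z))"
    unfolding G by (simp add: algebra_simps)
  have "cmod (\<Sum>n=1..N. fm n z * fm n z) \<le> (\<Sum>n=1..N. (cmod (fm n z))\<^sup>2)"
    by (rule sum_norm_le) (simp add: norm_mult power2_eq_square)
  also have "\<dots> \<le> (M + 1) * (cmod (fm (Suc N) z) * cmod (fm N z)) / Im z"
    using fm_norm_product_ge[OF z, of N] z by (simp add: field_simps)
  finally have S: "cmod (\<Sum>n=1..N. fm n z * fm n z) \<le> (M + 1) * (cmod (fm (Suc N) z) * cmod (fm N z)) / Im z" .
  have "cmod (- (fp (Suc N) z / fm (Suc N) z * (\<Sum>n=1..N. fm n z * fm n z)))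
     \<le> cmod (fp (Suc N) z) / cmod (fm (Suc N) z) * ((M + 1) * (cmod (fm (Suc N) z) * cmod (fm N z)) / Im z)"
    unfolding norm_minus_cancel norm_mult norm_divide using S by (intro mult_left_mono) auto
  also have "\<dots> = (M + 1) / Im z * (cmod (fp (Suc N) z) * cmod (fm N z))"
  proof -
    have "p / q * (K * (q * r) / y) = K / y * (p * r)" if "q \<noteq> 0" for p q r K y :: real using that by simp
    from this[of "cmod (fm (Suc N) z)"] nz show ?thesis by (metis norm_eq_zero)
  qed
  also have "\<dots> \<le> (M + 1) / Im z * (((M + 1) * cmod (fp N z) / Im z) * cmod (fm N z))"
    using fp_ratio[OF z, of N] z M_pos by (intro mult_left_mono mult_right_mono) (auto simp: field_simps)
  also have "\<dots> = (M + 1)\<^sup>2 / (Im z)\<^sup>2 * cmod (fm N z * fp N z)"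
    by (simp add: norm_mult power2_eq_square)
  also have "\<dots> \<le> (M + 1)\<^sup>2 / (Im z)\<^sup>2 * (1 / Im z)"
    using green_upper[OF z N] by (intro mult_left_mono) auto
  also have "\<dots> = (M + 1)\<^sup>2 / (Im z) ^ 3" by (simp only: power2_eq_square power3_eq_cube times_divide_times_eq mult_1_right)
  finally have "cmod (?G + fm_deriv (Suc N) z / fm (Suc N) z) \<le> (M + 1)\<^sup>2 / (Im z) ^ 3"
    unfolding eq .
  moreover have avg: "green_avg a b N z + (1 / of_nat N) * (fm_deriv (Suc N) z / fm (Suc N) z)
    = (?G + fm_deriv (Suc N) z / fm (Suc N) z) / of_nat N"
    unfolding green_avg_def by (simp add: add_divide_distrib)
  ultimately show ?thesis unfolding avg norm_divide norm_of_nat by (intro divide_right_mono) auto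
qed (simp add: green_avg_def)

end

section \<open>Growth of the orthonormal polynomials almost everywhere\<close>

context bounded_jacobi
begin

lemma jacobi_lincomb: "jacobi a b (lincomb c u d v) = lincomb c (jacobi a b u) d (jacobi a b v)"
  by (auto simp: jacobi_def lincomb_def algebra_simps)

lemma jacobi_ell2:
  assumes u: "u \<in> ell2"
  shows "jacobi a b u \<in> ell2"
proof -
  have s: "summable (\<lambda>n. (cmod (u n))\<^sup>2)" using u by (simp add: ell2_def)
  have "summable (\<lambda>n. (cmod (u (n - 1)))\<^sup>2)" using s by (subst summable_Suc_iff[symmetric]) simp
  moreover have "summable (\<lambda>n. (cmod (u (n + 1)))\<^sup>2)" using s summable_Suc_iff[of "\<lambda>n. (cmod (u n))\<^sup>2"] by simp
  ultimately have sum: "summable (\<lambda>n. 3 * (M + 1)\<^sup>2 * ((cmod (u (n + 1)))\<^sup>2 + (cmod (u (n - 1)))\<^sup>2 + (cmod (u n))\<^sup>2))"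
    using s by (intro summable_mult summable_add)
  have "summable (\<lambda>n. (cmod (jacobi a b u n))\<^sup>2)"
  proof (rule summable_comparison_test'[OF sum, where N = 0])
    fix n
    define p q r where "p = cmod (u (n + 1))" and "q = cmod (u (n - 1))" and "r = cmod (u n)"
    have "cmod (jacobi a b u n) \<le> (M + 1) * p + (M + 1) * q + (M + 1) * r"
    proof (cases "n = 0")
      case True
      then show ?thesis using M_pos by (simp add: jacobi_def p_def q_def r_def)
    next
      case False
      have "cmod (of_real (a n) * u (n + 1)) \<le> (M + 1) * p"
        using a_le[of n] a_pos[of n] by (auto simp: norm_mult p_def intro!: mult_right_mono)
      moreover have "cmod (if n = 1 then 0 else of_real (a (n - 1)) * u (n - 1)) \<le> (M + 1) * q"
        using a_le[of "n - 1"] a_pos[of "n - 1"] M_pos by (auto simp: norm_mult q_def intro!: mult_right_mono)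
      moreover have "cmod (of_real (b n) * u n) \<le> (M + 1) * r"
        using b_bounds[of n] False M_pos by (auto simp: norm_mult r_def intro!: mult_right_mono)
      ultimately show ?thesis using False unfolding jacobi_def
        by (simp only: if_False) (intro norm_triangle_le add_mono order_trans[OF norm_triangle_ineq])
    qed
    then have "(cmod (jacobi a b u n))\<^sup>2 \<le> ((M + 1) * p + (M + 1) * q + (M + 1) * r)\<^sup>2" by (intro power_mono) auto
    also have "\<dots> = (M + 1)\<^sup>2 * (p + q + r)\<^sup>2" by (simp add: power2_eq_square algebra_simps)
    finally have 1: "(cmod (jacobi a b u n))\<^sup>2 \<le> (M + 1)\<^sup>2 * (p + q + r)\<^sup>2" .
    have "(p + q + r)\<^sup>2 \<le> 3 * (p\<^sup>2 + q\<^sup>2 + r\<^sup>2)"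
      using sum_squares_bound[of p q] sum_squares_bound[of p r] sum_squares_bound[of q r]
      by (simp add: power2_eq_square algebra_simps)
    then have "(M + 1)\<^sup>2 * (p + q + r)\<^sup>2 \<le> (M + 1)\<^sup>2 * (3 * (p\<^sup>2 + q\<^sup>2 + r\<^sup>2))"
      by (rule mult_left_mono) simp
    also have "\<dots> = 3 * (M + 1)\<^sup>2 * (p\<^sup>2 + q\<^sup>2 + r\<^sup>2)" by simp
    finally show "norm ((cmod (jacobi a b u n))\<^sup>2) \<le> 3 * (M + 1)\<^sup>2 * ((cmod (u (n + 1)))\<^sup>2 + (cmod (u (n - 1)))\<^sup>2 + (cmod (u n))\<^sup>2)"
      using 1 by (simp add: p_def q_def r_def)
  qed
  then show ?thesis by (simp add: ell2_def jacobi_def)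
qed

text \<open>
Summation by parts; the boundary term \<open>X\<close> tends to 0.
\<close>

lemma jacobi_symmetric:
  assumes u: "u \<in> ell2" and v: "v \<in> ell2"
  shows "ell2_inner (jacobi a b u) v = ell2_inner u (jacobi a b v)"
proof -
  have 0: "u 0 = 0" "v 0 = 0" using u v by (auto simp: ell2_def)
  define X where "X N = of_real (a N) * (cnj (u N) * v (Suc N) - cnj (u (Suc N)) * v N)" for N
  define d where "d n = cnj (u n) * jacobi a b v n - cnj (jacobi a b u n) * v n" for n
  have "(\<Sum>n\<le>N. d n) = X N" for N
  proof (induction N)
    case 0
    then show ?case by (simp add: d_def X_def \<open>u 0 = 0\<close> \<open>v 0 = 0\<close>)
  next
    case (Suc N)
    have J: "jacobi a b w (Suc N) = of_real (a (Suc N)) * w (Suc (Suc N)) + of_real (a N) * w N + of_real (b (Suc N)) * w (Suc N)"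
      if "w 0 = 0" for w using that by (simp add: jacobi_def)
    have "d (Suc N) = X (Suc N) - X N"
      unfolding d_def X_def J[of u, OF \<open>u 0 = 0\<close>] J[of v, OF \<open>v 0 = 0\<close>] complex_cnj_add complex_cnj_mult complex_cnj_complex_of_real
      by (simp only: ring_distribs) (simp add: algebra_simps)
    then show ?case using Suc by simp
  qed
  moreover have "X \<longlonglongrightarrow> 0"
  proof (rule tendsto_0_le[where K = 1])
    have "(\<lambda>N. (M + 1) * (cmod (u N) * cmod (v (Suc N)) + cmod (u (Suc N)) * cmod (v N))) \<longlonglongrightarrow> (M + 1) * (cmod 0 * cmod 0 + cmod 0 * cmod 0)"
      by (intro tendsto_intros ell2_tendsto_0[OF u] ell2_tendsto_0[OF v] LIMSEQ_Suc[OF ell2_tendsto_0[OF u]] LIMSEQ_Suc[OF ell2_tendsto_0[OF v]])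
    then show "(\<lambda>N. (M + 1) * (cmod (u N) * cmod (v (Suc N)) + cmod (u (Suc N)) * cmod (v N))) \<longlonglongrightarrow> 0" by simp
    have "cmod (X N) \<le> (M + 1) * (cmod (u N) * cmod (v (Suc N)) + cmod (u (Suc N)) * cmod (v N))" for N
    proof -
      have "cmod (X N) = a N * cmod (cnj (u N) * v (Suc N) - cnj (u (Suc N)) * v N)"
        using a_pos[of N] by (simp add: X_def norm_mult)
      also have "\<dots> \<le> (M + 1) * (cmod (u N) * cmod (v (Suc N)) + cmod (u (Suc N)) * cmod (v N))"
        using a_le[of N] M_pos norm_triangle_ineq4[of "cnj (u N) * v (Suc N)" "cnj (u (Suc N)) * v N"]
        by (intro mult_mono) (auto simp: norm_mult)
      finally show ?thesis .
    qed
    then show "\<forall>\<^sub>F N in sequentially. norm (X N) \<le> norm ((M + 1) * (cmod (u N) * cmod (v (Suc N)) + cmod (u (Suc N)) * cmod (v N))) * 1"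
      by (intro always_eventually allI) (metis abs_ge_self mult_1_right order_trans real_norm_def)
  qed
  ultimately have "(\<lambda>N. \<Sum>n\<le>N. d n) \<longlonglongrightarrow> 0" by simp
  then have "d sums 0" by (simp add: sums_def_le)
  moreover have "d sums (ell2_inner u (jacobi a b v) - ell2_inner (jacobi a b u) v)"
    unfolding d_def ell2_inner_def by (intro sums_diff summable_sums ell2_inner_summable jacobi_ell2 u v)
  ultimately show ?thesis using sums_unique2 by fastforce
qed

lemma jacobi_sum: "jacobi a b (\<lambda>n. \<Sum>k\<le>K. c k * D k n) = (\<lambda>n. \<Sum>k\<le>(K::nat). c k * jacobi a b (D k) n)"
proof (induction K)
  case 0
  then show ?case using jacobi_lincomb[of "c 0" "D 0" 0 "D 0"] by (simp add: lincomb_def)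
next
  case (Suc K)
  have "jacobi a b (\<lambda>n. \<Sum>k\<le>Suc K. c k * D k n) = jacobi a b (lincomb 1 (\<lambda>n. \<Sum>k\<le>K. c k * D k n) (c (Suc K)) (D (Suc K)))"
    by (simp add: lincomb_def)
  then show ?case unfolding jacobi_lincomb Suc.IH by (simp add: lincomb_def)
qed

text \<open>
The vector \<open>p(J)\<delta>\<^sub>1\<close>.
\<close>

definition orbit :: "complex poly \<Rightarrow> nat \<Rightarrow> complex" where
  "orbit p = (\<lambda>n. \<Sum>k\<le>degree p. coeff p k * (jacobi a b ^^ k) (delta 1) n)"

lemma orbit_eq:
  assumes "degree p \<le> K"
  shows "orbit p = (\<lambda>n. \<Sum>k\<le>K. coeff p k * (jacobi a b ^^ k) (delta 1) n)"
  unfolding orbit_def using assms by (intro ext sum.mono_neutral_left) (auto simp: coeff_eq_0)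

lemma orbit_smult_add: "orbit (Polynomial.smult c p + Polynomial.smult d q) = lincomb c (orbit p) d (orbit q)"
proof -
  define K where "K = max (degree p) (degree q)"
  have d: "degree p \<le> K" "degree q \<le> K" by (simp_all add: K_def)
  then have "degree (Polynomial.smult c p + Polynomial.smult d q) \<le> K"
    by (intro degree_add_le order_trans[OF degree_smult_le])
  then show ?thesis unfolding orbit_eq[OF d(1)] orbit_eq[OF d(2)]
    by (simp add: orbit_eq lincomb_def sum.distrib sum_distrib_left algebra_simps)
qed

lemma orbit_pCons_0: "orbit (pCons 0 p) = jacobi a b (orbit p)"
proof -
  have "degree (pCons 0 p) \<le> Suc (degree p)" by (rule degree_pCons_le)
  from orbit_eq[OF this] show ?thesis
    unfolding orbit_def[of p] jacobi_sum by (simp add: sum.atMost_Suc_shift del: sum.atMost_Suc)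
qed

lemma orbit_linear_factor: "orbit ([:- l, 1:] * p) = lincomb 1 (jacobi a b (orbit p)) (- l) (orbit p)"
proof -
  have "[:- l, 1:] * p = Polynomial.smult 1 (pCons 0 p) + Polynomial.smult (- l) p" by simp
  then show ?thesis by (simp only: orbit_smult_add orbit_pCons_0)
qed

lemma orbit_0: "orbit 0 = (\<lambda>n. 0)" by (simp add: orbit_def)

lemma orbit_1: "orbit 1 = delta 1" by (simp add: orbit_def)

lemma orbit_fm_poly: "orbit (fm_poly (Suc n)) = delta (Suc n)"
proof (induction n rule: less_induct)
  case (less n)
  show ?case
  proof (cases n)
    case 0
    then show ?thesis by (simp add: orbit_1)
  next
    case (Suc m)
    let ?r = "1 / complex_of_real (a (Suc m))"
    have m: "orbit (fm_poly m) = (if m = 0 then (\<lambda>n. 0) else delta m)"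
      using less.IH[of "m - 1"] Suc by (cases m) (auto simp: orbit_0)
    have "fm_poly (Suc (Suc m)) = Polynomial.smult ?r ([:- of_real (b (Suc m)), 1:] * fm_poly (Suc m)) + Polynomial.smult (- of_real (a m) * ?r) (fm_poly m)"
      by (simp only: fm_poly.simps smult_diff_right smult_smult) (simp add: mult.commute)
    then have "orbit (fm_poly (Suc (Suc m))) = lincomb ?r (lincomb 1 (jacobi a b (delta (Suc m))) (- of_real (b (Suc m))) (delta (Suc m)))
         (- of_real (a m) * ?r) (orbit (fm_poly m))"
      using less.IH[of m] Suc by (simp only: orbit_smult_add orbit_linear_factor lessI)
    also have "\<dots> = delta (Suc (Suc m))"
      unfolding m by (auto simp: fun_eq_iff lincomb_def jacobi_def delta_def)
    finally show ?thesis using Suc by simp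
  qed
qed

lemma jacobi_spectral_operator: "spectral_resolution (jacobi a b) E \<Longrightarrow> spectral_operator (jacobi a b) E"
  by unfold_locales (auto intro: jacobi_ell2 jacobi_lincomb jacobi_symmetric)

lemma fm_norm_factorization:
  assumes "fm_poly (Suc N) = Polynomial.smult (complex_of_real c) (\<Prod>i<N. [:- complex_of_real (x i), 1:])" "0 < c"
  shows "cmod (fm (Suc N) z) = c * (\<Prod>i<N. cmod (z - of_real (x i)))"
  unfolding poly_fm_poly[symmetric] assms(1) using assms(2) by (simp add: poly_prod norm_mult flip: prod_norm)

text \<open>
Since \<open>\<delta>\<^bsub>N+1\<^esub> = p\<^sub>N(J)\<delta>\<^sub>1\<close> and \<open>p\<^sub>N\<close> is a product of real linear factors, the functional calculus turns
\<open>\<parallel>\<delta>\<^bsub>N+1\<^esub>\<parallel>\<^sup>2 = 1\<close> into \<open>\<integral> p\<^sub>N\<^sup>2 d\<rho> = 1\<close>.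
\<close>

lemma orthonormal_norm:
  assumes E: "spectral_resolution (jacobi a b) E"
  shows "(\<integral>\<^sup>+t. ennreal ((cmod (fm (Suc N) (of_real t)))\<^sup>2) \<partial>spectral_measure E) = 1"
proof -
  interpret S: spectral_operator "jacobi a b" E by (rule jacobi_spectral_operator[OF E])
  have rho: "spectral_measure E = S.\<mu> (delta 1)"
    by (simp add: spectral_measure_def S.\<mu>_def S.F_def[abs_def])
  obtain c x where cx: "0 < c" "fm_poly (Suc N) = Polynomial.smult (complex_of_real c) (\<Prod>i<N. [:- complex_of_real (x i), 1:])"
    by (rule fm_factorization)
  have d: "delta 1 \<in> ell2" by (rule delta_ell2) simp
  have orbit_prod: "orbit (\<Prod>i<k. [:- complex_of_real (x i), 1:]) = S.shifted x (delta 1) k" for k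
  proof (induction k)
    case (Suc k)
    have "(\<Prod>i<Suc k. [:- complex_of_real (x i), 1:]) = [:- complex_of_real (x k), 1:] * (\<Prod>i<k. [:- complex_of_real (x i), 1:])"
      by (simp only: prod.lessThan_Suc mult.commute)
    then show ?case by (simp only: orbit_linear_factor Suc.IH S.shifted.simps)
  qed (simp add: orbit_1)
  let ?v = "S.shifted x (delta 1) N"
  have v: "?v \<in> ell2" by (rule S.shifted_ell2[OF d])
  have "delta (Suc N) = orbit (Polynomial.smult (of_real c) (\<Prod>i<N. [:- complex_of_real (x i), 1:]) + Polynomial.smult 0 0)"
    using orbit_fm_poly[of N] cx(2) by simp
  then have "delta (Suc N) = lincomb (of_real c) ?v 0 (\<lambda>n. 0)" by (simp only: orbit_smult_add orbit_prod orbit_0)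
  then have dl: "delta (Suc N) = lincomb (of_real c) ?v 0 ?v" by (simp add: lincomb_def)
  have "complex_of_real ((ell2_norm (delta (Suc N)))\<^sup>2) = complex_of_real (c\<^sup>2 * (ell2_norm ?v)\<^sup>2)"
    unfolding dl S.norm_sq_lincomb[OF v v] norm_sq_inner[OF v, symmetric] by (simp add: power2_eq_square)
  then have one: "c\<^sup>2 * (ell2_norm ?v)\<^sup>2 = 1"
    by (simp only: of_real_eq_iff) (simp add: norm_sq_delta)
  have "(cmod (fm (Suc N) (of_real t)))\<^sup>2 = c\<^sup>2 * (\<Prod>i<N. t - x i)\<^sup>2" for t
  proof -
    have "cmod (complex_of_real t - of_real (x i)) = \<bar>t - x i\<bar>" for i
      by (simp flip: of_real_diff)
    then show ?thesis unfolding fm_norm_factorization[OF cx(2,1)]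
      by (simp add: power_mult_distrib abs_prod[symmetric])
  qed
  then have "(\<integral>\<^sup>+t. ennreal ((cmod (fm (Suc N) (of_real t)))\<^sup>2) \<partial>spectral_measure E)
     = (\<integral>\<^sup>+t. ennreal (c\<^sup>2) * ennreal ((\<Prod>i<N. t - x i)\<^sup>2) \<partial>S.\<mu> (delta 1))"
    by (simp add: rho ennreal_mult)
  also have "\<dots> = ennreal (c\<^sup>2) * (\<integral>\<^sup>+t. ennreal ((\<Prod>i<N. t - x i)\<^sup>2) \<partial>S.\<mu> (delta 1))"
    by (rule nn_integral_cmult) measurable
  also have "\<dots> = ennreal (c\<^sup>2) * ennreal ((ell2_norm ?v)\<^sup>2)"
    by (simp only: S.integral_shifted[OF d])
  also have "\<dots> = 1" using one by (simp flip: ennreal_mult)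
  finally show ?thesis .
qed

text \<open>
The series \<open>\<Sum> p\<^sub>N\<^sup>2 / (N+1)\<^sup>2\<close> has finite \<open>\<rho>\<close>-integral.
\<close>

lemma AE_growth:
  assumes E: "spectral_resolution (jacobi a b) E"
  shows "AE t in spectral_measure E. \<exists>C. \<forall>N. cmod (fm (Suc N) (of_real t)) \<le> C * real (Suc N)"
proof -
  have [simp, measurable_cong]: "sets (spectral_measure E) = sets borel" by (simp add: spectral_measure_def)
  have [measurable]: "(\<lambda>t::real. fm n (complex_of_real t)) \<in> borel_measurable borel" for n
    unfolding poly_fm_poly[symmetric] by (intro borel_measurable_continuous_onI continuous_intros)
  \<comment> \<open>Any summable weights of polynomial decay give subexponential growth.\<close>
  define q where "q N = 1 / (real (Suc N))\<^sup>2" for N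
  have q0: "0 \<le> q N" for N by (simp add: q_def)
  have "(\<integral>\<^sup>+t. (\<Sum>N. ennreal (q N) * ennreal ((cmod (fm (Suc N) (of_real t)))\<^sup>2)) \<partial>spectral_measure E)
      = (\<Sum>N. ennreal (q N) * (\<integral>\<^sup>+t. ennreal ((cmod (fm (Suc N) (of_real t)))\<^sup>2) \<partial>spectral_measure E))"
    by (subst nn_integral_suminf) (auto simp: nn_integral_cmult)
  also have "\<dots> = (\<Sum>N. ennreal (q N))" by (simp add: orthonormal_norm[OF E])
  also have "\<dots> < \<infinity>"
  proof -
    have "summable (\<lambda>N. 1 / (real N)\<^sup>2)" using inverse_power_summable[of 2, where 'a = real] by (simp add: divide_inverse)
    then have "summable q" unfolding q_def by (subst summable_Suc_iff)
    then show ?thesis using suminf_ennreal2[OF q0] by (simp add: less_top[symmetric])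
  qed
  finally have "AE t in spectral_measure E. (\<Sum>N. ennreal (q N) * ennreal ((cmod (fm (Suc N) (of_real t)))\<^sup>2)) \<noteq> \<infinity>"
    by (intro nn_integral_PInf_AE) auto
  then show ?thesis
  proof eventually_elim
    case (elim t)
    define S where "S = (\<Sum>N. ennreal (q N) * ennreal ((cmod (fm (Suc N) (of_real t)))\<^sup>2))"
    obtain B where B: "0 \<le> B" "S = ennreal B" using elim by (cases S) (auto simp: S_def)
    have "cmod (fm (Suc N) (of_real t)) \<le> sqrt B * real (Suc N)" for N
    proof -
      have "ennreal (q N) * ennreal ((cmod (fm (Suc N) (of_real t)))\<^sup>2) \<le> S"
        unfolding S_def using sum_le_suminf[of "\<lambda>N. ennreal (q N) * ennreal ((cmod (fm (Suc N) (of_real t)))\<^sup>2)" "{N}"] by auto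
      then have "q N * (cmod (fm (Suc N) (of_real t)))\<^sup>2 \<le> B" using B q0 by (simp flip: ennreal_mult)
      then have "(cmod (fm (Suc N) (of_real t)))\<^sup>2 \<le> B * (real (Suc N))\<^sup>2"
        by (simp add: q_def pos_divide_le_eq del: of_nat_Suc)
      then have "sqrt ((cmod (fm (Suc N) (of_real t)))\<^sup>2) \<le> sqrt (B * (real (Suc N))\<^sup>2)" by (rule real_sqrt_le_mono)
      then show ?thesis by (simp add: real_sqrt_mult)
    qed
    then show ?case by blast
  qed
qed

end

section \<open>Support of the spectral measure and boundary values\<close>

lemma converges_locally_uniformly_pointwise:
  assumes "converges_locally_uniformly F f" "0 < Im z"
  shows "(\<lambda>j. F j z) \<longlonglongrightarrow> f z"
proof -
  have "compact {z} \<and> {z} \<subseteq> upper_half_plane" using assms(2) by simp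
  then have "uniform_limit {z} F f sequentially"
    using assms(1) unfolding converges_locally_uniformly_def by blast
  then show ?thesis by (rule tendsto_uniform_limitI) simp
qed

lemma converges_locally_uniformly_deriv:
  assumes "converges_locally_uniformly F f" "\<And>j. F j holomorphic_on upper_half_plane" "0 < Im z"
  shows "(\<lambda>j. deriv (F j) z) \<longlonglongrightarrow> deriv f z"
proof -
  have "z \<in> upper_half_plane" using assms(3) by simp
  then obtain r where r: "0 < r" "cball z r \<subseteq> upper_half_plane"
    using open_contains_cball[of upper_half_plane] open_upper_half_plane by blast
  have hol: "F j holomorphic_on ball z r" for j
    using holomorphic_on_subset[OF assms(2)] r ball_subset_cball[of z r] by (meson order_trans)
  have "uniform_limit (cball z r) F f sequentially"
    using assms(1) r unfolding converges_locally_uniformly_def by auto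
  then have "uniform_limit (ball z r) F f sequentially" by (rule uniform_limit_on_subset) auto
  then show ?thesis
    by (rule deriv_complex_uniform_limit)
       (use r hol in auto)
qed

lemma vertical_derivative:
  assumes "(f has_field_derivative D) (at (Complex t y))"
  shows "((\<lambda>u. Re (f (Complex t u))) has_real_derivative - Im D) (at y)"
proof -
  have "((\<lambda>u. complex_of_real t + \<i> * of_real u) has_vector_derivative \<i>) (at y)"
    by (auto intro!: derivative_eq_intros)
  then have "((\<lambda>u. Complex t u) has_vector_derivative \<i>) (at y)" by (simp add: Complex_eq)
  from field_vector_diff_chain_at[OF this] assms
  have "((f \<circ> Complex t) has_vector_derivative (\<i> * D)) (at y)" by simp
  then have "((\<lambda>u. Re ((f \<circ> Complex t) u)) has_vector_derivative Re (\<i> * D)) (at y)"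
    by (rule bounded_linear.has_vector_derivative[OF bounded_linear_Re])
  then show ?thesis by (simp add: has_real_derivative_iff_has_vector_derivative o_def)
qed

theorem theorem4p2:
  fixes a b :: "nat \<Rightarrow> real" and M A :: real
    and E :: "real \<Rightarrow> (nat \<Rightarrow> complex) \<Rightarrow> nat \<Rightarrow> complex"
    and Nj :: "nat \<Rightarrow> nat"
    and wp wm g :: "complex \<Rightarrow> complex"
    and \<nu> \<kappa> :: "real measure"
  assumes M_pos: "M > 0"
    and a_zero: "a 0 = 1"
    and a_bounds: "\<And>n. n \<ge> 1 \<Longrightarrow> 1 / (M + 1) \<le> a n \<and> a n \<le> M + 1"
    and b_bounds: "\<And>n. n \<ge> 1 \<Longrightarrow> \<bar>b n\<bar> \<le> M"
    and E_resolution: "spectral_resolution (jacobi a b) E"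
    and Nj_limit: "filterlim Nj at_top sequentially"
    and wp_herglotz: "herglotz wp"
    and wp_limit: "converges_locally_uniformly (\<lambda>j. w_plus_avg a b (Nj j)) wp"
    and wm_herglotz: "herglotz wm"
    and wm_limit: "converges_locally_uniformly (\<lambda>j. w_minus_avg a b (Nj j)) wm"
    and g_herglotz: "herglotz g"
    and g_limit: "converges_locally_uniformly (\<lambda>j. green_avg a b (Nj j)) g"
    and nu_prob: "prob_space \<nu>" "sets \<nu> = sets borel"
    and nu_limit: "weak_star_convergent (\<lambda>j. averaged_spectral_measure E (Nj j)) \<nu>"
    and kappa_prob: "prob_space \<kappa>" "sets \<kappa> = sets borel"
    and kappa_limit: "weak_star_convergent (\<lambda>j. eigenvalue_counting_measure a b (Nj j)) \<kappa>"
    and A_pos: "A > 0"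
    and A_limit: "(\<lambda>j. (\<Prod>n=1..Nj j. a n) powr (1 / real (Nj j))) \<longlonglongrightarrow> A"
  defines "\<rho> \<equiv> spectral_measure E"
    and "\<gamma> \<equiv> \<lambda>z. - Re (wp z)"
  defines "Z \<equiv> {t::real. boundary_value \<gamma> t = 0}"
  shows "(\<exists>N\<in>sets (borel :: real measure). log_capacity N = 0 \<and> supported_by \<rho> (Z \<union> N)) \<and>
    (\<forall>\<rho>ac \<Sigma>ac. is_ac_part \<rho> \<rho>ac \<and> essential_support \<rho>ac \<Sigma>ac \<longrightarrow>
       wp \<in> herglotz_N \<Sigma>ac \<and> wm \<in> herglotz_N \<Sigma>ac \<and> g \<in> herglotz_N \<Sigma>ac)"
proof -
  interpret J: bounded_jacobi a b M
    by unfold_locales (use M_pos a_zero a_bounds b_bounds in auto)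
  have "\<exists>c x. 0 < c \<and> J.fm_poly (Suc N) = Polynomial.smult (complex_of_real c) (\<Prod>i<N. [:- complex_of_real (x i), 1:])" for N
    by (rule J.fm_factorization[of N]) blast
  then obtain c0 x0 where cx0: "\<And>N. 0 < c0 N"
    "\<And>N. J.fm_poly (Suc N) = Polynomial.smult (complex_of_real (c0 N)) (\<Prod>i<N. [:- complex_of_real (x0 N i), 1:])"
    by metis
  have norm_fm: "cmod (f_minus a b (Suc N) z) = c0 N * (\<Prod>i<N. cmod (z - of_real (x0 N i)))" for N z
    by (rule J.fm_norm_factorization[OF cx0(2) cx0(1)])
  have inv_N: "(\<lambda>j. B / real (Nj j)) \<longlonglongrightarrow> 0" for B
    by (rule real_tendsto_divide_at_top[OF tendsto_const])
       (rule filterlim_compose[OF filterlim_real_sequentially Nj_limit])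
  have Re_wm: "Re (wm z) = \<gamma> z" if z: "0 < Im z" for z
  proof -
    obtain B where B: "\<And>N. \<bar>Re (w_plus_avg a b N z) + Re (w_minus_avg a b N z)\<bar> \<le> B / real N"
      using J.Re_w_sum_bounded[OF z] by blast
    have "(\<lambda>j. Re (w_plus_avg a b (Nj j) z) + Re (w_minus_avg a b (Nj j) z)) \<longlonglongrightarrow> 0"
      by (rule Lim_null_comparison[OF _ inv_N[of B]]) (use B in simp)
    moreover have "(\<lambda>j. Re (w_plus_avg a b (Nj j) z) + Re (w_minus_avg a b (Nj j) z)) \<longlonglongrightarrow> Re (wp z) + Re (wm z)"
      by (intro tendsto_intros converges_locally_uniformly_pointwise[OF wp_limit z] converges_locally_uniformly_pointwise[OF wm_limit z])
    ultimately have "Re (wp z) + Re (wm z) = 0" using LIMSEQ_unique by blast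
    then show ?thesis by (simp add: \<gamma>_def)
  qed
  have conv: "(\<lambda>j. ln (cmod (f_minus a b (Suc (Nj j)) z)) / real (Nj j)) \<longlonglongrightarrow> \<gamma> z" if z: "0 < Im z" for z
    unfolding Re_wm[OF z, symmetric] J.Re_w_minus_avg[OF z, symmetric]
    by (intro tendsto_intros converges_locally_uniformly_pointwise[OF wm_limit z])
  have nonneg: "0 \<le> \<gamma> z" if z: "0 < Im z" for z
  proof (rule LIMSEQ_le[OF inv_N conv[OF z]], intro exI allI impI)
    define m where "m = min 1 ((Im z / (M + 1))\<^sup>2)"
    have m: "0 < m" using z M_pos by (simp add: m_def)
    fix j
    have "ln m \<le> ln ((cmod (f_minus a b (Suc (Nj j)) z))\<^sup>2)"
      using J.fm_growth[OF z, of "Nj j"] m by (intro ln_mono) (auto simp: m_def)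
    also have "\<dots> = 2 * ln (cmod (f_minus a b (Suc (Nj j)) z))"
      using J.fm_nonzero[OF z, of "Suc (Nj j)"] by (simp add: ln_realpow)
    finally show "ln (min 1 ((Im z / (M + 1))\<^sup>2)) / 2 / real (Nj j) \<le> ln (cmod (f_minus a b (Suc (Nj j)) z)) / real (Nj j)"
      by (intro divide_right_mono) (auto simp: m_def)
  qed
  interpret P: averaged_log_products "\<lambda>j. c0 (Nj j)" "\<lambda>j. x0 (Nj j)" Nj \<gamma>
    by unfold_locales (use cx0 Nj_limit conv nonneg in \<open>auto simp: norm_fm\<close>)
  have bv: "boundary_value \<gamma> t = P.\<Gamma> t" for t
    unfolding boundary_value_def by (rule tendsto_Lim[OF _ P.tendsto_\<Gamma>]) simp
  have Z: "Z = {t. P.\<Gamma> t = 0}" by (simp add: Z_def bv)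
  have [measurable]: "Z \<in> sets borel" unfolding Z using P.\<Gamma>_measurable by simp
  define N where "N = {t. 0 < P.\<Gamma> t \<and> (\<exists>C. \<forall>j. c0 (Nj j) * (\<Prod>i<Nj j. \<bar>t - x0 (Nj j) i\<bar>) \<le> C * real (Suc (Nj j)))}"
  have N_meas [measurable]: "N \<in> sets borel" unfolding N_def by (rule P.exceptional_set_measurable)
  have capN: "log_capacity N = 0" unfolding N_def by (rule P.capacity_zero_polynomial_growth)
  have sets_rho: "sets \<rho> = sets borel" and space_rho: "space \<rho> = UNIV"
    by (simp_all add: \<rho>_def spectral_measure_def)
  have supp: "supported_by \<rho> (Z \<union> N)"
    unfolding supported_by_def
  proof
    show m: "Z \<union> N \<in> sets \<rho>" unfolding sets_rho by measurable
    have "AE t in \<rho>. t \<in> Z \<union> N"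
      using J.AE_growth[OF E_resolution] unfolding \<rho>_def[symmetric]
    proof eventually_elim
      case (elim t)
      then obtain C where C: "\<And>N. cmod (f_minus a b (Suc N) (of_real t)) \<le> C * real (Suc N)" by blast
      have "cmod (complex_of_real t - of_real s) = \<bar>t - s\<bar>" for s by (simp flip: of_real_diff)
      then have "c0 (Nj j) * (\<Prod>i<Nj j. \<bar>t - x0 (Nj j) i\<bar>) \<le> C * real (Suc (Nj j))" for j
        using C[of "Nj j"] by (simp only: norm_fm)
      then show ?case using P.\<Gamma>_nonneg[of t] by (cases "P.\<Gamma> t = 0") (auto simp: Z N_def)
    qed
    then show "emeasure \<rho> (space \<rho> - (Z \<union> N)) = 0"
    proof (rule AE_iff_measurable[THEN iffD1, rotated 2])
      show "space \<rho> - (Z \<union> N) \<in> sets \<rho>" using m by (rule sets.compl_sets)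
      show "{t \<in> space \<rho>. \<not> t \<in> Z \<union> N} = space \<rho> - (Z \<union> N)" by blast
    qed
  qed
  have g_eq: "g z = - deriv wm z" if z: "0 < Im z" for z
  proof -
    have hol: "w_minus_avg a b n holomorphic_on upper_half_plane" for n
      unfolding holomorphic_on_open[OF open_upper_half_plane] using J.w_minus_avg_derivative by (metis uhp_iff)
    have "(\<lambda>j. green_avg a b (Nj j) z + deriv (w_minus_avg a b (Nj j)) z) \<longlonglongrightarrow> g z + deriv wm z"
      by (intro tendsto_intros converges_locally_uniformly_pointwise[OF g_limit z]
            converges_locally_uniformly_deriv[OF wm_limit hol z])
    moreover have "(\<lambda>j. green_avg a b (Nj j) z + deriv (w_minus_avg a b (Nj j)) z) \<longlonglongrightarrow> 0"
      by (rule Lim_null_comparison[OF always_eventually inv_N[of "(M + 1)\<^sup>2 / (Im z) ^ 3"]])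
         (use J.green_avg_plus_deriv[OF z] DERIV_imp_deriv[OF J.w_minus_avg_derivative[OF z]] in auto)
    ultimately have "g z + deriv wm z = 0" using LIMSEQ_unique by blast
    then show ?thesis by (simp add: add_eq_0_iff)
  qed
  have wm_hol: "wm holomorphic_on upper_half_plane" and wp_hol: "wp holomorphic_on upper_half_plane"
    using wm_herglotz wp_herglotz by (auto simp: herglotz_def)
  have pos: "0 < \<gamma> z" if z: "0 < Im z" for z
  proof (rule ccontr)
    assume "\<not> 0 < \<gamma> z"
    then have 0: "\<gamma> z = 0" using nonneg[OF z] by simp
    define t y where "t = Re z" and "y = Im z"
    have ty: "z = Complex t y" "0 < y" using z by (simp_all add: t_def y_def)
    have "(wm has_field_derivative deriv wm z) (at (Complex t y))"
      unfolding ty(1)[symmetric] by (rule holomorphic_derivI[OF wm_hol open_upper_half_plane]) (use z in simp)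
    from vertical_derivative[OF this]
    have "((\<lambda>u. Re (wm (Complex t u))) has_real_derivative Im (g z)) (at y)" by (simp add: g_eq[OF z])
    \<comment> \<open>The exponent would have a minimum at height \<open>y\<close>, but its vertical derivative is \<open>Im g > 0\<close>.\<close>
    then have "Im (g z) = 0"
    proof (rule DERIV_local_min[OF _ ty(2)], intro allI impI)
      fix u assume "\<bar>y - u\<bar> < y"
      then have "0 < u" by simp
      then show "Re (wm (Complex t y)) \<le> Re (wm (Complex t u))"
        using 0 nonneg[of "Complex t u"] Re_wm[of "Complex t u"] Re_wm[of z] ty by simp
    qed
    moreover have "0 < Im (g z)" using g_herglotz z by (auto simp: herglotz_def image_subset_iff)
    ultimately show False by simp
  qed
  have hm: "herglotz (\<lambda>z. \<i> * wm z)" and hp: "herglotz (\<lambda>z. - \<i> * wp z)"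
    using pos Re_wm wm_hol wp_hol by (auto simp: herglotz_def \<gamma>_def intro!: holomorphic_intros)
  have AE_Z: "AE t in lborel. t \<in> Z \<longrightarrow> Re (boundary_value wp t) = 0 \<and> Re (boundary_value wm t) = 0 \<and> Re (boundary_value g t) = 0"
    using P.AE_linear_decay
  proof (eventually_elim, intro impI)
    case (elim t)
    assume "t \<in> Z"
    then obtain y C where y: "\<And>n. 0 < y n" "y \<longlonglongrightarrow> 0" "\<And>n. \<gamma> (Complex t (y n)) \<le> C * y n"
      using elim by (auto simp: Z)
    have bm: "Im (\<i> * wm (Complex t (y n))) \<le> C * y n" for n using y(3)[of n] y(1)[of n] by (simp add: Re_wm)
    have bp: "Im (- \<i> * wp (Complex t (y n))) \<le> C * y n" for n using y(3)[of n] by (simp add: \<gamma>_def)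
    obtain h0 c where hm0: "((\<lambda>y. \<i> * wm (Complex t y)) \<longlongrightarrow> complex_of_real h0) (at_right 0)"
      and dm0: "((\<lambda>y. deriv (\<lambda>z. \<i> * wm z) (Complex t y)) \<longlongrightarrow> complex_of_real c) (at_right 0)"
      by (rule julia_caratheodory_radial[OF hm y(1,2) bm])
    obtain h1 c1 where hp0: "((\<lambda>y. - \<i> * wp (Complex t y)) \<longlongrightarrow> complex_of_real h1) (at_right 0)"
      by (rule julia_caratheodory_radial[OF hp y(1,2) bp])
    have "((\<lambda>y. - \<i> * (\<i> * wm (Complex t y))) \<longlongrightarrow> - \<i> * of_real h0) (at_right 0)" by (intro tendsto_intros hm0)
    then have "((\<lambda>y. wm (Complex t y)) \<longlongrightarrow> - \<i> * of_real h0) (at_right 0)" by simp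
    then have 1: "boundary_value wm t = - \<i> * of_real h0" unfolding boundary_value_def by (intro tendsto_Lim) auto
    have "((\<lambda>y. \<i> * (- \<i> * wp (Complex t y))) \<longlongrightarrow> \<i> * of_real h1) (at_right 0)" by (intro tendsto_intros hp0)
    then have "((\<lambda>y. wp (Complex t y)) \<longlongrightarrow> \<i> * of_real h1) (at_right 0)" by simp
    then have 2: "boundary_value wp t = \<i> * of_real h1" unfolding boundary_value_def by (intro tendsto_Lim) auto
    have "((\<lambda>y. \<i> * deriv (\<lambda>z. \<i> * wm z) (Complex t y)) \<longlongrightarrow> \<i> * of_real c) (at_right 0)" by (intro tendsto_intros dm0)
    then have "((\<lambda>y. g (Complex t y)) \<longlongrightarrow> \<i> * of_real c) (at_right 0)"
    proof (rule Lim_transform_eventually)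
      show "\<forall>\<^sub>F y in at_right 0. \<i> * deriv (\<lambda>z. \<i> * wm z) (Complex t y) = g (Complex t y)"
        using eventually_at_right_less[of "0::real"]
      proof eventually_elim
        case (elim y)
        have "wm field_differentiable (at (Complex t y))"
          using holomorphic_on_imp_differentiable_at[OF wm_hol open_upper_half_plane] elim by simp
        then have "deriv (\<lambda>z. \<i> * wm z) (Complex t y) = \<i> * deriv wm (Complex t y)" by (rule deriv_cmult)
        then show ?case using elim by (simp add: g_eq)
      qed
    qed
    then have 3: "boundary_value g t = \<i> * of_real c" unfolding boundary_value_def by (intro tendsto_Lim) auto
    show "Re (boundary_value wp t) = 0 \<and> Re (boundary_value wm t) = 0 \<and> Re (boundary_value g t) = 0"
      unfolding 1 2 3 by simp
  qed
  have ac: "wp \<in> herglotz_N \<Sigma> \<and> wm \<in> herglotz_N \<Sigma> \<and> g \<in> herglotz_N \<Sigma>"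
    if "is_ac_part \<rho> \<alpha>" "essential_support \<alpha> \<Sigma>" for \<alpha> \<Sigma>
  proof -
    from that(1) obtain \<sigma> where sets_al: "sets \<alpha> = sets borel"
      and dec: "\<And>A. A \<in> sets borel \<Longrightarrow> emeasure \<rho> A = emeasure \<alpha> A + emeasure \<sigma> A"
      by (auto simp: is_ac_part_def)
    have space_al: "space \<alpha> = UNIV" using sets_eq_imp_space_eq[OF sets_al] by simp
    from that(2) have \<Sigma>: "\<Sigma> \<in> sets borel" "emeasure \<alpha> (UNIV - \<Sigma>) = 0"
      by (auto simp: essential_support_def supported_by_def sets_al space_al)
    \<comment> \<open>\<open>\<alpha>\<close> is still supported by the part of \<open>\<Sigma>\<close> inside \<open>Z \<union> N\<close>, so minimality makes the rest null.\<close>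
    define T where "T = \<Sigma> \<inter> (Z \<union> N)"
    have T: "T \<in> sets borel" using \<Sigma> by (simp add: T_def)
    have "emeasure \<alpha> (UNIV - (Z \<union> N)) = 0"
      using dec[of "UNIV - (Z \<union> N)"] supp by (simp add: supported_by_def space_rho)
    then have "emeasure \<alpha> ((UNIV - \<Sigma>) \<union> (UNIV - (Z \<union> N))) = 0"
      using \<Sigma> by (subst emeasure_Un_null_set) (auto simp: null_sets_def sets_al)
    moreover have "(UNIV - \<Sigma>) \<union> (UNIV - (Z \<union> N)) = UNIV - T" by (auto simp: T_def)
    ultimately have "supported_by \<alpha> T" using T by (simp add: supported_by_def sets_al space_al)
    then have "emeasure lborel (\<Sigma> - T) = 0" using that(2) by (auto simp: essential_support_def T_def)
    then have "AE t in lborel. t \<notin> \<Sigma> - T" using \<Sigma> T by (intro AE_not_in) (auto simp: null_sets_def)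
    moreover have "AE t in lborel. t \<notin> N"
      using capacity_zero_imp_lebesgue_null[OF N_meas capN] by (intro AE_not_in) (auto simp: null_sets_def)
    ultimately have "AE t in lborel. t \<in> \<Sigma> \<longrightarrow> Re (boundary_value wp t) = 0 \<and> Re (boundary_value wm t) = 0 \<and> Re (boundary_value g t) = 0"
      using AE_Z by eventually_elim (auto simp: T_def)
    then show ?thesis using wp_herglotz wm_herglotz g_herglotz by (auto simp: herglotz_N_def)
  qed
  show ?thesis using N_meas capN supp ac by blast
qed

end
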